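(* Let $w$ be a (non-trivial) solution of the variable coefficient thin obstacle problem $$\partial_i a^{ij}\partial_j w=0\ \text{ in }B_1^+,\qquad w\ge0,\ \ -\partial_{n+1}w\ge0,\ \ w\,\partial_{n+1}w=0\ \text{ on }B_1',$$ under the standing assumptions listed in the context, and let $0\in\Gamma_w$ with $\kappa_0<\infty$. Consider the rescaling $$w_\sigma(x)=\frac{w(\sigma x)}{\sigma^{-\frac{n+1}{2}}\|w\|_{L^2(B_\sigma^+)}}.$$ Then along a sequence $\{\sigma_j\}_{j\in\mathbb{N}}$ with $\sigma_j\to0$ one has $w_{\sigma_j}\to w_0$ in $L^2(B_1^+)$, where $w_0$ is a weak solution of the thin obstacle problem with constant coefficients $$\Delta w_0=0\ \text{ in }B_1^+,\qquad w_0\ge0,\ \ -\partial_{n+1}w_0\ge0,\ \ w_0\,\partial_{n+1}w_0=0\ \text{ on }B_1'.$$ Moreover $\|w_0\|_{L^2(B_1^+)}=1$; in particular, $w_0$ is not the trivial function.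
   Context: $n\ge1$, Einstein summation. $B_r^+(x_0)=\{x\in\mathbb{R}^{n+1}:x_{n+1}\ge0,\ |x-x_0|<r\}$ for $x_0=(x_0',0)$, $B_r^+=B_r^+(0)$, $B_r'=B_r^+\cap\{x_{n+1}=0\}$, $A_{r,R}^+(x_0)=B_R^+(x_0)\setminus B_r^+(x_0)$. The free boundary is $\Gamma_w=\partial_{B_1'}\{x\in B_1':w(x)>0\}$ (boundary relative to $B_1'$). Standing assumptions: (A0) $\|w\|_{L^2(B_1^+)}=1$; (A1) $a^{i,n+1}(x',0)=0$ on $\{x_{n+1}=0\}$ for $i=1,\dots,n$; (A2) $a^{ij}$ is symmetric and uniformly elliptic with eigenvalues in $[1/2,2]$; (A3) $a^{ij}\in W^{1,p}(B_1^+)$ for some $p\in(n+1,\infty]$; (A4) $a^{ij}(0)=\delta^{ij}$; (W) $w\in C^{1,\alpha}$ (locally up to $B_1'$) for some $\alpha\in(0,\frac12]$. The equation is understood weakly. Vanishing order: $$\kappa_{x_0}=\limsup_{r\to0_+}\frac{\ln\Big(\frac{1}{|A^+_{r/2,r}(x_0)|}\int_{A^+_{r/2,r}(x_0)}w^2\Big)^{1/2}}{\ln r}\in[-\infty,\infty].$$ *)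

theory Defs
  imports "HOL-Analysis.Analysis"
begin

text \<open>
  Points of R^(n+1) are vectors indexed by \<^typ>\<open>'n option\<close> with n = CARD('n): the index
  \<^term>\<open>Some i\<close> is a tangential direction, \<^term>\<open>None\<close> is the normal direction n+1.
\<close>

type_synonym 'n pt = "real ^ ('n option)"

definition half_ball :: "'n::finite pt \<Rightarrow> real \<Rightarrow> 'n pt set" where
  "half_ball x0 r = {x. 0 \<le> x $ None \<and> dist x x0 < r}"

definition thin_ball :: "'n::finite pt \<Rightarrow> real \<Rightarrow> 'n pt set" where
  "thin_ball x0 r = half_ball x0 r \<inter> {x. x $ None = 0}"

definition half_annulus :: "'n::finite pt \<Rightarrow> real \<Rightarrow> real \<Rightarrow> 'n pt set" where
  "half_annulus x0 r R = half_ball x0 R - half_ball x0 r"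

definition flat :: "real ^ 'n::finite \<Rightarrow> 'n pt" where
  "flat x' = (\<chi> i. case i of None \<Rightarrow> 0 | Some k \<Rightarrow> x' $ k)"


subsection \<open>Lebesgue spaces\<close>

definition Lspace :: "ereal \<Rightarrow> 'a::euclidean_space set \<Rightarrow> ('a \<Rightarrow> real) set" where
  "Lspace p S = {f \<in> borel_measurable (lebesgue_on S).
     if p = \<infinity> then (\<exists>C. AE x in lebesgue_on S. \<bar>f x\<bar> \<le> C)
     else integrable (lebesgue_on S) (\<lambda>x. \<bar>f x\<bar> powr real_of_ereal p)}"

definition L2norm :: "'a::euclidean_space set \<Rightarrow> ('a \<Rightarrow> real) \<Rightarrow> real" where
  "L2norm S f = sqrt (\<integral>x. (f x)\<^sup>2 \<partial>lebesgue_on S)"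

definition L2_converges ::
    "'a::euclidean_space set \<Rightarrow> (nat \<Rightarrow> 'a \<Rightarrow> real) \<Rightarrow> ('a \<Rightarrow> real) \<Rightarrow> bool" where
  "L2_converges S F f \<longleftrightarrow> (\<forall>k. F k \<in> Lspace 2 S) \<and> f \<in> Lspace 2 S \<and>
     (\<lambda>k. L2norm S (\<lambda>x. F k x - f x)) \<longlonglongrightarrow> 0"


subsection \<open>Classical and weak derivatives\<close>

text \<open>
  The derivative is taken within \<open>S\<close>. On a half ball, which contains its flat boundary, this is
  the classical gradient in the interior and has the one-sided normal derivative at flat points;
  \<open>C1_on S\<close> is then \<open>C\<^sup>1\<close> up to the flat boundary.
\<close>

definition grad :: "(real ^ 'm::finite) set \<Rightarrow> (real ^ 'm \<Rightarrow> real) \<Rightarrow> real ^ 'm \<Rightarrow> real ^ 'm" where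
  "grad S f x = (\<chi> i. frechet_derivative f (at x within S) (axis i 1))"

definition C1_on :: "(real ^ 'm::finite) set \<Rightarrow> (real ^ 'm \<Rightarrow> real) \<Rightarrow> bool" where
  "C1_on S f \<longleftrightarrow> f differentiable_on S \<and> continuous_on S (grad S f)"

definition C1_alpha_loc :: "real \<Rightarrow> (real ^ 'm::finite) set \<Rightarrow> (real ^ 'm \<Rightarrow> real) \<Rightarrow> bool" where
  "C1_alpha_loc \<alpha> S f \<longleftrightarrow> C1_on S f \<and>
     (\<forall>K. compact K \<and> K \<subseteq> S \<longrightarrow>
        (\<exists>C. \<forall>x\<in>K. \<forall>y\<in>K. norm (grad S f x - grad S f y) \<le> C * dist x y powr \<alpha>))"

text \<open>
  Test functions on an open set are continuously differentiable with compact support, as in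
  Gilbarg and Trudinger, Chapters 7 and 8. By mollification, smooth ones yield the same weak
  derivatives and weak solutions.
\<close>

definition test_functions :: "(real ^ 'm::finite) set \<Rightarrow> (real ^ 'm \<Rightarrow> real) set" where
  "test_functions U = {\<phi>. C1_on UNIV \<phi> \<and>
     compact (closure {x. \<phi> x \<noteq> 0}) \<and> closure {x. \<phi> x \<noteq> 0} \<subseteq> U}"

definition weak_partial ::
    "(real ^ 'm::finite) set \<Rightarrow> 'm \<Rightarrow> (real ^ 'm \<Rightarrow> real) \<Rightarrow> (real ^ 'm \<Rightarrow> real) \<Rightarrow> bool" where
  "weak_partial S i f g \<longleftrightarrow> (\<forall>\<phi>\<in>test_functions (interior S).
     (\<integral>x. f x * grad UNIV \<phi> x $ i \<partial>lebesgue_on S) = - (\<integral>x. g x * \<phi> x \<partial>lebesgue_on S))"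

definition W1_space :: "ereal \<Rightarrow> (real ^ 'm::finite) set \<Rightarrow> (real ^ 'm \<Rightarrow> real) set" where
  "W1_space p S = {f \<in> Lspace p S. \<forall>i. \<exists>g\<in>Lspace p S. weak_partial S i f g}"

text \<open>
  Weak form of \<open>\<partial>\<^sub>i F\<^sub>i = 0\<close>; the equation \<open>\<partial>\<^sub>i a\<^sup>i\<^sup>j \<partial>\<^sub>j w = 0\<close> is the case
  \<open>F = a \<nabla>w\<close>, Laplace's equation the case \<open>F = \<nabla>w\<close>.
\<close>

definition weakly_div_free :: "(real ^ 'm::finite) set \<Rightarrow> (real ^ 'm \<Rightarrow> real ^ 'm) \<Rightarrow> bool" where
  "weakly_div_free S F \<longleftrightarrow> (\<forall>\<phi>\<in>test_functions (interior S).
     (\<integral>x. F x \<bullet> grad UNIV \<phi> x \<partial>lebesgue_on S) = 0)"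


subsection \<open>The thin obstacle problem\<close>

text \<open>
  Solutions that are \<open>C\<^sup>1\<close> up to the flat boundary: the equation holds weakly, the boundary
  conditions hold pointwise.
\<close>

definition thin_obstacle_solution ::
    "('n::finite pt \<Rightarrow> real ^ ('n option) ^ ('n option)) \<Rightarrow> ('n pt \<Rightarrow> real) \<Rightarrow> bool" where
  "thin_obstacle_solution a w \<longleftrightarrow>
     weakly_div_free (half_ball 0 1) (\<lambda>x. a x *v grad (half_ball 0 1) w x) \<and>
     (\<forall>x\<in>thin_ball 0 1. 0 \<le> w x \<and> 0 \<le> - (grad (half_ball 0 1) w x $ None) \<and>
        w x * grad (half_ball 0 1) w x $ None = 0)"

text \<open>
  The trace on the flat boundary of a function \<open>w\<close> with weak gradient \<open>G\<close>: the limit of the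
  restrictions of approximating \<open>C\<^sup>1\<close> functions.
\<close>

definition flat_trace ::
    "('n::finite pt \<Rightarrow> real) \<Rightarrow> ('n pt \<Rightarrow> 'n pt) \<Rightarrow> (real ^ 'n \<Rightarrow> real) \<Rightarrow> bool" where
  "flat_trace w G T \<longleftrightarrow> (\<forall>r. 0 < r \<and> r < 1 \<longrightarrow> (\<exists>u.
     (\<forall>k. C1_on (half_ball 0 r) (u k)) \<and>
     L2_converges (half_ball 0 r) u w \<and>
     (\<forall>i. L2_converges (half_ball 0 r) (\<lambda>k x. grad (half_ball 0 r) (u k) x $ i) (\<lambda>x. G x $ i)) \<and>
     L2_converges (ball 0 r) (\<lambda>k x'. u k (flat x')) T))"

text \<open>
  Weak (\<open>H\<^sup>1\<close>) solutions of the thin obstacle problem for the Laplacian: \<open>w \<ge> 0\<close> on the flat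
  boundary holds for the trace, and, the outer normal being \<open>- e\<^sub>n\<^sub>+\<^sub>1\<close>, the normal derivative
  \<open>- \<partial>\<^sub>n\<^sub>+\<^sub>1 w\<close> is the functional \<open>\<psi> \<mapsto> \<integral> \<nabla>w \<bullet> \<nabla>\<psi>\<close> for \<open>\<psi>\<close> vanishing near the spherical part
  of the boundary. The last two conjuncts are the conditions \<open>- \<partial>\<^sub>n\<^sub>+\<^sub>1 w \<ge> 0\<close> (with \<open>\<psi> = \<phi> \<ge> 0\<close>)
  and \<open>w \<partial>\<^sub>n\<^sub>+\<^sub>1 w = 0\<close> (with \<open>\<psi> = w \<phi>\<close>); the test functions there need not vanish on the
  flat boundary.
\<close>

definition laplace_thin_obstacle_weak_solution :: "('n::finite pt \<Rightarrow> real) \<Rightarrow> bool" where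
  "laplace_thin_obstacle_weak_solution w \<longleftrightarrow>
     w \<in> Lspace 2 (half_ball 0 1) \<and>
     (\<exists>G. (\<forall>i. (\<lambda>x. G x $ i) \<in> Lspace 2 (half_ball 0 1) \<and>
               weak_partial (half_ball 0 1) i w (\<lambda>x. G x $ i)) \<and>
          weakly_div_free (half_ball 0 1) G \<and>
          (\<exists>T. flat_trace w G T \<and> (AE x' in lebesgue_on (ball 0 1). 0 \<le> T x')) \<and>
          (\<forall>\<phi>\<in>test_functions (ball 0 1). (\<forall>x. 0 \<le> \<phi> x) \<longrightarrow>
             0 \<le> (\<integral>x. G x \<bullet> grad UNIV \<phi> x \<partial>lebesgue_on (half_ball 0 1))) \<and>
          (\<forall>\<phi>\<in>test_functions (ball 0 1).
             (\<integral>x. G x \<bullet> (\<phi> x *\<^sub>R G x + w x *\<^sub>R grad UNIV \<phi> x) \<partial>lebesgue_on (half_ball 0 1)) = 0))"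

definition free_boundary :: "('n::finite pt \<Rightarrow> real) \<Rightarrow> 'n pt set" where
  "free_boundary w = top_of_set (thin_ball 0 1) frontier_of {x \<in> thin_ball 0 1. 0 < w x}"

text \<open>The logarithm with value \<open>-\<infinity>\<close> at 0, whereas \<^term>\<open>ln (0::real)\<close> is 0.\<close>

definition elog :: "real \<Rightarrow> ereal" where
  "elog t = (if t \<le> 0 then - \<infinity> else ereal (ln t))"

definition vanishing_order :: "('n::finite pt \<Rightarrow> real) \<Rightarrow> 'n pt \<Rightarrow> ereal" where
  "vanishing_order w x0 = Limsup (at_right 0) (\<lambda>r.
     elog (sqrt ((\<integral>x. (w x)\<^sup>2 \<partial>lebesgue_on (half_annulus x0 (r / 2) r)) /
                 measure lebesgue (half_annulus x0 (r / 2) r))) / ereal (ln r))"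

definition rescaling :: "('n::finite pt \<Rightarrow> real) \<Rightarrow> real \<Rightarrow> 'n pt \<Rightarrow> real" where
  "rescaling w \<sigma> x = w (\<sigma> *\<^sub>R x) /
     (\<sigma> powr (- (real CARD('n) + 1) / 2) * L2norm (half_ball 0 \<sigma>) w)"

end

theory Submission
  imports Defs "HOL-Complex_Analysis.Great_Picard" "HOL-Library.Diagonal_Subsequence"
begin

text \<open>
  Finite vanishing order bounds the integral of \<open>w\<^sup>2\<close> over half balls from below by a power of the
  radius. Hence it is doubling along some sequence of radii, and the rescalings at these radii
  are bounded in \<open>L\<^sup>2\<close> of the half ball of radius 2. Testing with cutoffs of \<open>w\<close> gives
  Caccioppoli's inequality, so that Rellich's theorem yields a subsequence converging in \<open>L\<^sup>2\<close>.

  The complementarity condition is quadratic in the gradient and needs strong convergence of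
  gradients. Since traces are nonnegative, two rescalings can be tested against each other, which
  bounds the energy of their difference by its \<open>L\<^sup>2\<close> norm and by the distance of the
  rescaled coefficients to the identity. So the gradients converge strongly as well, and all
  conditions pass to the limit. Near 0, continuity of the coefficients and \<open>a(0) = \<delta>\<^sup>i\<^sup>j\<close> provide
  the ellipticity.
\<close>

subsection \<open>Continuously differentiable functions on the half space\<close>

text \<open>The vanishing order is a limsup and \<open>ln r\<close> is negative, so its finiteness
  bounds the mass from below at every small radius. Against such a polynomial bound, doubling with a
  slightly larger power of 2 cannot fail at all small scales. This yields good radii below every
  threshold, hence a sequence only. Radius 2 leaves room inside for three successive losses of
  domain: gradients are bounded on radius 3/2, they are Cauchy on 5/4, and traces are Cauchy on 1.
  The main obstacle is that the weak equation admits only test functions supported in the open half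
  ball, whereas the boundary conditions concern functions that do not vanish on the flat part.
  \<open>flux_integral_nonneg\<close> bridges this gap, and every variational inequality below is an
  instance of it. All approximants are C1 up to the flat boundary, so Sobolev objects occur only in
  the limit, as a triple of L2 limits: function, gradient and trace. The normalisation gives every
  rescaling norm 1 on the unit half ball, and strong L2 convergence keeps it.\<close>

definition upper :: "'n::finite pt set" where
  "upper = {x. 0 \<le> x $ None}"

text \<open>
  The derivative is taken within the half space and not within \<open>S\<close>, so that it does not change
  when \<open>S\<close> is restricted to a smaller half ball.
\<close>

definition upper_C1 ::
    "'n::finite pt set \<Rightarrow> ('n pt \<Rightarrow> real) \<Rightarrow> ('n pt \<Rightarrow> 'n pt) \<Rightarrow> bool" where
  "upper_C1 S u g \<longleftrightarrow>
     (\<forall>x\<in>S. (u has_derivative (\<lambda>h. g x \<bullet> h)) (at x within upper)) \<and> continuous_on S g"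

lemma half_ball_eq: "half_ball x r = upper \<inter> ball x r"
  by (auto simp: half_ball_def upper_def dist_commute)

lemma mem_half_ball_0: "x \<in> half_ball 0 r \<longleftrightarrow> x \<in> upper \<and> norm x < r"
  by (auto simp: half_ball_eq)

lemma half_ball_upper: "half_ball 0 R \<subseteq> upper"
  by (auto simp: half_ball_eq)

lemma closed_upper [simp]: "closed (upper :: 'n::finite pt set)"
  unfolding upper_def by (intro closed_Collect_le continuous_intros)

lemma borel_upper [measurable, simp]: "(upper :: 'n::finite pt set) \<in> sets borel"
  by (rule borel_closed) simp

lemma borel_half_ball [measurable, simp]: "half_ball x r \<in> sets borel"
  by (simp add: half_ball_eq sets.Int)

lemma lmeasurable_half_ball: "half_ball x r \<in> lmeasurable"
  by (rule bounded_set_imp_lmeasurable)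
    (auto simp: half_ball_eq intro!: bounded_Int borel_upper)

lemma upper_add: "x \<in> upper \<Longrightarrow> y \<in> upper \<Longrightarrow> x + y \<in> upper"
  by (simp add: upper_def)

lemma upper_scaleR: "x \<in> upper \<Longrightarrow> 0 \<le> c \<Longrightarrow> c *\<^sub>R x \<in> upper"
  by (simp add: upper_def)

lemma half_ball_mono: "r \<le> R \<Longrightarrow> half_ball x r \<subseteq> half_ball x R"
  by (auto simp: half_ball_def)

lemma at_within_half_ball:
  assumes "x \<in> half_ball 0 r"
  shows "at x within half_ball 0 r = at x within upper"
  by (rule at_within_nhd[of _ "ball 0 r"]) (use assms in \<open>auto simp: half_ball_eq\<close>)

lemma interior_upper: "interior upper = {x::'n::finite pt. 0 < x $ None}"
proof -
  have "{x. x $ None \<ge> (0::real)} = {x::'n pt. axis None 1 \<bullet> x \<ge> 0}"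
    by (simp add: inner_axis')
  moreover have "interior {x::'n pt. axis None (1::real) \<bullet> x \<ge> 0} = {x. axis None 1 \<bullet> x > 0}"
    by (rule interior_halfspace_ge) (simp add: axis_eq_0_iff)
  ultimately show ?thesis
    by (simp add: upper_def inner_axis')
qed

lemma interior_half_ball: "interior (half_ball 0 r) = {x::'n::finite pt. 0 < x $ None \<and> norm x < r}"
  by (auto simp: half_ball_eq interior_upper)

text \<open>At a flat point the normal direction is available on one side only. The uniqueness
  criterion asks for just one small nonzero multiple of each basis vector, and positive multiples
  never leave the half space.\<close>

lemma upper_derivative_unique:
  fixes f :: "'n::finite pt \<Rightarrow> real"
  assumes "x \<in> upper" "(f has_derivative f') (at x within upper)"
    "(f has_derivative f'') (at x within upper)"
  shows "f' = f''"
proof (rule frechet_derivative_unique_within[OF assms(2,3)])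
  fix i :: "'n pt" and e :: real assume i: "i \<in> Basis" and e: "e > 0"
  then obtain k where k: "i = axis k 1"
    by (auto simp: Basis_vec_def)
  then show "\<exists>d. 0 < \<bar>d\<bar> \<and> \<bar>d\<bar> < e \<and> x + d *\<^sub>R i \<in> upper"
    using assms(1) e by (intro exI[of _ "e/2"]) (auto simp: upper_def axis_def)
qed

lemma upper_C1D:
  assumes "upper_C1 S u g" "x \<in> S"
  shows "(u has_derivative (\<lambda>h. g x \<bullet> h)) (at x within upper)"
  using assms by (auto simp: upper_C1_def)

lemma upper_C1_subset: "upper_C1 S u g \<Longrightarrow> T \<subseteq> S \<Longrightarrow> upper_C1 T u g"
  by (auto simp: upper_C1_def intro: continuous_on_subset)

lemma upper_C1_continuous:
  assumes "upper_C1 S u g" "S \<subseteq> upper"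
  shows "continuous_on S u"
  unfolding continuous_on_eq_continuous_within
proof
  fix x assume "x \<in> S"
  then have "(u has_derivative (\<lambda>h. g x \<bullet> h)) (at x within S)"
    using assms by (auto intro: has_derivative_subset dest: upper_C1D)
  then show "continuous (at x within S) u"
    by (rule has_derivative_continuous)
qed

text \<open>Ties the \<open>grad\<close> of the definitions to one fixed gradient, so that the same
  \<open>g\<close> serves for all smaller half balls.\<close>

lemma grad_half_ball_eq:
  assumes "upper_C1 (half_ball 0 R) u g" "r \<le> R" "x \<in> half_ball 0 r"
  shows "grad (half_ball 0 r) u x = g x"
proof -
  have x: "x \<in> half_ball 0 R" "x \<in> upper"
    using assms half_ball_mono[of r R] by (auto simp: half_ball_eq)
  have d: "(u has_derivative (\<lambda>h. g x \<bullet> h)) (at x within upper)"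
    using assms(1) x by (auto dest: upper_C1D)
  then have "(u has_derivative frechet_derivative u (at x within upper)) (at x within upper)"
    using frechet_derivative_works differentiableI by blast
  then have "frechet_derivative u (at x within upper) = (\<lambda>h. g x \<bullet> h)"
    by (rule upper_derivative_unique[OF x(2) _ d])
  then show ?thesis
    using assms(3) by (simp add: grad_def at_within_half_ball vec_eq_iff inner_axis)
qed

lemma C1_on_half_ball:
  assumes "upper_C1 (half_ball 0 R) u g" "r \<le> R"
  shows "C1_on (half_ball 0 r) u"
  unfolding C1_on_def
proof
  have sub: "half_ball 0 r \<subseteq> half_ball 0 R"
    using assms by (intro half_ball_mono)
  show "u differentiable_on half_ball 0 r"
    unfolding differentiable_on_def
    using assms(1) sub by (auto simp: at_within_half_ball intro!: differentiableI dest!: upper_C1D)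
  have "continuous_on (half_ball 0 r) g"
    using assms(1) sub by (auto simp: upper_C1_def intro: continuous_on_subset)
  then show "continuous_on (half_ball 0 r) (grad (half_ball 0 r) u)"
    by (rule continuous_on_eq) (simp add: grad_half_ball_eq[OF assms])
qed

lemma linear_eq_inner_axis:
  fixes f :: "real ^ 'm::finite \<Rightarrow> real"
  assumes "linear f"
  shows "f = (\<lambda>h. (\<chi> i. f (axis i 1)) \<bullet> h)"
proof
  fix h
  interpret linear f by fact
  have "f h = f (\<Sum>i\<in>UNIV. h $ i *\<^sub>R axis i 1)"
    using basis_expansion[of h] by (simp add: scalar_mult_eq_scaleR)
  also have "\<dots> = (\<Sum>i\<in>UNIV. h $ i * f (axis i 1))"
    by (simp add: sum scale)
  finally show "f h = (\<chi> i. f (axis i 1)) \<bullet> h"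
    by (simp add: inner_vec_def mult.commute)
qed

lemma upper_C1_grad:
  assumes "C1_on (half_ball 0 R) u"
  shows "upper_C1 (half_ball 0 R) u (grad (half_ball 0 R) u)"
  unfolding upper_C1_def
proof
  show "continuous_on (half_ball 0 R) (grad (half_ball 0 R) u)"
    using assms by (simp add: C1_on_def)
  show "\<forall>x\<in>half_ball 0 R. (u has_derivative (\<bullet>) (grad (half_ball 0 R) u x)) (at x within upper)"
  proof
    fix x :: "'a pt" assume x: "x \<in> half_ball 0 R"
    define D where "D = frechet_derivative u (at x within half_ball 0 R)"
    have D: "(u has_derivative D) (at x within half_ball 0 R)"
      using assms x frechet_derivative_works unfolding D_def C1_on_def differentiable_on_def by blast
    moreover have "D = (\<lambda>h. grad (half_ball 0 R) u x \<bullet> h)"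
      using linear_eq_inner_axis[OF has_derivative_linear[OF D]] by (simp add: grad_def D_def)
    ultimately show "(u has_derivative (\<bullet>) (grad (half_ball 0 R) u x)) (at x within upper)"
      using x by (simp add: at_within_half_ball)
  qed
qed

lemma grad_UNIV_eq:
  assumes "(f has_derivative (\<lambda>h. g \<bullet> h)) (at x)"
  shows "grad UNIV f x = g"
  by (simp add: grad_def frechet_derivative_at[OF assms, symmetric] inner_axis vec_eq_iff)

lemma C1_on_UNIV_derivative:
  assumes "C1_on UNIV f"
  shows "(f has_derivative (\<lambda>h. grad UNIV f x \<bullet> h)) (at x)"
proof -
  have D: "(f has_derivative frechet_derivative f (at x)) (at x)"
    using assms frechet_derivative_works by (auto simp: C1_on_def differentiable_on_def)
  show ?thesis
    using linear_eq_inner_axis[OF has_derivative_linear[OF D]] D by (simp add: grad_def)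
qed

lemma C1_on_UNIV_I:
  assumes "\<And>x. (f has_derivative (\<lambda>h. g x \<bullet> h)) (at x)" "continuous_on UNIV g"
  shows "C1_on UNIV f"
proof -
  have "grad UNIV f = g"
    using grad_UNIV_eq[OF assms(1)] by auto
  then show ?thesis
    using assms by (auto simp: C1_on_def differentiable_on_def intro: differentiableI)
qed

lemma grad_eq_0_outside_support:
  assumes "x \<notin> closure {x. f x \<noteq> 0}"
  shows "grad UNIV f x = 0"
proof (rule grad_UNIV_eq)
  have "((\<lambda>_. 0) has_derivative (\<lambda>h. 0 \<bullet> h)) (at x)"
    by simp
  then show "(f has_derivative (\<lambda>h. 0 \<bullet> h)) (at x)"
    by (rule has_derivative_transform_within_open[of _ _ _ _ "- closure {x. f x \<noteq> 0}"])
      (use assms closure_subset[of "{x. f x \<noteq> 0}"] in auto)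
qed

lemma test_function_eq_0:
  assumes "\<phi> \<in> test_functions U" "x \<notin> U"
  shows "\<phi> x = 0" "grad UNIV \<phi> x = 0"
proof -
  have "x \<notin> closure {x. \<phi> x \<noteq> 0}"
    using assms by (auto simp: test_functions_def)
  then show "grad UNIV \<phi> x = 0" "\<phi> x = 0"
    using closure_subset[of "{x. \<phi> x \<noteq> 0}"] by (auto intro: grad_eq_0_outside_support)
qed

lemma test_function_upper_C1:
  assumes "\<phi> \<in> test_functions U"
  shows "upper_C1 S \<phi> (grad UNIV \<phi>)"
  using assms C1_on_UNIV_derivative[of \<phi>]
  by (auto simp: test_functions_def upper_C1_def C1_on_def
      intro: has_derivative_at_withinI continuous_on_subset)

lemma upper_C1_mult:
  assumes "upper_C1 S u g" "upper_C1 S v k" "S \<subseteq> upper"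
  shows "upper_C1 S (\<lambda>x. u x * v x) (\<lambda>x. u x *\<^sub>R k x + v x *\<^sub>R g x)"
  unfolding upper_C1_def
proof
  show "continuous_on S (\<lambda>x. u x *\<^sub>R k x + v x *\<^sub>R g x)"
    using assms upper_C1_continuous[OF assms(1)] upper_C1_continuous[OF assms(2)]
    by (auto simp: upper_C1_def intro!: continuous_intros)
  show "\<forall>x\<in>S. ((\<lambda>x. u x * v x) has_derivative (\<bullet>) (u x *\<^sub>R k x + v x *\<^sub>R g x)) (at x within upper)"
  proof
    fix x assume "x \<in> S"
    then have "((\<lambda>x. u x * v x) has_derivative (\<lambda>h. u x * (k x \<bullet> h) + (g x \<bullet> h) * v x)) (at x within upper)"
      using assms by (intro has_derivative_mult) (auto dest: upper_C1D)
    then show "((\<lambda>x. u x * v x) has_derivative (\<bullet>) (u x *\<^sub>R k x + v x *\<^sub>R g x)) (at x within upper)"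
      by (rule has_derivative_eq_rhs) (auto simp: inner_add_left)
  qed
qed

lemma upper_C1_diff:
  assumes "upper_C1 S u g" "upper_C1 S v k"
  shows "upper_C1 S (\<lambda>x. u x - v x) (\<lambda>x. g x - k x)"
  using assms unfolding upper_C1_def
  by (auto intro!: continuous_intros has_derivative_eq_rhs[OF has_derivative_diff] simp: inner_diff_left)

lemma upper_C1_minus:
  assumes "upper_C1 S u g"
  shows "upper_C1 S (\<lambda>x. - u x) (\<lambda>x. - g x)"
  using assms unfolding upper_C1_def
  by (auto intro!: continuous_intros has_derivative_eq_rhs[OF has_derivative_minus] simp: inner_minus_left)

text \<open>Turns a function on the half ball into a candidate test function, for which
  differentiability on the whole space is required. Off \<open>U\<close> the point is interior and
  the one-sided derivative is a full one; on the open set \<open>U\<close> everything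
  vanishes.\<close>

lemma upper_C1_extend_UNIV:
  assumes v: "upper_C1 (half_ball 0 R) v g" and U: "open U" "- U \<subseteq> interior (half_ball 0 R)"
    and z: "\<And>x. x \<in> U \<Longrightarrow> v x = 0" "\<And>x. x \<in> U \<Longrightarrow> g x = 0"
  shows "(v has_derivative (\<bullet>) (g x)) (at x)" "continuous_on UNIV g"
proof -
  show "(v has_derivative (\<bullet>) (g x)) (at x)"
  proof (cases "x \<in> U")
    case True
    have "((\<lambda>_. 0) has_derivative (\<bullet>) (g x)) (at x)"
      by (rule has_derivative_eq_rhs[OF has_derivative_const]) (simp add: z(2)[OF True] fun_eq_iff)
    then show ?thesis
      by (rule has_derivative_transform_within_open[OF _ U(1) True]) (simp add: z)
  next
    case False
    then have x: "x \<in> half_ball 0 R" "x \<in> interior upper"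
      using U(2) interior_subset interior_mono[OF half_ball_upper] by blast+
    show ?thesis
      using upper_C1D[OF v x(1)] unfolding at_within_interior[OF x(2)] .
  qed
  have "continuous_on (interior (half_ball 0 R)) g"
    using v interior_subset by (auto simp: upper_C1_def intro: continuous_on_subset)
  moreover have "continuous_on U g"
    by (rule continuous_on_eq[of _ "\<lambda>_. 0"]) (use z in auto)
  ultimately have "continuous_on (interior (half_ball 0 R) \<union> U) g"
    using U(1) by (intro continuous_on_open_Un) auto
  moreover have "interior (half_ball 0 R) \<union> U = UNIV"
    using U(2) by auto
  ultimately show "continuous_on UNIV g"
    by simp
qed

subsection \<open>Integration over the half space\<close>

lemma integral_lebesgue_on_indicator:
  fixes f :: "'a::euclidean_space \<Rightarrow> real"
  assumes "S \<in> sets borel"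
  shows "integral\<^sup>L (lebesgue_on S) f = (\<integral>x. indicator S x * f x \<partial>lebesgue)"
    "integrable (lebesgue_on S) f \<longleftrightarrow> integrable lebesgue (\<lambda>x. indicator S x * f x)"
  using assms by (auto simp: integral_restrict_space integrable_restrict_space)

lemma integral_extend_support:
  fixes f :: "'a::euclidean_space \<Rightarrow> real"
  assumes "S \<in> sets borel" "T \<in> sets borel" "S \<subseteq> T" "\<And>x. x \<in> T - S \<Longrightarrow> f x = 0"
  shows "integral\<^sup>L (lebesgue_on S) f = integral\<^sup>L (lebesgue_on T) f"
    "integrable (lebesgue_on S) f \<longleftrightarrow> integrable (lebesgue_on T) f"
proof -
  have "(\<lambda>x. indicator S x * f x) = (\<lambda>x. indicator T x * f x)"
    using assms by (auto simp: fun_eq_iff indicator_def)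
  then show "integral\<^sup>L (lebesgue_on S) f = integral\<^sup>L (lebesgue_on T) f"
    "integrable (lebesgue_on S) f \<longleftrightarrow> integrable (lebesgue_on T) f"
    by (simp_all add: integral_lebesgue_on_indicator assms)
qed

text \<open>The half ball does not contain its spherical boundary, near which a continuous function
  may be unbounded. Vanishing beyond \<open>\<rho>\<close> reduces the claim to a compact set that
  does include the flat part.\<close>

lemma integrable_half_ball_support:
  fixes f :: "'n::finite pt \<Rightarrow> real"
  assumes f: "continuous_on (half_ball 0 R) f" and "\<rho> < R"
    and z: "\<And>x. x \<in> upper \<Longrightarrow> \<rho> \<le> norm x \<Longrightarrow> f x = 0"
  shows "integrable lborel (\<lambda>x. indicator upper x * f x)" "integrable (lebesgue_on upper) f"
proof -
  have sub: "upper \<inter> cball 0 \<rho> \<subseteq> half_ball 0 R"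
    using \<open>\<rho> < R\<close> by (auto simp: half_ball_eq)
  have "integrable lborel (\<lambda>x. indicator (upper \<inter> cball 0 \<rho>) x *\<^sub>R f x)"
    using continuous_on_subset[OF f sub] by (intro borel_integrable_compact) auto
  moreover have "(\<lambda>x. indicator (upper \<inter> cball 0 \<rho>) x *\<^sub>R f x) = (\<lambda>x. indicator upper x * f x)"
    using z by (auto simp: fun_eq_iff indicator_def)
  ultimately show *: "integrable lborel (\<lambda>x. indicator upper x * f x)"
    by simp
  then show "integrable (lebesgue_on upper) f"
    by (simp add: integral_lebesgue_on_indicator integrable_completion)
qed

lemma integral_upper_lborel:
  fixes f :: "'n::finite pt \<Rightarrow> real"
  assumes "(\<lambda>x. indicator upper x * f x) \<in> borel_measurable borel"
  shows "integral\<^sup>L (lebesgue_on upper) f = (\<integral>x. indicator upper x * f x \<partial>lborel)"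
  using assms by (simp add: integral_lebesgue_on_indicator integral_completion)

lemma integrable_half_ball_inner:
  fixes f :: "'n::finite pt \<Rightarrow> real"
  assumes f: "continuous_on (half_ball 0 R) f" and "r < R"
  shows "integrable (lebesgue_on (half_ball 0 r)) f"
proof -
  let ?K = "upper \<inter> cball 0 r :: 'n pt set"
  have sub: "?K \<subseteq> half_ball 0 R"
    using \<open>r < R\<close> by (auto simp: half_ball_eq)
  have "integrable lborel (\<lambda>x. indicator ?K x *\<^sub>R f x)"
    using continuous_on_subset[OF f sub] by (intro borel_integrable_compact) auto
  then have "integrable lborel (\<lambda>x. indicator (half_ball 0 r) x *\<^sub>R (indicator ?K x *\<^sub>R f x))"
    by (rule integrable_mult_indicator[rotated]) simp
  moreover have "(\<lambda>x. indicator (half_ball 0 r) x *\<^sub>R (indicator ?K x *\<^sub>R f x)) =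
      (\<lambda>x. indicator (half_ball 0 r) x * f x)"
    by (auto simp: fun_eq_iff indicator_def half_ball_eq)
  ultimately show ?thesis
    by (simp add: integral_lebesgue_on_indicator integrable_completion)
qed

subsection \<open>Cutoff functions\<close>

text \<open>The C1 spline equal to \<open>2 * t\<^sup>2\<close> on [0, 1/2] and
  \<open>1 - 2 * (1 - t)\<^sup>2\<close> on [1/2, 1]. Writing it as a second difference of truncated
  squares reduces its differentiability to that of a single function; its derivative is a tent with
  peak 2 at 1/2.\<close>

definition smooth_step :: "real \<Rightarrow> real" where
  "smooth_step t = 2 * ((max 0 t)\<^sup>2 - 2 * (max 0 (t - 1/2))\<^sup>2 + (max 0 (t - 1))\<^sup>2)"

definition smooth_step' :: "real \<Rightarrow> real" where
  "smooth_step' t = 4 * (max 0 t - 2 * max 0 (t - 1/2) + max 0 (t - 1))"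

lemma has_derivative_max_0_squared:
  "((\<lambda>t::real. (max 0 t)\<^sup>2) has_real_derivative 2 * max 0 t) (at t)"
proof (cases "t = 0")
  case True
  have "((\<lambda>t::real. (max 0 t)\<^sup>2) has_derivative (\<lambda>h. 0)) (at 0)"
  proof (rule has_derivativeI)
    have "((\<lambda>h::real. \<bar>h\<bar>) \<longlongrightarrow> 0) (at 0)"
      by (rule tendsto_eq_intros refl | simp)+
    then show "((\<lambda>y. ((max 0 y)\<^sup>2 - (max 0 0)\<^sup>2 - 0) /\<^sub>R norm (y - 0)) \<longlongrightarrow> (0::real)) (at 0)"
      by (rule Lim_null_comparison[rotated])
        (auto simp: max_def power2_eq_square eventually_at_filter)
  qed simp
  then show ?thesis
    unfolding has_field_derivative_def True by (rule has_derivative_eq_rhs) auto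
next
  case False
  show ?thesis
  proof (cases "t > 0")
    case True
    have "((\<lambda>t::real. t\<^sup>2) has_real_derivative 2 * t) (at t)"
      by (auto intro!: derivative_eq_intros)
    then have "((\<lambda>t::real. (max 0 t)\<^sup>2) has_real_derivative 2 * t) (at t)"
      by (rule has_field_derivative_transform_within_open[of _ _ _ "{0<..}"]) (use True in auto)
    then show ?thesis
      using True by simp
  next
    case f: False
    have "((\<lambda>t::real. 0) has_real_derivative 0) (at t)"
      by simp
    then have "((\<lambda>t::real. (max 0 t)\<^sup>2) has_real_derivative 0) (at t)"
      by (rule has_field_derivative_transform_within_open[of _ _ _ "{..<0}"]) (use f False in auto)
    then show ?thesis
      using f by simp
  qed
qed

lemma smooth_step_derivative:
  "(smooth_step has_real_derivative smooth_step' t) (at t)"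
proof -
  have *: "((\<lambda>t::real. (max 0 (t - c))\<^sup>2) has_real_derivative 2 * max 0 (t - c)) (at t)" for c
    using DERIV_chain2[OF has_derivative_max_0_squared, of "\<lambda>t. t - c" 1 t UNIV]
    by (simp add: DERIV_cdivide derivative_intros DERIV_diff[OF DERIV_ident DERIV_const, simplified])
  have "((\<lambda>t. 2 * ((max 0 (t - 0))\<^sup>2 - 2 * (max 0 (t - 1/2))\<^sup>2 + (max 0 (t - 1))\<^sup>2))
      has_real_derivative smooth_step' t) (at t)"
    by (rule derivative_eq_intros * refl)+ (simp add: smooth_step'_def)
  then show ?thesis
    by (simp add: smooth_step_def[abs_def])
qed

lemma continuous_on_smooth_step' [continuous_intros]:
  "continuous_on S f \<Longrightarrow> continuous_on S (\<lambda>x. smooth_step' (f x))"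
  unfolding smooth_step'_def by (intro continuous_intros)

lemma smooth_step_values:
  "t \<le> 0 \<Longrightarrow> smooth_step t = 0" "1 \<le> t \<Longrightarrow> smooth_step t = 1"
  "t \<le> 0 \<Longrightarrow> smooth_step' t = 0" "1 \<le> t \<Longrightarrow> smooth_step' t = 0"
  by (auto simp: smooth_step_def smooth_step'_def max_def power2_eq_square field_simps)

lemma smooth_step'_bounds: "0 \<le> smooth_step' t" "smooth_step' t \<le> 2"
  by (auto simp: smooth_step'_def max_def)

lemma smooth_step_bounds: "0 \<le> smooth_step t" "smooth_step t \<le> 1"
proof -
  have mono: "smooth_step a \<le> smooth_step b" if "a \<le> b" for a b
    using DERIV_nonneg_imp_nondecreasing[OF that] smooth_step_derivative smooth_step'_bounds(1)
    by blast
  show "0 \<le> smooth_step t"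
    using mono[of "min t 0" t] by (simp add: smooth_step_values)
  show "smooth_step t \<le> 1"
    using mono[of t "max t 1"] by (simp add: smooth_step_values)
qed

text \<open>The step is composed with an affine function of the squared norm, which unlike the norm
  is differentiable at the origin. Its gradient is \<open>2 / q\<close> times \<open>x\<close>, so
  slope at most 2 and \<open>norm x < R\<close> give the bound \<open>4 / q * R\<close>.\<close>

lemma radial_cutoff:
  assumes "0 \<le> r" "r < R"
  obtains \<eta> :: "'n::finite pt \<Rightarrow> real" and \<zeta> C where
    "\<And>S. upper_C1 S \<eta> \<zeta>" "\<And>x. 0 \<le> \<eta> x \<and> \<eta> x \<le> 1" "\<And>x. norm x \<le> r \<Longrightarrow> \<eta> x = 1"
    "\<And>x. R \<le> norm x \<Longrightarrow> \<eta> x = 0" "\<And>x. R \<le> norm x \<Longrightarrow> \<zeta> x = 0"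
    "\<And>x. norm (\<zeta> x) \<le> C" "0 \<le> C"
proof -
  define q where "q = R\<^sup>2 - r\<^sup>2"
  have q: "q > 0"
    using assms by (simp add: q_def power_strict_mono)
  define \<tau> where "\<tau> x = (x \<bullet> x - r\<^sup>2) / q" for x :: "'n pt"
  define \<eta> where "\<eta> x = 1 - smooth_step (\<tau> x)" for x
  define \<zeta> where "\<zeta> x = (- smooth_step' (\<tau> x) * 2 / q) *\<^sub>R x" for x
  have tau1: "\<tau> x \<ge> 1" if "R \<le> norm x" for x
  proof -
    have "R\<^sup>2 \<le> x \<bullet> x"
      using that assms by (auto simp: dot_square_norm intro!: power_mono)
    then show ?thesis
      using q by (simp add: \<tau>_def q_def)
  qed
  have tau0: "\<tau> x \<le> 0" if "norm x \<le> r" for x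
  proof -
    have "x \<bullet> x \<le> r\<^sup>2"
      using that assms by (auto simp: dot_square_norm intro!: power_mono)
    then show ?thesis
      using q by (simp add: \<tau>_def divide_le_0_iff)
  qed
  have \<tau>d: "(\<tau> has_derivative (\<lambda>h. 2 * (x \<bullet> h) / q)) (at x)" for x
    unfolding \<tau>_def using q
    by (auto intro!: derivative_eq_intros simp: inner_commute field_simps)
  have d: "(\<eta> has_derivative (\<bullet>) (\<zeta> x)) (at x)" for x
  proof -
    have "((\<lambda>x. smooth_step (\<tau> x)) has_derivative (\<lambda>h. 2 * (x \<bullet> h) / q * smooth_step' (\<tau> x))) (at x)"
      using DERIV_compose_FDERIV[OF smooth_step_derivative \<tau>d] by blast
    then show ?thesis
      unfolding \<eta>_def
      by (auto intro!: derivative_eq_intros simp: \<zeta>_def)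
  qed
  have c: "continuous_on S \<zeta>" for S
    unfolding \<zeta>_def \<tau>_def using q by (intro continuous_intros) auto
  have bnd: "norm (\<zeta> x) \<le> 4 / q * R" for x
  proof (cases "R \<le> norm x")
    case True
    then show ?thesis
      using tau1[OF True] q assms by (simp add: \<zeta>_def smooth_step_values)
  next
    case False
    have "norm (\<zeta> x) = smooth_step' (\<tau> x) * 2 / q * norm x"
      using q smooth_step'_bounds[of "\<tau> x"] by (simp add: \<zeta>_def abs_mult)
    also have "\<dots> \<le> 2 * 2 / q * R"
      using q smooth_step'_bounds[of "\<tau> x"] False assms
      by (intro mult_mono divide_right_mono) auto
    finally show ?thesis
      by simp
  qed
  show thesis
  proof (rule that[of \<eta> \<zeta> "4 / q * R"])
    show "upper_C1 S \<eta> \<zeta>" for S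
      using c d by (auto simp: upper_C1_def intro: has_derivative_at_withinI)
    show "0 \<le> \<eta> x \<and> \<eta> x \<le> 1" for x
      using smooth_step_bounds by (simp add: \<eta>_def)
    show "norm x \<le> r \<Longrightarrow> \<eta> x = 1" for x
      using tau0 by (simp add: \<eta>_def smooth_step_values)
    show "R \<le> norm x \<Longrightarrow> \<eta> x = 0" "R \<le> norm x \<Longrightarrow> \<zeta> x = 0" for x
      using tau1 by (simp_all add: \<eta>_def \<zeta>_def smooth_step_values)
  qed (use bnd q assms in auto)
qed

subsection \<open>Integration by parts up to the flat boundary\<close>

text \<open>A box around a thin layer over the flat ball. What matters is that its volume is linear
  in \<open>\<epsilon>\<close>, which compensates a cutoff of slope proportional to
  \<open>1 / \<epsilon>\<close>.\<close>

lemma measure_flat_strip: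
  fixes \<rho> \<epsilon> :: real
  assumes "0 \<le> \<rho>" "0 \<le> \<epsilon>"
  defines "c \<equiv> cbox (\<chi> i. case i of None \<Rightarrow> 0 | Some _ \<Rightarrow> - \<rho>)
      ((\<chi> i. case i of None \<Rightarrow> \<epsilon> | Some _ \<Rightarrow> \<rho>) :: 'n::finite pt)"
  shows "measure lebesgue c = \<epsilon> * (2 * \<rho>) ^ CARD('n)"
    "\<And>x. 0 \<le> x $ None \<Longrightarrow> x $ None \<le> \<epsilon> \<Longrightarrow> norm x \<le> \<rho> \<Longrightarrow> x \<in> c"
proof -
  have ne: "(\<chi> i. case i of None \<Rightarrow> 0 | Some _ \<Rightarrow> - \<rho>) \<in> c"
    using assms by (auto simp: mem_box_cart split: option.splits)
  then have "measure lborel c = (\<Prod>i\<in>UNIV. (case i of None \<Rightarrow> \<epsilon> | Some _ \<Rightarrow> \<rho>) -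
      (case i of None \<Rightarrow> 0 | Some (_::'n) \<Rightarrow> - \<rho>))"
    unfolding c_def by (subst content_cbox_cart) auto
  also have "\<dots> = \<epsilon> * (2 * \<rho>) ^ CARD('n)"
    by (simp add: UNIV_option_conv prod.reindex)
  finally show "measure lebesgue c = \<epsilon> * (2 * \<rho>) ^ CARD('n)"
    by (simp add: c_def)
  show "x \<in> c" if "0 \<le> x $ None" "x $ None \<le> \<epsilon>" "norm x \<le> \<rho>" for x
  proof -
    have "\<bar>x $ i\<bar> \<le> \<rho>" for i
      using component_le_norm_cart[of x i] that by simp
    then show ?thesis
      using that by (auto simp: c_def mem_box_cart abs_le_iff minus_le_iff split: option.splits)
  qed
qed

text \<open>The points of the closed inner half ball with \<open>f x \<ge> \<delta>\<close> form a
  compact set that misses the flat boundary, so the normal coordinate has a positive minimum there;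
  half of it is a safe height.\<close>

lemma compact_flat_bound:
  fixes f :: "'n::finite pt \<Rightarrow> real"
  assumes f: "continuous_on (half_ball 0 R) f" and "\<rho> < R" and "0 < \<delta>"
    and flat: "\<And>x. x \<in> thin_ball 0 R \<Longrightarrow> f x \<le> 0"
  obtains \<epsilon>0 where "0 < \<epsilon>0" "\<And>x. 0 \<le> x $ None \<Longrightarrow> x $ None \<le> \<epsilon>0 \<Longrightarrow> norm x \<le> \<rho> \<Longrightarrow> f x \<le> \<delta>"
proof -
  define K where "K = upper \<inter> cball (0::'n pt) \<rho> \<inter> f -` {\<delta>..}"
  have sub: "upper \<inter> cball 0 \<rho> \<subseteq> (half_ball 0 R :: 'n pt set)"
    using \<open>\<rho> < R\<close> by (auto simp: half_ball_eq)
  have "closed (upper \<inter> cball (0::'n pt) \<rho>)"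
    by auto
  then have "closed K"
    unfolding K_def using continuous_on_subset[OF f sub]
    by (intro continuous_closed_preimage) auto
  then have cK: "compact K"
    unfolding K_def by (metis bounded_Int bounded_cball compact_eq_bounded_closed inf_commute)
  show thesis
  proof (cases "K = {}")
    case True
    then show thesis
      by (intro that[of 1]) (auto simp: K_def upper_def dist_norm)
  next
    case False
    have "continuous_on K (\<lambda>x. x $ None)"
      by (intro continuous_intros)
    then obtain y where y: "y \<in> K" "\<And>x. x \<in> K \<Longrightarrow> y $ None \<le> x $ None"
      using continuous_attains_inf[OF cK False] by blast
    have "y $ None \<noteq> 0"
    proof
      assume "y $ None = 0"
      then have "y \<in> thin_ball 0 R"
        using y(1) sub by (auto simp: K_def thin_ball_def)
      then show False
        using flat[of y] y(1) \<open>0 < \<delta>\<close> by (auto simp: K_def)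
    qed
    then have y0: "y $ None > 0"
      using y(1) by (auto simp: K_def upper_def)
    show thesis
    proof (rule that[of "y $ None / 2"])
      show "f x \<le> \<delta>" if "0 \<le> x $ None" "x $ None \<le> y $ None / 2" "norm x \<le> \<rho>" for x
      proof (rule ccontr)
        assume "\<not> f x \<le> \<delta>"
        then have "x \<in> K"
          using that by (auto simp: K_def upper_def)
        then show False
          using y(2)[of x] that y0 by simp
      qed
    qed (use y0 in auto)
  qed
qed

text \<open>
  Test with \<open>\<beta>(x\<^sub>n\<^sub>+\<^sub>1 / \<epsilon>) \<phi>\<close>: the normal derivative of the cutoff has size \<open>1 / \<epsilon>\<close> on a strip of
  volume \<open>O(\<epsilon>)\<close>, on which \<open>F\<^sub>n\<^sub>+\<^sub>1 \<phi>\<close> is at most \<open>o(1)\<close> by continuity.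
\<close>
lemma flux_integral_nonneg:
  fixes F :: "'n::finite pt \<Rightarrow> 'n pt"
  assumes F: "continuous_on (half_ball 0 R) F" "weakly_div_free (half_ball 0 R) F"
    and \<phi>: "upper_C1 (half_ball 0 R) \<phi> \<psi>"
    and \<rho>: "0 \<le> \<rho>" "\<rho> < R"
    and z: "\<And>x. x \<in> upper \<Longrightarrow> \<rho> \<le> norm x \<Longrightarrow> \<phi> x = 0" "\<And>x. x \<in> upper \<Longrightarrow> \<rho> \<le> norm x \<Longrightarrow> \<psi> x = 0"
    and flat: "\<And>x. x \<in> thin_ball 0 R \<Longrightarrow> F x $ None * \<phi> x \<le> 0"
  shows "0 \<le> (\<integral>x. F x \<bullet> \<psi> x \<partial>lebesgue_on upper)"
proof -
  have sub: "upper \<inter> cball 0 \<rho> \<subseteq> (half_ball 0 R :: 'n pt set)"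
    using \<open>\<rho> < R\<close> by (auto simp: half_ball_eq)
  have subU: "half_ball 0 R \<subseteq> (upper :: 'n pt set)"
    by (auto simp: half_ball_eq)
  have c\<phi>: "continuous_on (half_ball 0 R) \<phi>" and c\<psi>: "continuous_on (half_ball 0 R) \<psi>"
    using upper_C1_continuous[OF \<phi> subU] \<phi> by (auto simp: upper_C1_def)
  have cF\<psi>: "continuous_on (half_ball 0 R) (\<lambda>x. F x \<bullet> \<psi> x)"
    using F(1) c\<psi> by (intro continuous_intros)
  have "compact (upper \<inter> cball (0::'n pt) \<rho>)"
    by (simp add: closed_Int_compact)
  then have "bounded ((\<lambda>x. F x \<bullet> \<psi> x) ` (upper \<inter> cball (0::'n pt) \<rho>))"
    using continuous_on_subset[OF cF\<psi> sub] by (intro compact_imp_bounded compact_continuous_image)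
  then obtain M where M: "0 < M" "\<And>x. x \<in> upper \<inter> cball 0 \<rho> \<Longrightarrow> \<bar>F x \<bullet> \<psi> x\<bar> \<le> M"
    by (auto simp: bounded_pos)
  define k where "k = (2 * \<rho>) ^ CARD('n)"
  have k0: "k \<ge> 0"
    using \<rho> by (simp add: k_def)
  have cF\<phi>: "continuous_on (half_ball 0 R) (\<lambda>x. F x $ None * \<phi> x)"
    using F(1) c\<phi> by (intro continuous_intros)
  have int1: "integrable (lebesgue_on upper) (\<lambda>x. F x \<bullet> \<psi> x)"
    using z by (intro integrable_half_ball_support(2)[OF cF\<psi> \<rho>(2)]) auto
  have key: "- (2 * M * k + 4 * k) * \<delta> \<le> (\<integral>x. F x \<bullet> \<psi> x \<partial>lebesgue_on upper)" if \<delta>: "\<delta> > 0" for \<delta>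
  proof -
    obtain \<epsilon>0 where \<epsilon>0: "0 < \<epsilon>0" "\<And>x. 0 \<le> x $ None \<Longrightarrow> x $ None \<le> \<epsilon>0 \<Longrightarrow> norm x \<le> \<rho> \<Longrightarrow> F x $ None * \<phi> x \<le> \<delta>"
      using compact_flat_bound[OF cF\<phi> \<rho>(2) \<delta>] flat by blast
    \<comment> \<open>The transition layer reaches up to height \<open>2 * \<epsilon>\<close>, where
      the bound on the normal flux must still hold; \<open>\<epsilon> \<le> \<delta>\<close> makes
      the bounded part of the error O(\<open>\<delta>\<close>) too.\<close>
    define \<epsilon> where "\<epsilon> = min (\<epsilon>0 / 2) \<delta>"
    have \<epsilon>: "0 < \<epsilon>" "2 * \<epsilon> \<le> \<epsilon>0" "\<epsilon> \<le> \<delta>"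
      using \<epsilon>0(1) \<delta> by (auto simp: \<epsilon>_def)
    \<comment> \<open>The shift by 1 makes \<open>\<beta>\<close> vanish up to height
      \<open>\<epsilon>\<close>, so the support stays away from the flat boundary; from height
      \<open>2 * \<epsilon>\<close> on it equals 1.\<close>
    define \<beta> where "\<beta> x = smooth_step (x $ None / \<epsilon> - 1)" for x :: "'n pt"
    define \<beta>' where "\<beta>' x = smooth_step' (x $ None / \<epsilon> - 1) / \<epsilon>" for x :: "'n pt"
    define \<Phi> where "\<Phi> x = \<beta> x * \<phi> x" for x
    define \<Psi> where "\<Psi> x = \<beta> x *\<^sub>R \<psi> x + \<phi> x *\<^sub>R (\<beta>' x *\<^sub>R axis None 1)" for x
    have \<beta>C: "upper_C1 (half_ball 0 R) \<beta> (\<lambda>x. \<beta>' x *\<^sub>R axis None 1)"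
      unfolding upper_C1_def
    proof (intro conjI ballI)
      fix x :: "'n pt"
      have "((\<lambda>x::'n pt. x $ None / \<epsilon> - 1) has_derivative (\<lambda>h. h $ None / \<epsilon>)) (at x)"
        using \<epsilon>(1) by (auto intro!: derivative_eq_intros bounded_linear_imp_has_derivative)
      then have "(\<beta> has_derivative (\<lambda>h. h $ None / \<epsilon> * smooth_step' (x $ None / \<epsilon> - 1))) (at x)"
        unfolding \<beta>_def by (rule DERIV_compose_FDERIV[OF smooth_step_derivative])
      then show "(\<beta> has_derivative (\<bullet>) (\<beta>' x *\<^sub>R axis None 1)) (at x within upper)"
        by (rule has_derivative_eq_rhs[OF has_derivative_at_withinI]) (auto simp: \<beta>'_def inner_axis')
    qed (use \<epsilon> in \<open>auto simp: \<beta>'_def intro!: continuous_intros\<close>)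
    have \<Phi>C: "upper_C1 (half_ball 0 R) \<Phi> \<Psi>"
      unfolding \<Phi>_def \<Psi>_def by (rule upper_C1_mult[OF \<beta>C \<phi> subU])
    \<comment> \<open>\<open>U\<close> contains the lower half space, where nothing is known about
      \<open>\<phi>\<close> but \<open>\<beta>\<close> vanishes.\<close>
    define U where "U = {x::'n pt. x $ None < \<epsilon>} \<union> {x. \<rho> < norm x}"
    have oU: "open U"
      unfolding U_def by (intro open_Un open_Collect_less continuous_intros)
    have \<beta>0: "\<beta> x = 0" "\<beta>' x = 0" if "x $ None \<le> \<epsilon>" for x
      using that \<epsilon> by (auto simp: \<beta>_def \<beta>'_def smooth_step_values)
    have U0: "\<Phi> x = 0 \<and> \<Psi> x = 0" if "x \<in> U" for x
    proof (cases "x $ None \<le> \<epsilon>")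
      case False
      then have "x \<in> upper" "\<rho> \<le> norm x"
        using that \<epsilon> by (auto simp: upper_def U_def)
      then show ?thesis
        using z by (simp add: \<Phi>_def \<Psi>_def)
    qed (simp add: \<beta>0 \<Phi>_def \<Psi>_def)
    have cover: "x \<in> interior (half_ball 0 R)" if "x \<notin> U" for x
      using that \<epsilon> \<rho> by (auto simp: U_def interior_half_ball)
    have d\<Phi>: "(\<Phi> has_derivative (\<bullet>) (\<Psi> x)) (at x)" and c\<Psi>: "continuous_on UNIV \<Psi>" for x
      using U0 cover by (auto intro!: upper_C1_extend_UNIV[OF \<Phi>C oU])
    have supp: "closure {x. \<Phi> x \<noteq> 0} \<subseteq> - U"
      using U0 oU by (intro closure_minimal) auto
    have "- U \<subseteq> cball 0 \<rho>"
      by (auto simp: U_def)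
    then have "compact (closure {x. \<Phi> x \<noteq> 0})"
      using supp by (meson bounded_cball bounded_subset closed_closure compact_eq_bounded_closed subset_trans)
    then have "\<Phi> \<in> test_functions (interior (half_ball 0 R))"
      using supp cover C1_on_UNIV_I[OF d\<Phi> c\<Psi>] by (auto simp: test_functions_def)
    moreover have "grad UNIV \<Phi> = \<Psi>"
      using grad_UNIV_eq[OF d\<Phi>] by auto
    ultimately have "(\<integral>x. F x \<bullet> \<Psi> x \<partial>lebesgue_on (half_ball 0 R)) = 0"
      using F(2) by (auto simp: weakly_div_free_def)
    moreover have \<Psi>z: "\<Psi> x = 0" if "x \<in> upper" "\<rho> \<le> norm x" for x
      using z that by (simp add: \<Psi>_def)
    ultimately have zero: "(\<integral>x. F x \<bullet> \<Psi> x \<partial>lebesgue_on upper) = 0"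
      using \<rho> by (subst integral_extend_support[symmetric, of "half_ball 0 R"]) (auto simp: mem_half_ball_0 subU)
    have "continuous_on (half_ball 0 R) (\<lambda>x. F x \<bullet> \<Psi> x)"
      using F(1) continuous_on_subset[OF c\<Psi>] by (intro continuous_intros) auto
    then have int2: "integrable (lebesgue_on upper) (\<lambda>x. F x \<bullet> \<Psi> x)"
      using \<Psi>z \<rho>(2) by (intro integrable_half_ball_support(2)) auto
    define a :: "'n pt" where "a = (\<chi> i. case i of None \<Rightarrow> 0 | Some _ \<Rightarrow> - \<rho>)"
    define b :: "'n pt" where "b = (\<chi> i. case i of None \<Rightarrow> 2 * \<epsilon> | Some _ \<Rightarrow> \<rho>)"
    have meas: "measure lebesgue (cbox a b) = 2 * \<epsilon> * k"
      and strip: "\<And>x. 0 \<le> x $ None \<Longrightarrow> x $ None \<le> 2 * \<epsilon> \<Longrightarrow> norm x \<le> \<rho> \<Longrightarrow> x \<in> cbox a b"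
      using measure_flat_strip[of \<rho> "2 * \<epsilon>", where 'n = 'n] \<rho> \<epsilon>
      unfolding a_def b_def k_def by auto
    have nn: "- (M + 2 * \<delta> / \<epsilon>) * indicator (cbox a b) x \<le> 0" for x
      using M(1) \<open>\<delta> > 0\<close> \<epsilon>(1) add_pos_pos[of M "2 * \<delta> / \<epsilon>"]
      by (intro mult_nonpos_nonneg) auto
    \<comment> \<open>Inside the strip the difference is
      \<open>(1 - \<beta> x) * (F x \<bullet> \<psi> x)\<close>, of size at most \<open>M\<close>,
      minus the normal flux times \<open>\<phi> x * \<beta>' x\<close>. As \<open>\<beta>'\<close>
      lies between 0 and \<open>2 / \<epsilon>\<close>, the one-sided bound \<open>\<delta>\<close>
      suffices for the second term.\<close>
    have pw: "F x \<bullet> \<psi> x - F x \<bullet> \<Psi> x \<ge> - (M + 2 * \<delta> / \<epsilon>) * indicator (cbox a b) x" if x: "x \<in> upper" for x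
    proof (cases "\<rho> \<le> norm x")
      case True
      then have "F x \<bullet> \<psi> x - F x \<bullet> \<Psi> x = 0"
        using z \<Psi>z x by simp
      then show ?thesis
        using nn[of x] by linarith
    next
      case nx: False
      show ?thesis
      proof (cases "x $ None \<le> 2 * \<epsilon>")
        case False
        then have "x $ None / \<epsilon> - 1 \<ge> 1"
          using \<epsilon> by (simp add: field_simps)
        then have "\<Psi> x = \<psi> x"
          by (simp add: \<Psi>_def \<beta>_def \<beta>'_def smooth_step_values)
        then have "F x \<bullet> \<psi> x - F x \<bullet> \<Psi> x = 0"
          by simp
        then show ?thesis
          using nn[of x] by linarith
      next
        case True
        have x0: "0 \<le> x $ None"
          using x by (simp add: upper_def)
        have ib: "indicator (cbox a b) x = (1::real)"
          using strip[OF x0 True] nx by simp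
        have e: "F x \<bullet> \<psi> x - F x \<bullet> \<Psi> x = (1 - \<beta> x) * (F x \<bullet> \<psi> x) - F x $ None * \<phi> x * \<beta>' x"
          by (simp add: \<Psi>_def inner_add_right inner_axis algebra_simps)
        have "\<bar>(1 - \<beta> x) * (F x \<bullet> \<psi> x)\<bar> \<le> 1 * M"
          unfolding abs_mult using smooth_step_bounds M(2)[of x] x nx
          by (intro mult_mono) (auto simp: \<beta>_def)
        moreover have "F x $ None * \<phi> x * \<beta>' x \<le> \<delta> * \<beta>' x"
          using \<epsilon>0(2)[OF x0] True \<epsilon> nx smooth_step'_bounds
          by (intro mult_right_mono) (auto simp: \<beta>'_def)
        moreover have "\<delta> * \<beta>' x \<le> \<delta> * (2 / \<epsilon>)"
          using \<open>\<delta> > 0\<close> \<epsilon> smooth_step'_bounds by (intro mult_left_mono) (auto simp: \<beta>'_def divide_right_mono)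
        ultimately show ?thesis
          unfolding e ib by (auto simp: abs_le_iff)
      qed
    qed
    have cb: "cbox a b \<subseteq> upper"
      by (auto simp: upper_def mem_box_cart a_def dest!: spec[of _ None])
    have i3: "integrable (lebesgue_on upper) (\<lambda>x. indicator (cbox a b) x :: real)"
      and m3: "(\<integral>x. indicator (cbox a b) x \<partial>lebesgue_on upper) = 2 * \<epsilon> * k"
    proof -
      have *: "(\<lambda>x. indicator upper x * indicator (cbox a b) x :: real) = indicator (cbox a b)"
        using cb by (auto simp: indicator_def fun_eq_iff)
      show "integrable (lebesgue_on upper) (\<lambda>x. indicator (cbox a b) x :: real)"
        unfolding integral_lebesgue_on_indicator(2)[OF borel_upper] *
        by (rule lmeasurable_iff_integrable[THEN iffD1]) simp
      show "(\<integral>x. indicator (cbox a b) x \<partial>lebesgue_on upper) = 2 * \<epsilon> * k"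
        unfolding integral_lebesgue_on_indicator(1)[OF borel_upper] * using meas by simp
    qed
    have "- (M * 2 * k * \<epsilon> + 4 * \<delta> * k) = - (M + 2 * \<delta> / \<epsilon>) * (2 * \<epsilon> * k)"
      using \<epsilon>(1) by (simp add: field_simps)
    also have "\<dots> =
        (\<integral>x. - (M + 2 * \<delta> / \<epsilon>) * indicator (cbox a b) x \<partial>lebesgue_on upper)"
      using m3 i3 by simp
    also have "\<dots> \<le> (\<integral>x. F x \<bullet> \<psi> x - F x \<bullet> \<Psi> x \<partial>lebesgue_on upper)"
      using pw int1 int2 i3 by (intro integral_mono) auto
    also have "\<dots> = (\<integral>x. F x \<bullet> \<psi> x \<partial>lebesgue_on upper)"
      using int1 int2 zero by simp
    finally have "- (M * 2 * k * \<epsilon> + 4 * \<delta> * k) \<le> (\<integral>x. F x \<bullet> \<psi> x \<partial>lebesgue_on upper)" .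
    moreover have "M * 2 * k * \<epsilon> \<le> M * 2 * k * \<delta>"
      using M(1) k0 \<epsilon>(3) by (intro mult_left_mono) auto
    ultimately show ?thesis
      by (simp add: algebra_simps)
  qed
  show ?thesis
  proof (rule ccontr)
    define I where "I = (\<integral>x. F x \<bullet> \<psi> x \<partial>lebesgue_on upper)"
    \<comment> \<open>One more than the constant in \<open>key\<close>, so that the choice
      \<open>\<delta> = - I / q\<close> contradicts a negative \<open>I\<close> and replaces the
      limit of vanishing \<open>\<delta>\<close>.\<close>
    define q where "q = 2 * M * k + 4 * k + 1"
    assume "\<not> ?thesis"
    then have I: "I < 0"
      by (simp add: I_def)
    have q: "q > 0"
      using M(1) k0 by (simp add: q_def add_nonneg_pos)
    have "0 < - I / q"
      using I q by (intro divide_pos_pos) auto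
    from key[OF this] have "- (q - 1) * (- I / q) \<le> I"
      by (simp add: q_def I_def)
    then show False
      using q I by (simp add: field_simps)
  qed
qed

subsection \<open>Compactness\<close>

text \<open>Cauchy-Schwarz against the constant 1: with \<open>m\<close> the measure of
  \<open>Q\<close>, the integral of \<open>(m * h x - I)\<^sup>2\<close> over \<open>Q\<close>
  equals \<open>m * (m * J - I\<^sup>2)\<close>. If \<open>m\<close> is 0, then \<open>I\<close> is
  an integral over a null set.\<close>

lemma square_integral_le:
  fixes h :: "'a::euclidean_space \<Rightarrow> real"
  assumes Q: "compact Q" and h: "continuous_on Q h"
  shows "(\<integral>x. indicator Q x * h x \<partial>lborel)\<^sup>2 \<le>
    measure lborel Q * (\<integral>x. indicator Q x * (h x)\<^sup>2 \<partial>lborel)"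
proof -
  define m where "m = measure lborel Q"
  define I where "I = (\<integral>x. indicator Q x * h x \<partial>lborel)"
  define J where "J = (\<integral>x. indicator Q x * (h x)\<^sup>2 \<partial>lborel)"
  have i: "integrable lborel (\<lambda>x. indicator Q x * h x)" "integrable lborel (\<lambda>x. indicator Q x * (h x)\<^sup>2)"
    using borel_integrable_compact[OF Q h] borel_integrable_compact[OF Q continuous_on_power[OF h, of 2]]
    by simp_all
  have iQ: "integrable lborel (indicator Q :: 'a \<Rightarrow> real)" "(\<integral>x. indicator Q x \<partial>lborel) = m"
    using borel_integrable_compact[OF Q continuous_on_const[of _ "1::real"]] Q
    by (simp_all add: m_def del: integrable_indicator_iff)
  have "0 \<le> (\<integral>x. indicator Q x * (m * h x - I)\<^sup>2 \<partial>lborel)"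
    by (intro integral_nonneg_AE) auto
  also have "\<dots> = (\<integral>x. m\<^sup>2 * (indicator Q x * (h x)\<^sup>2) - 2 * m * I * (indicator Q x * h x)
      + I\<^sup>2 * indicator Q x \<partial>lborel)"
    by (intro Bochner_Integration.integral_cong) (auto simp: power2_eq_square algebra_simps)
  also have "\<dots> = m\<^sup>2 * J - 2 * m * I * I + I\<^sup>2 * m"
    using i iQ by (simp add: I_def J_def)
  finally have *: "0 \<le> m * (m * J - I\<^sup>2)"
    by (simp add: power2_eq_square algebra_simps)
  show ?thesis
  proof (cases "m = 0")
    case True
    then have "emeasure lborel Q = 0"
      using emeasure_compact_finite[OF Q] by (auto simp: m_def measure_def enn2real_eq_0_iff)
    then have "AE x in lborel. indicator Q x * h x = 0"
      using Q by (intro AE_I[where N = Q]) (auto simp: indicator_def compact_imp_closed)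
    then have "I = 0"
      unfolding I_def by (rule integral_eq_zero_AE)
    then show ?thesis
      using True by (simp add: I_def m_def)
  next
    case False
    then have "m > 0"
      by (simp add: m_def zero_less_measure_iff order.not_eq_order_implies_strict)
    then show ?thesis
      using * by (simp add: zero_le_mult_iff I_def J_def m_def)
  qed
qed

text \<open>Holds without assuming integrability: integrability passes between \<open>f\<close> and
  its shift in both directions, and if it fails both integrals have the default value 0.\<close>

lemma lborel_integral_shift:
  fixes f :: "'a::euclidean_space \<Rightarrow> real"
  shows "(\<integral>x. f (c + x) \<partial>lborel) = (\<integral>x. f x \<partial>lborel)"
    "integrable lborel (\<lambda>x. f (c + x)) \<longleftrightarrow> integrable lborel f"
proof -
  have 1: "integrable lborel f" if "integrable lborel (\<lambda>x. f (c + x))" for f :: "'a \<Rightarrow> real" and c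
  proof -
    have "(\<lambda>x. f (c + (- c + x))) \<in> borel_measurable borel"
      using borel_measurable_integrable[OF that] by measurable
    then have "f \<in> borel_measurable borel"
      by (simp add: add.assoc[symmetric])
    then show ?thesis
      using that integrable_distr_eq[of "(+) c" lborel borel f] by (simp add: lborel_distr_plus)
  qed
  show *: "integrable lborel (\<lambda>x. f (c + x)) \<longleftrightarrow> integrable lborel f"
    using 1[of f c] 1[of "\<lambda>x. f (c + x)" "- c"] by (auto simp: add.assoc[symmetric])
  show "(\<integral>x. f (c + x) \<partial>lborel) = (\<integral>x. f x \<partial>lborel)"
  proof (cases "integrable lborel f")
    case True
    then have "f \<in> borel_measurable borel"
      using borel_measurable_integrable by force
    then show ?thesis
      using integral_distr[of "(+) c" lborel borel f] by (simp add: lborel_distr_plus)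
  qed (simp add: * not_integrable_integral_eq)
qed

text \<open>Stands for an H1 function on the half space with bounded support. It need not vanish on
  the flat boundary, so extension by 0 would destroy weak differentiability; instead all
  translations below are by vectors of \<open>upper\<close>, which map the half space into
  itself.\<close>

locale upper_C1_compact =
  fixes v :: "'n::finite pt \<Rightarrow> real" and g :: "'n pt \<Rightarrow> 'n pt" and \<rho> :: real
  assumes C1: "upper_C1 upper v g"
    and supp: "\<And>x. x \<in> upper \<Longrightarrow> \<rho> \<le> norm x \<Longrightarrow> v x = 0"
      "\<And>x. x \<in> upper \<Longrightarrow> \<rho> \<le> norm x \<Longrightarrow> g x = 0"
begin

lemma continuous_v: "continuous_on upper v"
  by (rule upper_C1_continuous[OF C1]) simp

lemma continuous_g: "continuous_on upper g"
  using C1 by (simp add: upper_C1_def)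

definition energy :: real where
  "energy = (\<integral>x. indicator upper x * (norm (g x))\<^sup>2 \<partial>lborel)"

lemma integrable_energy: "integrable lborel (\<lambda>x. indicator upper x * (norm (g x))\<^sup>2)"
proof (rule integrable_half_ball_support(1)[of "\<rho> + 1" _ \<rho>])
  show "continuous_on (half_ball 0 (\<rho> + 1)) (\<lambda>x. (norm (g x))\<^sup>2)"
    using continuous_on_subset[OF continuous_g] by (intro continuous_intros) (auto simp: half_ball_eq)
qed (use supp in auto)

lemma energy_nonneg: "0 \<le> energy"
  unfolding energy_def by (intro integral_nonneg_AE) auto

lemma measurable_v: "(\<lambda>x. indicator upper x * v x) \<in> borel_measurable borel"
  using borel_measurable_continuous_on_indicator[OF borel_upper continuous_v] by simp

lemma measurable_g: "(\<lambda>x. indicator upper x * (norm (g x))\<^sup>2) \<in> borel_measurable borel"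
  using borel_measurable_continuous_on_indicator[OF borel_upper, of "\<lambda>x. (norm (g x))\<^sup>2"]
    continuous_on_power[OF continuous_on_norm[OF continuous_g], of 2] by simp

lemma continuous_shift:
  "z \<in> upper \<Longrightarrow> S \<subseteq> upper \<Longrightarrow> continuous_on S (\<lambda>x. v (x + z))"
  by (rule continuous_on_compose2[OF continuous_v]) (auto intro!: continuous_intros upper_add)

text \<open>The increment is the integral of \<open>g (x + t *\<^sub>R z) \<bullet> z\<close> over
  [0, 1], and Cauchy-Schwarz is applied twice, in \<open>t\<close> and in the inner product. The
  nonnegative integral on the right prepares the exchange of integrals in
  \<open>translation_le\<close>.\<close>

lemma increment_square_le:
  assumes x: "x \<in> upper" and z: "z \<in> upper"
  shows "ennreal ((v (x + z) - v x)\<^sup>2) \<le>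
    (\<integral>\<^sup>+t. indicator {0..1} t * ennreal ((norm z)\<^sup>2 * (norm (g (x + t *\<^sub>R z)))\<^sup>2) \<partial>lborel)"
proof -
  define f where "f t = g (x + t *\<^sub>R z) \<bullet> z" for t
  have mem: "x + t *\<^sub>R z \<in> upper" if "t \<in> {0..1}" for t
    using x z that by (intro upper_add upper_scaleR) auto
  have cg: "continuous_on {0..1} (\<lambda>t. g (x + t *\<^sub>R z))"
    using mem by (intro continuous_on_compose2[OF continuous_g]) (auto intro!: continuous_intros)
  then have cg2: "continuous_on {0..1} (\<lambda>t. (norm z)\<^sup>2 * (norm (g (x + t *\<^sub>R z)))\<^sup>2)"
    by (intro continuous_intros)
  from cg have cf: "continuous_on {0..1} f"
    unfolding f_def by (intro continuous_intros)
  have d: "((\<lambda>t. v (x + t *\<^sub>R z)) has_vector_derivative f t) (at t within {0..1})" if t: "t \<in> {0..1}" for t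
  proof -
    have "((\<lambda>t. x + t *\<^sub>R z) has_derivative (\<lambda>h. h *\<^sub>R z)) (at t within {0..1})"
      by (auto intro!: derivative_eq_intros)
    moreover have "(v has_derivative (\<bullet>) (g (x + t *\<^sub>R z))) (at (x + t *\<^sub>R z) within (\<lambda>t. x + t *\<^sub>R z) ` {0..1})"
      by (rule has_derivative_subset[OF upper_C1D[OF C1 mem[OF t]]]) (use mem in auto)
    ultimately have "((\<lambda>t. v (x + t *\<^sub>R z)) has_derivative (\<lambda>h. g (x + t *\<^sub>R z) \<bullet> (h *\<^sub>R z))) (at t within {0..1})"
      by (rule has_derivative_in_compose)
    then show ?thesis
      by (simp add: has_vector_derivative_def f_def)
  qed
  have "(f has_integral (v (x + 1 *\<^sub>R z) - v (x + 0 *\<^sub>R z))) {0..1}"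
    by (rule fundamental_theorem_of_calculus[OF _ d]) auto
  then have "integral {0..1} f = v (x + z) - v x"
    by (simp add: integral_unique)
  moreover have "set_integrable lborel {0..1} f"
    using borel_integrable_compact[OF _ cf] by (simp add: set_integrable_def)
  ultimately have "v (x + z) - v x = (\<integral>t. indicator {0..1} t * f t \<partial>lborel)"
    using set_borel_integral_eq_integral(2)[of "{0..1}" f] by (simp add: set_lebesgue_integral_def)
  then have "(v (x + z) - v x)\<^sup>2 \<le> (\<integral>t. indicator {0..1} t * (f t)\<^sup>2 \<partial>lborel)"
    using square_integral_le[OF _ cf] by simp
  also have "\<dots> \<le> (\<integral>t. indicator {0..1} t * ((norm z)\<^sup>2 * (norm (g (x + t *\<^sub>R z)))\<^sup>2) \<partial>lborel)"
  proof (rule integral_mono)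
    show "integrable lborel (\<lambda>t. indicator {0..1} t * (f t)\<^sup>2)"
      using borel_integrable_compact[of "{0..1}" "\<lambda>t. (f t)\<^sup>2"] cf by (auto intro: continuous_intros)
    show "integrable lborel (\<lambda>t. indicator {0..1} t * ((norm z)\<^sup>2 * (norm (g (x + t *\<^sub>R z)))\<^sup>2))"
      using borel_integrable_compact[OF _ cg2] by simp
    show "indicator {0..1} t * (f t)\<^sup>2 \<le> indicator {0..1} t * ((norm z)\<^sup>2 * (norm (g (x + t *\<^sub>R z)))\<^sup>2)" for t
      using Cauchy_Schwarz_ineq[of "g (x + t *\<^sub>R z)" z]
      by (auto simp: f_def indicator_def dot_square_norm mult.commute)
  qed
  finally have "ennreal ((v (x + z) - v x)\<^sup>2) \<le>
      ennreal (\<integral>t. indicator {0..1} t * ((norm z)\<^sup>2 * (norm (g (x + t *\<^sub>R z)))\<^sup>2) \<partial>lborel)"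
    by (rule ennreal_leI)
  also have "\<dots> = (\<integral>\<^sup>+t. ennreal (indicator {0..1} t * ((norm z)\<^sup>2 * (norm (g (x + t *\<^sub>R z)))\<^sup>2)) \<partial>lborel)"
    using borel_integrable_compact[OF _ cg2]
    by (intro nn_integral_eq_integral[symmetric]) auto
  also have "\<dots> = (\<integral>\<^sup>+t. indicator {0..1} t * ennreal ((norm z)\<^sup>2 * (norm (g (x + t *\<^sub>R z)))\<^sup>2) \<partial>lborel)"
    by (intro nn_integral_cong) (auto simp: indicator_def)
  finally show ?thesis .
qed

lemma integrable_translation:
  assumes z: "z \<in> upper"
  shows "integrable lborel (\<lambda>x. indicator upper x * (v (x + z) - v x)\<^sup>2)"
proof (rule integrable_half_ball_support(1)[of "\<bar>\<rho>\<bar> + norm z + 1" _ "\<bar>\<rho>\<bar> + norm z"])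
  show "continuous_on (half_ball 0 (\<bar>\<rho>\<bar> + norm z + 1)) (\<lambda>x. (v (x + z) - v x)\<^sup>2)"
    using continuous_on_subset[OF continuous_v] continuous_shift[OF z]
    by (intro continuous_intros) (auto simp: half_ball_eq)
  fix x :: "'n pt" assume x: "x \<in> upper" "\<bar>\<rho>\<bar> + norm z \<le> norm x"
  have "norm x \<le> norm (x + z) + norm z"
    using norm_triangle_ineq4[of "x + z" z] by simp
  then have "\<rho> \<le> norm (x + z)" "\<rho> \<le> norm x"
    using x norm_ge_zero[of z] by linarith+
  then show "(v (x + z) - v x)\<^sup>2 = 0"
    using supp(1)[of x] supp(1)[of "x + z"] upper_add[OF x(1) z] x(1) by simp
qed simp

text \<open>Integrate the increment bound over \<open>x\<close> and exchange the integrals by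
  Tonelli. Since \<open>G\<close> carries the indicator of the half space, translation invariance
  makes the inner integral the full energy for each \<open>t\<close>.\<close>

lemma translation_le:
  assumes z: "z \<in> upper"
  shows "(\<integral>x. indicator upper x * (v (x + z) - v x)\<^sup>2 \<partial>lborel) \<le> (norm z)\<^sup>2 * energy"
proof -
  define G where "G x = ennreal (indicator upper x * (norm (g x))\<^sup>2)" for x
  have G [measurable]: "G \<in> borel_measurable borel"
    unfolding G_def using measurable_g by measurable
  have "ennreal (\<integral>x. indicator upper x * (v (x + z) - v x)\<^sup>2 \<partial>lborel) =
      (\<integral>\<^sup>+x. ennreal (indicator upper x * (v (x + z) - v x)\<^sup>2) \<partial>lborel)"
    using integrable_translation[OF z] by (intro nn_integral_eq_integral[symmetric]) auto
  also have "\<dots> \<le> (\<integral>\<^sup>+x. \<integral>\<^sup>+t. indicator {0..1} t * (ennreal ((norm z)\<^sup>2) * G (t *\<^sub>R z + x)) \<partial>lborel \<partial>lborel)"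
  proof (intro nn_integral_mono)
    fix x
    show "ennreal (indicator upper x * (v (x + z) - v x)\<^sup>2) \<le>
      (\<integral>\<^sup>+t. indicator {0..1} t * (ennreal ((norm z)\<^sup>2) * G (t *\<^sub>R z + x)) \<partial>lborel)"
    proof (cases "x \<in> upper")
      case True
      have "(\<integral>\<^sup>+t. indicator {0..1} t * ennreal ((norm z)\<^sup>2 * (norm (g (x + t *\<^sub>R z)))\<^sup>2) \<partial>lborel) =
          (\<integral>\<^sup>+t. indicator {0..1} t * (ennreal ((norm z)\<^sup>2) * G (t *\<^sub>R z + x)) \<partial>lborel)"
        using True z upper_add[OF True upper_scaleR[OF z]]
        by (intro nn_integral_cong) (auto simp: G_def indicator_def ennreal_mult add.commute)
      then show ?thesis
        using increment_square_le[OF True z] True by simp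
    qed simp
  qed
  also have "\<dots> = (\<integral>\<^sup>+t. \<integral>\<^sup>+x. indicator {0..1} t * (ennreal ((norm z)\<^sup>2) * G (t *\<^sub>R z + x)) \<partial>lborel \<partial>lborel)"
    by (rule lborel_pair.Fubini') measurable
  also have "\<dots> = (\<integral>\<^sup>+t. indicator {0..1::real} t * (ennreal ((norm z)\<^sup>2) * (\<integral>\<^sup>+x. G x \<partial>lborel)) \<partial>lborel)"
  proof (rule nn_integral_cong)
    fix t :: real
    have "(\<integral>\<^sup>+x. G (t *\<^sub>R z + x) \<partial>lborel) = (\<integral>\<^sup>+x. G x \<partial>distr lborel borel ((+) (t *\<^sub>R z)))"
      by (subst nn_integral_distr) auto
    then show "(\<integral>\<^sup>+x. indicator {0..1} t * (ennreal ((norm z)\<^sup>2) * G (t *\<^sub>R z + x)) \<partial>lborel) =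
        indicator {0..1} t * (ennreal ((norm z)\<^sup>2) * (\<integral>\<^sup>+x. G x \<partial>lborel))"
      by (simp add: nn_integral_cmult lborel_distr_plus)
  qed
  also have "\<dots> = ennreal ((norm z)\<^sup>2) * (\<integral>\<^sup>+x. G x \<partial>lborel)"
    by (subst nn_integral_multc) auto
  also have "(\<integral>\<^sup>+x. G x \<partial>lborel) = ennreal energy"
    unfolding G_def energy_def using integrable_energy
    by (intro nn_integral_eq_integral) auto
  finally show ?thesis
    using energy_nonneg by (simp add: ennreal_mult[symmetric])
qed

end

text \<open>A cube with a corner at 0 and not centred there: \<open>x + y\<close> remains in the
  half space for \<open>x\<close> in it and \<open>y\<close> in the cube.\<close>

definition cell :: "real \<Rightarrow> 'n::finite pt set" where
  "cell \<epsilon> = cbox 0 (\<chi> i. \<epsilon>)"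

definition cell_average :: "real \<Rightarrow> ('n::finite pt \<Rightarrow> real) \<Rightarrow> 'n pt \<Rightarrow> real" where
  "cell_average \<epsilon> v x = (\<integral>y. indicator (cell \<epsilon>) y * v (x + y) \<partial>lborel) / measure lborel (cell \<epsilon> :: 'n pt set)"

lemma cell_facts:
  assumes "0 < \<epsilon>"
  shows "compact (cell \<epsilon> :: 'n::finite pt set)" "cell \<epsilon> \<subseteq> (upper :: 'n pt set)"
    "0 < measure lborel (cell \<epsilon> :: 'n pt set)"
    "\<And>x::'n pt. x \<in> cell \<epsilon> \<Longrightarrow> norm x \<le> real CARD('n option) * \<epsilon>"
proof -
  show "compact (cell \<epsilon> :: 'n pt set)"
    by (simp add: cell_def)
  show "cell \<epsilon> \<subseteq> (upper :: 'n pt set)"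
    by (auto simp: cell_def upper_def mem_box_cart)
  have "0 \<in> (cell \<epsilon> :: 'n pt set)"
    using assms by (simp add: cell_def mem_box_cart)
  then have "measure lborel (cell \<epsilon> :: 'n pt set) = (\<Prod>i\<in>(UNIV :: 'n option set). \<epsilon>)"
    unfolding cell_def by (subst content_cbox_cart) auto
  then show "0 < measure lborel (cell \<epsilon> :: 'n pt set)"
    using assms by simp
  fix x :: "'n pt" assume "x \<in> cell \<epsilon>"
  then have "\<bar>x $ i\<bar> \<le> \<epsilon>" for i
    by (simp add: cell_def mem_box_cart)
  then have "(\<Sum>i\<in>UNIV. \<bar>x $ i\<bar>) \<le> of_nat (card (UNIV :: 'n option set)) * \<epsilon>"
    by (intro sum_bounded_above) auto
  then show "norm x \<le> real CARD('n option) * \<epsilon>"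
    using norm_le_l1_cart[of x] by linarith
qed

context upper_C1_compact
begin

lemma integrable_shift_cell:
  assumes "0 < \<epsilon>" "x \<in> upper"
  shows "continuous_on (cell \<epsilon>) (\<lambda>y. v (x + y))" "integrable lborel (\<lambda>y. indicator (cell \<epsilon>) y * v (x + y))"
proof -
  show *: "continuous_on (cell \<epsilon>) (\<lambda>y. v (x + y))"
    using continuous_shift[OF assms(2) cell_facts(2)[OF assms(1)]] by (simp add: add.commute)
  show "integrable lborel (\<lambda>y. indicator (cell \<epsilon>) y * v (x + y))"
    using borel_integrable_compact[OF cell_facts(1)[OF assms(1)] *] by simp
qed

lemma integrable_v_square: "integrable lborel (\<lambda>x. indicator upper x * (v x)\<^sup>2)"
proof (rule integrable_half_ball_support(1)[of "\<rho> + 1" _ \<rho>])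
  show "continuous_on (half_ball 0 (\<rho> + 1)) (\<lambda>x. (v x)\<^sup>2)"
    using continuous_on_subset[OF continuous_v] by (intro continuous_intros) (auto simp: half_ball_eq)
qed (use supp in auto)

text \<open>Jensen's inequality turns the L2 bound into a pointwise one, at the cost of dividing by
  the cell volume. This provides equiboundedness for Arzela-Ascoli.\<close>

lemma cell_average_square_le:
  assumes "0 < \<epsilon>" "x \<in> upper"
  shows "(cell_average \<epsilon> v x)\<^sup>2 \<le> (\<integral>x. indicator upper x * (v x)\<^sup>2 \<partial>lborel) / measure lborel (cell \<epsilon> :: 'n pt set)"
proof -
  define m where "m = measure lborel (cell \<epsilon> :: 'n pt set)"
  have m: "m > 0"
    using cell_facts(3)[OF assms(1)] by (simp add: m_def)
  note sub = cell_facts(2)[OF assms(1), where 'n = 'n]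
  have "(m * cell_average \<epsilon> v x)\<^sup>2 \<le> m * (\<integral>y. indicator (cell \<epsilon>) y * (v (x + y))\<^sup>2 \<partial>lborel)"
    using square_integral_le[OF cell_facts(1)[OF assms(1)] integrable_shift_cell(1)[OF assms]] m
    by (simp add: cell_average_def m_def)
  also have "(\<integral>y. indicator (cell \<epsilon>) y * (v (x + y))\<^sup>2 \<partial>lborel) \<le>
      (\<integral>y. indicator upper (x + y) * (v (x + y))\<^sup>2 \<partial>lborel)"
  proof (rule integral_mono)
    show "integrable lborel (\<lambda>y. indicator (cell \<epsilon>) y * (v (x + y))\<^sup>2)"
      using borel_integrable_compact[OF cell_facts(1)[OF assms(1)] continuous_on_power[OF integrable_shift_cell(1)[OF assms], of 2]]
      by simp
    show "integrable lborel (\<lambda>y. indicator upper (x + y) * (v (x + y))\<^sup>2)"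
      using lborel_integral_shift(2)[of "\<lambda>x. indicator upper x * (v x)\<^sup>2" x] integrable_v_square by simp
    show "indicator (cell \<epsilon>) y * (v (x + y))\<^sup>2 \<le> indicator upper (x + y) * (v (x + y))\<^sup>2" for y
      using sub upper_add[OF assms(2), of y] by (auto simp: indicator_def)
  qed
  also have "\<dots> = (\<integral>x. indicator upper x * (v x)\<^sup>2 \<partial>lborel)"
    using lborel_integral_shift(1)[of "\<lambda>x. indicator upper x * (v x)\<^sup>2" x] by simp
  finally have "m\<^sup>2 * (cell_average \<epsilon> v x)\<^sup>2 \<le> m * (\<integral>x. indicator upper x * (v x)\<^sup>2 \<partial>lborel)"
    using m by (simp add: power_mult_distrib)
  then have "m * (cell_average \<epsilon> v x)\<^sup>2 \<le> (\<integral>x. indicator upper x * (v x)\<^sup>2 \<partial>lborel)"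
    using m by (simp add: power2_eq_square mult.assoc)
  then show ?thesis
    using m by (simp add: m_def[symmetric] field_simps)
qed

text \<open>The difference of the averages is the average of
  \<open>v (x + z + y) - v (x + y)\<close>, so Jensen and \<open>translation_le\<close> apply. The
  constant depends on \<open>v\<close> only through its energy, as equicontinuity requires.\<close>

lemma cell_average_shift:
  assumes "0 < \<epsilon>" "x \<in> upper" "z \<in> upper"
  shows "\<bar>cell_average \<epsilon> v (x + z) - cell_average \<epsilon> v x\<bar> \<le> sqrt (energy / measure lborel (cell \<epsilon> :: 'n pt set)) * norm z"
proof -
  define m where "m = measure lborel (cell \<epsilon> :: 'n pt set)"
  have m: "m > 0"
    using cell_facts(3)[OF assms(1)] by (simp add: m_def)
  note sub = cell_facts(2)[OF assms(1), where 'n = 'n]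
  note i = integrable_shift_cell[OF assms(1) assms(2)] integrable_shift_cell[OF assms(1) upper_add[OF assms(2,3)]]
  let ?d = "cell_average \<epsilon> v (x + z) - cell_average \<epsilon> v x"
  have c: "continuous_on (cell \<epsilon>) (\<lambda>y. v (x + z + y) - v (x + y))"
    using i by (intro continuous_intros)
  have "m * ?d = (\<integral>y. indicator (cell \<epsilon>) y * v (x + z + y) \<partial>lborel) - (\<integral>y. indicator (cell \<epsilon>) y * v (x + y) \<partial>lborel)"
    using m by (simp add: cell_average_def m_def[symmetric] field_simps)
  also have "\<dots> = (\<integral>y. indicator (cell \<epsilon>) y * (v (x + z + y) - v (x + y)) \<partial>lborel)"
    using i by (simp add: right_diff_distrib)
  finally have "(m * ?d)\<^sup>2 \<le> m * (\<integral>y. indicator (cell \<epsilon>) y * (v (x + z + y) - v (x + y))\<^sup>2 \<partial>lborel)"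
    using square_integral_le[OF cell_facts(1)[OF assms(1)] c] by (simp add: m_def)
  also have "(\<integral>y. indicator (cell \<epsilon>) y * (v (x + z + y) - v (x + y))\<^sup>2 \<partial>lborel) \<le>
      (\<integral>y. indicator upper (x + y) * (v (x + y + z) - v (x + y))\<^sup>2 \<partial>lborel)"
  proof (rule integral_mono)
    show "integrable lborel (\<lambda>y. indicator (cell \<epsilon>) y * (v (x + z + y) - v (x + y))\<^sup>2)"
      using borel_integrable_compact[OF cell_facts(1)[OF assms(1)] continuous_on_power[OF c, of 2]]
      by simp
    show "integrable lborel (\<lambda>y. indicator upper (x + y) * (v (x + y + z) - v (x + y))\<^sup>2)"
      using lborel_integral_shift(2)[of "\<lambda>x. indicator upper x * (v (x + z) - v x)\<^sup>2" x]
        integrable_translation[OF assms(3)] by simp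
    show "indicator (cell \<epsilon>) y * (v (x + z + y) - v (x + y))\<^sup>2 \<le> indicator upper (x + y) * (v (x + y + z) - v (x + y))\<^sup>2" for y
      using sub upper_add[OF assms(2), of y] by (auto simp: indicator_def algebra_simps)
  qed
  also have "\<dots> = (\<integral>x. indicator upper x * (v (x + z) - v x)\<^sup>2 \<partial>lborel)"
    using lborel_integral_shift(1)[of "\<lambda>x. indicator upper x * (v (x + z) - v x)\<^sup>2" x] by simp
  also have "\<dots> \<le> (norm z)\<^sup>2 * energy"
    by (rule translation_le[OF assms(3)])
  finally have "m * (m * ?d\<^sup>2) \<le> m * ((norm z)\<^sup>2 * energy)"
    using m by (simp add: power_mult_distrib power2_eq_square mult.assoc mult.left_commute)
  then have "?d\<^sup>2 \<le> (norm z)\<^sup>2 * (energy / m)"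
    using m by (simp add: pos_le_divide_eq mult.commute)
  then have "sqrt (?d\<^sup>2) \<le> sqrt ((norm z)\<^sup>2 * (energy / m))"
    by (rule real_sqrt_le_mono)
  then show ?thesis
    unfolding real_sqrt_mult by (simp add: m_def mult.commute)
qed

text \<open>Only upward shifts are controlled, but of two points the one with the larger normal
  coordinate is an upward shift of the other.\<close>

lemma cell_average_Lipschitz:
  assumes "0 < \<epsilon>" "x \<in> upper" "y \<in> upper"
  shows "\<bar>cell_average \<epsilon> v x - cell_average \<epsilon> v y\<bar> \<le> sqrt (energy / measure lborel (cell \<epsilon> :: 'n pt set)) * norm (x - y)"
proof (cases "x $ None \<le> y $ None")
  case True
  then have "y - x \<in> upper"
    by (simp add: upper_def)
  from cell_average_shift[OF assms(1,2) this] show ?thesis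
    by (simp add: abs_minus_commute norm_minus_commute)
next
  case False
  then have "x - y \<in> upper"
    by (simp add: upper_def)
  from cell_average_shift[OF assms(1,3) this] show ?thesis
    by simp
qed

lemma continuous_cell_average:
  assumes "0 < \<epsilon>"
  shows "continuous_on upper (cell_average \<epsilon> v)"
proof -
  have "(sqrt (energy / measure lborel (cell \<epsilon> :: 'n pt set)))-lipschitz_on upper (cell_average \<epsilon> v)"
    using cell_average_Lipschitz[OF assms] energy_nonneg
    by (intro lipschitz_onI) (auto simp: dist_norm)
  then show ?thesis
    by (rule lipschitz_on_continuous_on)
qed

text \<open>By Jensen and Tonelli the squared error is at most the mean over \<open>y\<close> in the
  cell of the squared L2 distance between \<open>v\<close> and its shift by \<open>y\<close>;
  \<open>translation_le\<close> bounds each of these.\<close>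

lemma cell_average_approx:
  assumes "0 < \<epsilon>"
  shows "(\<integral>\<^sup>+x. indicator upper x * ennreal ((cell_average \<epsilon> v x - v x)\<^sup>2) \<partial>lborel) \<le>
    ennreal ((real CARD('n option) * \<epsilon>)\<^sup>2 * energy)"
proof -
  define m where "m = measure lborel (cell \<epsilon> :: 'n pt set)"
  have m: "m > 0"
    using cell_facts(3)[OF assms(1)] by (simp add: m_def)
  have em: "emeasure lborel (cell \<epsilon> :: 'n pt set) = ennreal m"
    using emeasure_compact_finite[OF cell_facts(1)[OF assms, where 'n = 'n]]
    by (simp add: m_def emeasure_eq_ennreal_measure less_top)
  have bc [measurable]: "cell \<epsilon> \<in> sets (borel :: 'n pt measure)"
    by (simp add: cell_def)
  note sub = cell_facts(2)[OF assms(1), where 'n = 'n]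
  \<comment> \<open>Outside the half space \<open>v\<close> is arbitrary, so joint measurability for
    Tonelli is only available after truncation.\<close>
  define V where "V x = indicator upper x * v x" for x
  have V [measurable]: "V \<in> borel_measurable borel"
    unfolding V_def[abs_def] by (rule measurable_v)
  have "(\<integral>\<^sup>+x. indicator upper x * ennreal ((cell_average \<epsilon> v x - v x)\<^sup>2) \<partial>lborel) \<le>
      (\<integral>\<^sup>+x. \<integral>\<^sup>+y. indicator upper x * (indicator (cell \<epsilon>) y * ennreal ((V (x + y) - V x)\<^sup>2 / m)) \<partial>lborel \<partial>lborel)"
  proof (rule nn_integral_mono)
    fix x :: "'n pt"
    show "indicator upper x * ennreal ((cell_average \<epsilon> v x - v x)\<^sup>2) \<le>
      (\<integral>\<^sup>+y. indicator upper x * (indicator (cell \<epsilon>) y * ennreal ((V (x + y) - V x)\<^sup>2 / m)) \<partial>lborel)"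
    proof (cases "x \<in> upper")
      case True
      let ?d = "cell_average \<epsilon> v x - v x"
      have c: "continuous_on (cell \<epsilon>) (\<lambda>y. v (x + y) - v x)"
        using integrable_shift_cell[OF assms True] by (intro continuous_intros)
      have i1: "integrable lborel (\<lambda>y. indicator (cell \<epsilon> :: 'n pt set) y * v x)"
        using borel_integrable_compact[OF cell_facts(1)[OF assms] continuous_on_const[of _ "v x"]] by simp
      have "(\<integral>y. indicator (cell \<epsilon> :: 'n pt set) y * v x \<partial>lborel) = m * v x"
        by (simp add: m_def)
      then have "m * ?d = (\<integral>y. indicator (cell \<epsilon>) y * v (x + y) \<partial>lborel) - (\<integral>y. indicator (cell \<epsilon> :: 'n pt set) y * v x \<partial>lborel)"
        using m by (simp add: cell_average_def m_def[symmetric] field_simps)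
      also have "\<dots> = (\<integral>y. indicator (cell \<epsilon>) y * (v (x + y) - v x) \<partial>lborel)"
        using integrable_shift_cell[OF assms True] i1 by (simp add: right_diff_distrib)
      finally have "(m * ?d)\<^sup>2 \<le> m * (\<integral>y. indicator (cell \<epsilon>) y * (v (x + y) - v x)\<^sup>2 \<partial>lborel)"
        using square_integral_le[OF cell_facts(1)[OF assms(1)] c] by (simp add: m_def)
      then have "m * (m * ?d\<^sup>2) \<le> m * (\<integral>y. indicator (cell \<epsilon>) y * (v (x + y) - v x)\<^sup>2 \<partial>lborel)"
        by (simp add: power_mult_distrib power2_eq_square mult.assoc mult.left_commute)
      then have "?d\<^sup>2 \<le> (\<integral>y. indicator (cell \<epsilon>) y * (v (x + y) - v x)\<^sup>2 \<partial>lborel) / m"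
        using m by (simp add: field_simps)
      also have "\<dots> = (\<integral>y. indicator (cell \<epsilon>) y * ((v (x + y) - v x)\<^sup>2 / m) \<partial>lborel)"
        by simp
      finally have "ennreal (?d\<^sup>2) \<le> ennreal (\<integral>y. indicator (cell \<epsilon>) y * ((v (x + y) - v x)\<^sup>2 / m) \<partial>lborel)"
        by (rule ennreal_leI)
      also have "\<dots> = (\<integral>\<^sup>+y. ennreal (indicator (cell \<epsilon>) y * ((v (x + y) - v x)\<^sup>2 / m)) \<partial>lborel)"
      proof (rule nn_integral_eq_integral[symmetric])
        have "continuous_on (cell \<epsilon>) (\<lambda>y. (v (x + y) - v x)\<^sup>2 / m)"
          using continuous_on_divide[OF continuous_on_power[OF c, of 2] continuous_on_const[of _ m]] m by simp
        from borel_integrable_compact[OF cell_facts(1)[OF assms] this]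
        show "integrable lborel (\<lambda>y. indicator (cell \<epsilon>) y * ((v (x + y) - v x)\<^sup>2 / m))"
          by simp
      qed (use m in auto)
      also have "\<dots> = (\<integral>\<^sup>+y. indicator upper x * (indicator (cell \<epsilon>) y * ennreal ((V (x + y) - V x)\<^sup>2 / m)) \<partial>lborel)"
        using True sub upper_add[OF True] by (intro nn_integral_cong) (auto simp: indicator_def V_def)
      finally show ?thesis
        using True by simp
    qed simp
  qed
  also have "\<dots> = (\<integral>\<^sup>+y. \<integral>\<^sup>+x. indicator upper x * (indicator (cell \<epsilon>) y * ennreal ((V (x + y) - V x)\<^sup>2 / m)) \<partial>lborel \<partial>lborel)"
    by (rule lborel_pair.Fubini'[symmetric]) measurable
  also have "\<dots> \<le> (\<integral>\<^sup>+y. indicator (cell \<epsilon> :: 'n pt set) y * ennreal ((real CARD('n option) * \<epsilon>)\<^sup>2 * energy / m) \<partial>lborel)"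
  proof (rule nn_integral_mono)
    fix y :: "'n pt"
    show "(\<integral>\<^sup>+x. indicator upper x * (indicator (cell \<epsilon>) y * ennreal ((V (x + y) - V x)\<^sup>2 / m)) \<partial>lborel) \<le>
        indicator (cell \<epsilon>) y * ennreal ((real CARD('n option) * \<epsilon>)\<^sup>2 * energy / m)"
    proof (cases "y \<in> cell \<epsilon>")
      case True
      then have y: "y \<in> upper"
        using sub by auto
      have "(\<integral>\<^sup>+x. indicator upper x * (indicator (cell \<epsilon>) y * ennreal ((V (x + y) - V x)\<^sup>2 / m)) \<partial>lborel) =
          (\<integral>\<^sup>+x. ennreal (indicator upper x * (v (x + y) - v x)\<^sup>2 / m) \<partial>lborel)"
        using True upper_add[OF _ y] by (intro nn_integral_cong) (auto simp: indicator_def V_def)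
      also have "\<dots> = ennreal (\<integral>x. indicator upper x * (v (x + y) - v x)\<^sup>2 / m \<partial>lborel)"
        using integrable_translation[OF y] m by (intro nn_integral_eq_integral) auto
      also have "\<dots> \<le> ennreal ((real CARD('n option) * \<epsilon>)\<^sup>2 * energy / m)"
      proof (rule ennreal_leI)
        have "(\<integral>x. indicator upper x * (v (x + y) - v x)\<^sup>2 \<partial>lborel) \<le> (norm y)\<^sup>2 * energy"
          by (rule translation_le[OF y])
        also have "\<dots> \<le> (real CARD('n option) * \<epsilon>)\<^sup>2 * energy"
          using cell_facts(4)[OF assms True] energy_nonneg
          by (intro mult_right_mono power_mono) auto
        finally show "(\<integral>x. indicator upper x * (v (x + y) - v x)\<^sup>2 / m \<partial>lborel) \<le> (real CARD('n option) * \<epsilon>)\<^sup>2 * energy / m"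
          using m by (simp add: divide_right_mono)
      qed
      finally show ?thesis
        using True by simp
    qed simp
  qed
  also have "\<dots> = ennreal m * ennreal ((real CARD('n option) * \<epsilon>)\<^sup>2 * energy / m)"
    using em by (subst nn_integral_multc) auto
  also have "\<dots> = ennreal ((real CARD('n option) * \<epsilon>)\<^sup>2 * energy)"
    using m energy_nonneg by (simp add: ennreal_mult[symmetric])
  finally show ?thesis .
qed

end

lemma nn_integral_weighted_sum:
  assumes [measurable]: "f \<in> borel_measurable M" "h \<in> borel_measurable M" "B \<in> sets M"
  shows "(\<integral>\<^sup>+x. p * f x + q * h x + c * indicator B x \<partial>M) =
    p * (\<integral>\<^sup>+x. f x \<partial>M) + q * (\<integral>\<^sup>+x. h x \<partial>M) + c * emeasure M B"
proof -
  have "(\<integral>\<^sup>+x. p * f x + q * h x + c * indicator B x \<partial>M) =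
      (\<integral>\<^sup>+x. p * f x + q * h x \<partial>M) + (\<integral>\<^sup>+x. c * indicator B x \<partial>M)"
    by (rule nn_integral_add) measurable
  also have "(\<integral>\<^sup>+x. p * f x + q * h x \<partial>M) = (\<integral>\<^sup>+x. p * f x \<partial>M) + (\<integral>\<^sup>+x. q * h x \<partial>M)"
    by (rule nn_integral_add) measurable
  finally show ?thesis
    by (simp add: nn_integral_cmult)
qed

text \<open>Insert the two averages: \<open>v - v'\<close> splits into two approximation errors and
  the difference of the averages. A factor 3 comes from squaring three terms; both errors together
  give 6, and the middle term is integrated only over the ball that contains the supports.\<close>

lemma L2_dist_le_averages:
  fixes v v' :: "'n::finite pt \<Rightarrow> real"
  assumes "upper_C1_compact v g \<rho>" "upper_C1_compact v' g' \<rho>" "0 < \<epsilon>"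
    and E: "upper_C1_compact.energy g \<le> E" "upper_C1_compact.energy g' \<le> E" and "0 \<le> \<delta>"
    and close: "\<And>x. x \<in> upper \<Longrightarrow> norm x \<le> \<rho> \<Longrightarrow> \<bar>cell_average \<epsilon> v x - cell_average \<epsilon> v' x\<bar> \<le> \<delta>"
  shows "(\<integral>x. (v x - v' x)\<^sup>2 \<partial>lebesgue_on upper) \<le>
    6 * (real CARD('n option) * \<epsilon>)\<^sup>2 * E + 3 * \<delta>\<^sup>2 * measure lborel (cball (0::'n pt) \<rho>)"
proof -
  interpret v: upper_C1_compact v g \<rho> by fact
  interpret v': upper_C1_compact v' g' \<rho> by fact
  let ?A = "cell_average \<epsilon>" and ?k = "(real CARD('n option) * \<epsilon>)\<^sup>2"
  let ?B = "cball (0::'n pt) \<rho>"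
  define V where "V x = indicator upper x * v x" for x
  define V' where "V' x = indicator upper x * v' x" for x
  define a where "a x = indicator upper x * ?A v x" for x
  define a' where "a' x = indicator upper x * ?A v' x" for x
  have [measurable]: "V \<in> borel_measurable borel" "V' \<in> borel_measurable borel"
    unfolding V_def[abs_def] V'_def[abs_def] by (rule v.measurable_v v'.measurable_v)+
  have [measurable]: "a \<in> borel_measurable borel" "a' \<in> borel_measurable borel"
    using borel_measurable_continuous_on_indicator[OF borel_upper v.continuous_cell_average[OF assms(3)]]
      borel_measurable_continuous_on_indicator[OF borel_upper v'.continuous_cell_average[OF assms(3)]]
    by (simp_all add: a_def[abs_def] a'_def[abs_def])
  have E0: "0 \<le> E"
    using v.energy_nonneg E by simp
  have int: "integrable lborel (\<lambda>x. indicator upper x * (v x - v' x)\<^sup>2)"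
  proof (rule integrable_half_ball_support(1)[of "\<rho> + 1" _ \<rho>])
    show "continuous_on (half_ball 0 (\<rho> + 1)) (\<lambda>x. (v x - v' x)\<^sup>2)"
      using continuous_on_subset[OF v.continuous_v] continuous_on_subset[OF v'.continuous_v]
      by (intro continuous_intros) (auto simp: half_ball_eq)
  qed (use v.supp v'.supp in auto)
  have pw: "ennreal (indicator upper x * (v x - v' x)\<^sup>2) \<le>
      3 * (indicator upper x * ennreal ((a x - V x)\<^sup>2)) + 3 * (indicator upper x * ennreal ((a' x - V' x)\<^sup>2))
      + ennreal (3 * \<delta>\<^sup>2) * indicator ?B x" for x
  proof (cases "x \<in> upper \<and> norm x \<le> \<rho>")
    case True
    then have d: "(?A v x - ?A v' x)\<^sup>2 \<le> \<delta>\<^sup>2"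
      using close \<open>0 \<le> \<delta>\<close> by (simp add: abs_le_square_iff[symmetric])
    have "(v x - v' x)\<^sup>2 \<le> 3 * (?A v x - v x)\<^sup>2 + 3 * (?A v' x - v' x)\<^sup>2 + 3 * (?A v x - ?A v' x)\<^sup>2"
    proof -
      \<comment> \<open>The right side minus the left is
        \<open>(p + q)\<^sup>2 + (q + r)\<^sup>2 + (p - r)\<^sup>2\<close>.\<close>
      have ineq: "(q - p - r)\<^sup>2 \<le> 3 * p\<^sup>2 + 3 * q\<^sup>2 + 3 * r\<^sup>2" for p q r :: real
        using sum_squares_ge_zero[of "p + q" "p + r"] zero_le_power2[of "p + q"] zero_le_power2[of "p - r"]
          zero_le_power2[of "q + r"] by (simp add: power2_eq_square algebra_simps)
      show ?thesis
        using ineq[of "?A v' x - v' x" "?A v x - v x" "?A v' x - ?A v x"]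
        by (simp add: power2_commute[of "?A v' x" "?A v x"])
    qed
    with d have "(v x - v' x)\<^sup>2 \<le> 3 * (?A v x - v x)\<^sup>2 + 3 * (?A v' x - v' x)\<^sup>2 + 3 * \<delta>\<^sup>2"
      by simp
    then have "ennreal ((v x - v' x)\<^sup>2) \<le> ennreal (3 * (?A v x - v x)\<^sup>2 + 3 * (?A v' x - v' x)\<^sup>2 + 3 * \<delta>\<^sup>2)"
      by (rule ennreal_leI)
    then show ?thesis
      using True by (simp add: V_def V'_def a_def a'_def ennreal_mult)
  next
    case False
    then have "x \<in> upper \<Longrightarrow> v x = 0 \<and> v' x = 0"
      using v.supp v'.supp by auto
    then have "indicator upper x * (v x - v' x)\<^sup>2 = 0"
      by (auto simp: indicator_def)
    then show ?thesis
      by (simp only: ennreal_0 zero_le)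
  qed
  have "ennreal (\<integral>x. indicator upper x * (v x - v' x)\<^sup>2 \<partial>lborel) =
      (\<integral>\<^sup>+x. ennreal (indicator upper x * (v x - v' x)\<^sup>2) \<partial>lborel)"
    using int by (intro nn_integral_eq_integral[symmetric]) auto
  also have "\<dots> \<le> (\<integral>\<^sup>+x. 3 * (indicator upper x * ennreal ((a x - V x)\<^sup>2)) + 3 * (indicator upper x * ennreal ((a' x - V' x)\<^sup>2))
      + ennreal (3 * \<delta>\<^sup>2) * indicator ?B x \<partial>lborel)"
    by (intro nn_integral_mono pw)
  also have "\<dots> = 3 * (\<integral>\<^sup>+x. indicator upper x * ennreal ((a x - V x)\<^sup>2) \<partial>lborel) +
      3 * (\<integral>\<^sup>+x. indicator upper x * ennreal ((a' x - V' x)\<^sup>2) \<partial>lborel) + ennreal (3 * \<delta>\<^sup>2) * emeasure lborel ?B"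
    by (rule nn_integral_weighted_sum) measurable
  also have "(\<integral>\<^sup>+x. indicator upper x * ennreal ((a x - V x)\<^sup>2) \<partial>lborel) =
      (\<integral>\<^sup>+x. indicator upper x * ennreal ((?A v x - v x)\<^sup>2) \<partial>lborel)"
    by (intro nn_integral_cong) (auto simp: a_def V_def indicator_def)
  also have "(\<integral>\<^sup>+x. indicator upper x * ennreal ((a' x - V' x)\<^sup>2) \<partial>lborel) =
      (\<integral>\<^sup>+x. indicator upper x * ennreal ((?A v' x - v' x)\<^sup>2) \<partial>lborel)"
    by (intro nn_integral_cong) (auto simp: a'_def V'_def indicator_def)
  also have "3 * (\<integral>\<^sup>+x. indicator upper x * ennreal ((?A v x - v x)\<^sup>2) \<partial>lborel) +
      3 * (\<integral>\<^sup>+x. indicator upper x * ennreal ((?A v' x - v' x)\<^sup>2) \<partial>lborel) + ennreal (3 * \<delta>\<^sup>2) * emeasure lborel ?B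
      \<le> 3 * ennreal (?k * E) + 3 * ennreal (?k * E) + ennreal (3 * \<delta>\<^sup>2) * ennreal (measure lborel ?B)"
  proof (intro add_mono mult_left_mono)
    show "(\<integral>\<^sup>+x. indicator upper x * ennreal ((?A v x - v x)\<^sup>2) \<partial>lborel) \<le> ennreal (?k * E)"
      using v.cell_average_approx[OF assms(3)] E(1)
      by (elim order_trans) (intro ennreal_leI mult_left_mono, auto)
    show "(\<integral>\<^sup>+x. indicator upper x * ennreal ((?A v' x - v' x)\<^sup>2) \<partial>lborel) \<le> ennreal (?k * E)"
      using v'.cell_average_approx[OF assms(3)] E(2)
      by (elim order_trans) (intro ennreal_leI mult_left_mono, auto)
    show "emeasure lborel ?B \<le> ennreal (measure lborel ?B)"
      using emeasure_compact_finite[of ?B] by (simp add: emeasure_eq_ennreal_measure less_top)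
  qed auto
  also have "\<dots> = ennreal (3 * (?k * E) + 3 * (?k * E) + 3 * \<delta>\<^sup>2 * measure lborel ?B)"
  proof -
    have "3 * ennreal X + 3 * ennreal X + ennreal c * ennreal b = ennreal (3 * X + 3 * X + c * b)"
      if "0 \<le> X" "0 \<le> c" "0 \<le> b" for X b c :: real
    proof -
      have "3 * ennreal X = ennreal (3 * X)"
        using that by (simp add: ennreal_mult)
      then show ?thesis
        using that by (simp only: ennreal_plus[symmetric] ennreal_mult[symmetric] mult_nonneg_nonneg
            zero_le_numeral add_nonneg_nonneg)
    qed
    then show ?thesis
      using E0 by simp
  qed
  finally have "(\<integral>x. indicator upper x * (v x - v' x)\<^sup>2 \<partial>lborel) \<le> 3 * (?k * E) + 3 * (?k * E) + 3 * \<delta>\<^sup>2 * measure lborel ?B"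
    using E0 by (subst (asm) ennreal_le_iff) (auto intro!: add_nonneg_nonneg)
  then show ?thesis
    using borel_measurable_integrable[OF int] by (subst integral_upper_lborel) (auto simp: mult_ac)
qed

text \<open>
  Averages over a cell of fixed size are equibounded and equicontinuous, and by the translation
  inequality they are uniformly close to the functions in \<open>L\<^sup>2\<close>.
\<close>
lemma rellich_eps:
  fixes v :: "nat \<Rightarrow> 'n::finite pt \<Rightarrow> real"
  assumes v: "\<And>j. upper_C1_compact (v j) (g j) \<rho>"
    and M: "\<And>j. (\<integral>x. (v j x)\<^sup>2 \<partial>lebesgue_on upper) \<le> M"
    and E: "\<And>j. (\<integral>x. (norm (g j x))\<^sup>2 \<partial>lebesgue_on upper) \<le> E"
    and "0 < \<eta>"
  shows "\<exists>r::nat \<Rightarrow> nat. strict_mono r \<and> (\<forall>i j. (\<integral>x. (v (r i) x - v (r j) x)\<^sup>2 \<partial>lebesgue_on upper) < \<eta>)"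
proof -
  have E': "upper_C1_compact.energy (g j) \<le> E" for j
    using E[of j] upper_C1_compact.measurable_g[OF v[of j]]
    by (simp add: upper_C1_compact.energy_def[OF v[of j]] integral_upper_lborel)
  have M': "(\<integral>x. indicator upper x * (v j x)\<^sup>2 \<partial>lborel) \<le> M" for j
    using M[of j] borel_measurable_integrable[OF upper_C1_compact.integrable_v_square[OF v[of j]]]
    by (simp add: integral_upper_lborel)
  have E0: "E \<ge> 0"
    using E'[of 0] upper_C1_compact.energy_nonneg[OF v[of 0]] by simp
  define d where "d = real CARD('n option)"
  define b where "b = measure lborel (cball (0::'n pt) \<rho>)"
  have b0: "b \<ge> 0"
    by (simp add: b_def)
  \<comment> \<open>Solves \<open>12 * (d * \<epsilon>)\<^sup>2 * (E + 1) = \<eta>\<close>, so that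
    the approximation errors use at most half of \<open>\<eta>\<close>; adding 1 avoids division by
    0. The choice of \<open>\<delta>\<close> below follows the same pattern with the volume
    \<open>b\<close>.\<close>
  define \<epsilon> where "\<epsilon> = sqrt (\<eta> / (12 * (E + 1))) / d"
  have d0: "d > 0"
    by (simp add: d_def)
  have \<epsilon>: "\<epsilon> > 0"
    using \<open>0 < \<eta>\<close> E0 d0 by (simp add: \<epsilon>_def)
  have "(d * \<epsilon>)\<^sup>2 = \<eta> / (12 * (E + 1))"
    using \<open>0 < \<eta>\<close> E0 d0 by (simp add: \<epsilon>_def)
  then have "12 * ((d * \<epsilon>)\<^sup>2 * E) + 12 * (d * \<epsilon>)\<^sup>2 = \<eta>"
    using E0 by (simp add: field_simps)
  then have e1: "6 * (d * \<epsilon>)\<^sup>2 * E \<le> \<eta> / 2"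
    using zero_le_power2[of "d * \<epsilon>"] by linarith
  define \<delta> where "\<delta> = sqrt (\<eta> / (12 * (b + 1)))"
  have \<delta>: "\<delta> > 0"
    using \<open>0 < \<eta>\<close> b0 by (simp add: \<delta>_def)
  have "\<delta>\<^sup>2 = \<eta> / (12 * (b + 1))"
    using \<open>0 < \<eta>\<close> b0 by (simp add: \<delta>_def)
  then have "12 * (\<delta>\<^sup>2 * b) + 12 * \<delta>\<^sup>2 = \<eta>"
    using b0 by (simp add: field_simps)
  then have d1: "3 * \<delta>\<^sup>2 * b < \<eta> / 2"
    using \<delta> b0 mult_nonneg_nonneg[of "\<delta>\<^sup>2" b] zero_less_power[of \<delta> 2] by linarith
  define m where "m = measure lborel (cell \<epsilon> :: 'n pt set)"
  have m: "m > 0"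
    using cell_facts(3)[OF \<epsilon>] by (simp add: m_def)
  let ?K = "upper \<inter> cball (0::'n pt) \<rho>"
  let ?F = "\<lambda>j. cell_average \<epsilon> (v j)"
  define L where "L = sqrt (E / m) + 1"
  have L: "L > 0"
    using E0 m by (simp add: L_def add_nonneg_pos)
  have lip: "\<bar>?F j x - ?F j y\<bar> \<le> L * norm (x - y)" if "x \<in> upper" "y \<in> upper" for j x y
  proof -
    have "sqrt (upper_C1_compact.energy (g j) / m) \<le> L"
      using E'[of j] m by (simp add: L_def add_increasing2 divide_right_mono)
    then show ?thesis
      using upper_C1_compact.cell_average_Lipschitz[OF v[of j] \<epsilon> that]
        mult_right_mono[of _ L "norm (x - y)"] unfolding m_def by (meson norm_ge_zero order_trans)
  qed
  obtain G k where k: "strict_mono (k :: nat \<Rightarrow> nat)"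
    and conv: "\<And>e. 0 < e \<Longrightarrow> \<exists>N. \<forall>n x. n \<ge> N \<and> x \<in> ?K \<longrightarrow> norm (?F (k n) x - G x) < e"
  proof (rule Arzela_Ascoli[of ?K ?F "sqrt (M / m)"])
    show "compact ?K"
      by (simp add: closed_Int_compact)
    show "norm (?F n x) \<le> sqrt (M / m)" if "x \<in> ?K" for n x
    proof -
      have "(?F n x)\<^sup>2 \<le> M / m"
        using upper_C1_compact.cell_average_square_le[OF v[of n] \<epsilon>, of x] that M'[of n] m
          divide_right_mono[of _ M m] unfolding m_def by (meson IntD1 less_imp_le order_trans)
      then show ?thesis
        by (simp add: real_le_rsqrt)
    qed
    show "\<exists>d>0. \<forall>n y. y \<in> ?K \<and> norm (x - y) < d \<longrightarrow> norm (?F n x - ?F n y) < e"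
      if "x \<in> ?K" "0 < e" for x e
    proof (intro exI[of _ "e / L"] conjI allI impI)
      fix n y assume "y \<in> ?K \<and> norm (x - y) < e / L"
      then have "\<bar>?F n x - ?F n y\<bar> \<le> L * norm (x - y)" "L * norm (x - y) < e"
        using lip[of x y n] that L by (auto simp: field_simps)
      then show "norm (?F n x - ?F n y) < e"
        by simp
    qed (use L that in auto)
  qed blast
  obtain N where N: "\<And>n x. n \<ge> N \<Longrightarrow> x \<in> ?K \<Longrightarrow> \<bar>?F (k n) x - G x\<bar> < \<delta> / 2"
    using conv[of "\<delta> / 2"] \<delta> by auto
  \<comment> \<open>Discarding the first \<open>N\<close> terms makes the estimate hold for all
    pairs of indices, the form that survives passing to further subsequences.\<close>
  define r where "r n = k (n + N)" for n
  have "strict_mono r"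
    using k by (auto simp: r_def strict_mono_def)
  moreover have "(\<integral>x. (v (r i) x - v (r j) x)\<^sup>2 \<partial>lebesgue_on upper) < \<eta>" for i j
  proof -
    have "\<bar>?F (r i) x - ?F (r j) x\<bar> \<le> \<delta>" if "x \<in> upper" "norm x \<le> \<rho>" for x
      using N[of "i + N" x] N[of "j + N" x] that unfolding r_def by (simp add: abs_if split: if_splits)
    then have "(\<integral>x. (v (r i) x - v (r j) x)\<^sup>2 \<partial>lebesgue_on upper) \<le> 6 * (d * \<epsilon>)\<^sup>2 * E + 3 * \<delta>\<^sup>2 * b"
      unfolding d_def b_def
      by (intro L2_dist_le_averages[OF v v \<epsilon> E' E']) (use \<delta> in auto)
    then show ?thesis
      using e1 d1 by simp
  qed
  ultimately show ?thesis
    by blast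
qed

text \<open>A diagonal argument over the tolerances \<open>inverse (real (Suc n))\<close>. The
  property \<open>P n\<close> concerns all pairs of indices and is therefore inherited by
  subsequences, as the diagonal construction demands.\<close>

theorem rellich:
  fixes v :: "nat \<Rightarrow> 'n::finite pt \<Rightarrow> real"
  assumes v: "\<And>j. upper_C1_compact (v j) (g j) \<rho>"
    and M: "\<And>j. (\<integral>x. (v j x)\<^sup>2 \<partial>lebesgue_on upper) \<le> M"
    and E: "\<And>j. (\<integral>x. (norm (g j x))\<^sup>2 \<partial>lebesgue_on upper) \<le> E"
  shows "\<exists>s::nat \<Rightarrow> nat. strict_mono s \<and>
    (\<forall>\<eta>>0. \<exists>N. \<forall>i\<ge>N. \<forall>j\<ge>N. (\<integral>x. (v (s i) x - v (s j) x)\<^sup>2 \<partial>lebesgue_on upper) < \<eta>)"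
proof -
  define P where "P n s \<longleftrightarrow> (\<forall>i j. (\<integral>x. (v (s i) x - v (s j) x)\<^sup>2 \<partial>lebesgue_on upper) < inverse (real (Suc n)))"
    for n and s :: "nat \<Rightarrow> nat"
  interpret subseqs P
  proof
    fix n and s :: "nat \<Rightarrow> nat"
    show "\<exists>r'. strict_mono r' \<and> P n (s \<circ> r')"
      using rellich_eps[of "\<lambda>j. v (s j)" "\<lambda>j. g (s j)" \<rho> M E "inverse (real (Suc n))"] v M E
      by (simp add: P_def)
  qed
  have P: "P n (diagseq \<circ> (+) (Suc n))" for n
    by (rule diagseq_holds) (simp add: P_def)
  have "\<exists>N. \<forall>i\<ge>N. \<forall>j\<ge>N. (\<integral>x. (v (diagseq i) x - v (diagseq j) x)\<^sup>2 \<partial>lebesgue_on upper) < \<eta>" if \<eta>: "\<eta> > 0" for \<eta>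
  proof -
    obtain n where n: "inverse (real (Suc n)) < \<eta>"
      using reals_Archimedean[OF \<eta>] by blast
    show ?thesis
    \<comment> \<open>From index \<open>Suc n\<close> on, the diagonal sequence is a subsequence of
      the one selected at stage \<open>n\<close>.\<close>
    proof (intro exI[of _ "Suc n"] allI impI)
      fix i j assume "Suc n \<le> i" "Suc n \<le> j"
      then obtain i' j' where "i = Suc n + i'" "j = Suc n + j'"
        by (auto simp: le_iff_add)
      then show "(\<integral>x. (v (diagseq i) x - v (diagseq j) x)\<^sup>2 \<partial>lebesgue_on upper) < \<eta>"
        using P[of n] n unfolding P_def o_def by (meson less_trans)
    qed
  qed
  then show ?thesis
    using subseq_diagseq by blast
qed

subsection \<open>Square integrable functions\<close>

definition square_integrable :: "'a measure \<Rightarrow> ('a \<Rightarrow> real) \<Rightarrow> bool" where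
  "square_integrable M f \<longleftrightarrow> f \<in> borel_measurable M \<and> integrable M (\<lambda>x. (f x)\<^sup>2)"

lemma Lspace_2_iff: "f \<in> Lspace 2 S \<longleftrightarrow> square_integrable (lebesgue_on S) f"
proof -
  have "real_of_ereal 2 = 2" "(2::ereal) \<noteq> \<infinity>"
    by (simp_all add: numeral_eq_ereal)
  then show ?thesis
    unfolding Lspace_def square_integrable_def by (simp del: numeral_eq_ereal)
qed

lemma square_integrable_measurable [measurable_dest]:
  "square_integrable M f \<Longrightarrow> f \<in> borel_measurable M"
  by (simp add: square_integrable_def)

lemma square_integrable_D: "square_integrable M f \<Longrightarrow> integrable M (\<lambda>x. (f x)\<^sup>2)"
  by (simp add: square_integrable_def)

lemma square_integrable_mult_integrable:
  assumes f: "square_integrable M f" and h: "square_integrable M h"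
  shows "integrable M (\<lambda>x. f x * h x)"
proof (rule Bochner_Integration.integrable_bound)
  show "integrable M (\<lambda>x. (f x)\<^sup>2 + (h x)\<^sup>2)"
    using assms by (simp add: square_integrable_def)
  show "(\<lambda>x. f x * h x) \<in> borel_measurable M"
    using assms unfolding square_integrable_def by (intro borel_measurable_times) auto
  have "\<bar>a * b\<bar> \<le> a\<^sup>2 + b\<^sup>2" for a b :: real
  proof -
    have "0 \<le> (\<bar>a\<bar> - \<bar>b\<bar>)\<^sup>2"
      by simp
    then have "2 * (\<bar>a\<bar> * \<bar>b\<bar>) \<le> a\<^sup>2 + b\<^sup>2"
      by (simp add: power2_diff)
    moreover have "0 \<le> \<bar>a\<bar> * \<bar>b\<bar>"
      by simp
    ultimately show ?thesis
      unfolding abs_mult by linarith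
  qed
  then show "AE x in M. norm (f x * h x) \<le> norm ((f x)\<^sup>2 + (h x)\<^sup>2)"
    by auto
qed

lemma square_integrable_add:
  assumes "square_integrable M f" "square_integrable M h"
  shows "square_integrable M (\<lambda>x. f x + h x)"
  using assms square_integrable_mult_integrable[OF assms]
  by (auto simp: square_integrable_def power2_sum mult.assoc)

lemma square_integrable_cmult:
  assumes "square_integrable M f"
  shows "square_integrable M (\<lambda>x. c * f x)"
  using assms by (auto simp: square_integrable_def power_mult_distrib)

lemma square_integrable_diff:
  assumes "square_integrable M f" "square_integrable M h"
  shows "square_integrable M (\<lambda>x. f x - h x)"
  using square_integrable_add[OF assms(1) square_integrable_cmult[OF assms(2), of "-1"]] by simp

lemma square_integrable_mult_bounded:
  assumes f: "square_integrable M f" and h: "h \<in> borel_measurable M" "\<And>x. x \<in> space M \<Longrightarrow> \<bar>h x\<bar> \<le> C"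
  shows "square_integrable M (\<lambda>x. h x * f x)"
  unfolding square_integrable_def
proof
  show m: "(\<lambda>x. h x * f x) \<in> borel_measurable M"
    using assms unfolding square_integrable_def by (intro borel_measurable_times) auto
  show "integrable M (\<lambda>x. (h x * f x)\<^sup>2)"
  proof (rule Bochner_Integration.integrable_bound)
    show "integrable M (\<lambda>x. C\<^sup>2 * (f x)\<^sup>2)"
      using f by (simp add: square_integrable_def)
    show "(\<lambda>x. (h x * f x)\<^sup>2) \<in> borel_measurable M"
      using m by (rule borel_measurable_power)
    show "AE x in M. norm ((h x * f x)\<^sup>2) \<le> norm (C\<^sup>2 * (f x)\<^sup>2)"
    proof (rule AE_I2)
      fix x assume "x \<in> space M"
      then have "(h x)\<^sup>2 \<le> C\<^sup>2"
        using h(2) abs_le_square_iff[of "h x" C] by force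
      then show "norm ((h x * f x)\<^sup>2) \<le> norm (C\<^sup>2 * (f x)\<^sup>2)"
        by (simp add: power_mult_distrib mult_right_mono)
    qed
  qed
qed

lemma (in finite_measure) square_integrable_bounded:
  assumes "h \<in> borel_measurable M" "\<And>x. x \<in> space M \<Longrightarrow> \<bar>h x\<bar> \<le> C"
  shows "square_integrable M h"
proof -
  have "square_integrable M (\<lambda>_. 1)"
    by (simp add: square_integrable_def)
  from square_integrable_mult_bounded[OF this assms] show ?thesis
    by simp
qed

lemma integral_Cauchy_Schwarz:
  assumes f: "square_integrable M f" and h: "square_integrable M h"
  shows "\<bar>\<integral>x. f x * h x \<partial>M\<bar> \<le> sqrt (\<integral>x. (f x)\<^sup>2 \<partial>M) * sqrt (\<integral>x. (h x)\<^sup>2 \<partial>M)"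
proof -
  define A where "A = (\<integral>x. (f x)\<^sup>2 \<partial>M)"
  define B where "B = (\<integral>x. (h x)\<^sup>2 \<partial>M)"
  define C where "C = (\<integral>x. f x * h x \<partial>M)"
  note i = square_integrable_D[OF f] square_integrable_D[OF h] square_integrable_mult_integrable[OF f h]
  have "C\<^sup>2 \<le> A * B"
  proof (cases "B = 0")
    case True
    then have "AE x in M. (h x)\<^sup>2 = 0"
      using integral_nonneg_eq_0_iff_AE[OF i(2)] by (simp add: B_def)
    then have "AE x in M. f x * h x = 0"
      by eventually_elim simp
    then have "C = 0"
      unfolding C_def by (rule integral_eq_zero_AE)
    then show ?thesis
      using True by simp
  next
    case False
    then have B: "B > 0"
      using integral_nonneg_AE[of "\<lambda>x. (h x)\<^sup>2" M] by (simp add: B_def order.strict_iff_order)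
    have "0 \<le> (\<integral>x. (B * f x - C * h x)\<^sup>2 \<partial>M)"
      by (intro integral_nonneg_AE) auto
    also have "\<dots> = (\<integral>x. B\<^sup>2 * (f x)\<^sup>2 - 2 * B * C * (f x * h x) + C\<^sup>2 * (h x)\<^sup>2 \<partial>M)"
      by (intro Bochner_Integration.integral_cong) (auto simp: power2_eq_square algebra_simps)
    also have "\<dots> = B\<^sup>2 * A - 2 * B * C * C + C\<^sup>2 * B"
      using i by (simp add: A_def B_def C_def)
    finally have "0 \<le> B * (A * B - C\<^sup>2)"
      by (simp add: power2_eq_square algebra_simps)
    then show ?thesis
      using B by (simp add: zero_le_mult_iff)
  qed
  then have "sqrt (C\<^sup>2) \<le> sqrt (A * B)"
    by (rule real_sqrt_le_mono)
  then show ?thesis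
    by (simp add: real_sqrt_mult A_def B_def C_def)
qed

definition square_converges :: "'a measure \<Rightarrow> (nat \<Rightarrow> 'a \<Rightarrow> real) \<Rightarrow> ('a \<Rightarrow> real) \<Rightarrow> bool" where
  "square_converges M F f \<longleftrightarrow> (\<forall>k. square_integrable M (F k)) \<and> square_integrable M f \<and>
     (\<lambda>k. \<integral>x. (F k x - f x)\<^sup>2 \<partial>M) \<longlonglongrightarrow> 0"

lemma L2_converges_iff: "L2_converges S F f \<longleftrightarrow> square_converges (lebesgue_on S) F f"
proof -
  have "(\<lambda>k. sqrt (I k)) \<longlonglongrightarrow> 0 \<longleftrightarrow> I \<longlonglongrightarrow> 0" if "\<And>k. 0 \<le> I k" for I :: "nat \<Rightarrow> real"
  proof
    assume "(\<lambda>k. sqrt (I k)) \<longlonglongrightarrow> 0"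
    then have "(\<lambda>k. (sqrt (I k))\<^sup>2) \<longlonglongrightarrow> 0\<^sup>2"
      by (rule tendsto_power)
    then show "I \<longlonglongrightarrow> 0"
      using that by simp
  next
    assume "I \<longlonglongrightarrow> 0"
    from tendsto_real_sqrt[OF this] show "(\<lambda>k. sqrt (I k)) \<longlonglongrightarrow> 0"
      by simp
  qed
  from this[of "\<lambda>k. \<integral>x. (F k x - f x)\<^sup>2 \<partial>lebesgue_on S"] show ?thesis
    unfolding L2_converges_def square_converges_def Lspace_2_iff L2norm_def
    by (simp add: integral_nonneg_AE)
qed

lemma square_converges_const: "square_integrable M f \<Longrightarrow> square_converges M (\<lambda>_. f) f"
  by (simp add: square_converges_def)

lemma square_converges_perturb:
  assumes F: "square_converges M F f" and H: "\<And>k. square_integrable M (H k)"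
    and d: "(\<lambda>k. \<integral>x. (H k x - F k x)\<^sup>2 \<partial>M) \<longlonglongrightarrow> 0"
  shows "square_converges M H f"
  unfolding square_converges_def
proof (intro conjI allI)
  have sf: "square_integrable M f" "\<And>k. square_integrable M (F k)"
    using F by (simp_all add: square_converges_def)
  show "square_integrable M f" "\<And>k. square_integrable M (H k)"
    by fact+
  show "(\<lambda>k. \<integral>x. (H k x - f x)\<^sup>2 \<partial>M) \<longlonglongrightarrow> 0"
  proof (rule tendsto_sandwich[of "\<lambda>_. 0"])
    show "(\<lambda>k. 2 * (\<integral>x. (H k x - F k x)\<^sup>2 \<partial>M) + 2 * (\<integral>x. (F k x - f x)\<^sup>2 \<partial>M)) \<longlonglongrightarrow> 0"
      using tendsto_add[OF tendsto_mult_left[OF d, of 2] tendsto_mult_left[of _ 0 sequentially 2]] F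
      by (simp add: square_converges_def)
    have i: "integrable M (\<lambda>x. (H k x - F k x)\<^sup>2)" "integrable M (\<lambda>x. (F k x - f x)\<^sup>2)"
      "integrable M (\<lambda>x. (H k x - f x)\<^sup>2)" for k
      using H sf by (auto intro!: square_integrable_D square_integrable_diff)
    have "(\<integral>x. (H k x - f x)\<^sup>2 \<partial>M) \<le> (\<integral>x. 2 * (H k x - F k x)\<^sup>2 + 2 * (F k x - f x)\<^sup>2 \<partial>M)" for k
    proof (rule integral_mono)
      have "(a - c)\<^sup>2 \<le> 2 * (a - b)\<^sup>2 + 2 * (b - c)\<^sup>2" for a b c :: real
        using zero_le_power2[of "(a - b) - (b - c)"] by (simp add: power2_eq_square algebra_simps)
      then show "(H k x - f x)\<^sup>2 \<le> 2 * (H k x - F k x)\<^sup>2 + 2 * (F k x - f x)\<^sup>2" for x .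
    qed (use i in auto)
    then show "\<forall>\<^sub>F k in sequentially. (\<integral>x. (H k x - f x)\<^sup>2 \<partial>M) \<le>
        2 * (\<integral>x. (H k x - F k x)\<^sup>2 \<partial>M) + 2 * (\<integral>x. (F k x - f x)\<^sup>2 \<partial>M)"
      using i by simp
  qed (auto intro!: always_eventually integral_nonneg_AE)
qed

lemma square_converges_add:
  assumes F: "square_converges M F f" and H: "square_converges M H h"
  shows "square_converges M (\<lambda>k x. F k x + H k x) (\<lambda>x. f x + h x)"
proof (rule square_converges_perturb)
  have s: "square_integrable M f" "square_integrable M h" "\<And>k. square_integrable M (H k)"
    "\<And>k. square_integrable M (F k)"
    using assms by (simp_all add: square_converges_def)
  show "square_converges M (\<lambda>k x. F k x + h x) (\<lambda>x. f x + h x)"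
    using F s by (simp add: square_converges_def square_integrable_add)
  show "square_integrable M (\<lambda>x. F k x + H k x)" for k
    using s by (intro square_integrable_add)
  show "(\<lambda>k. \<integral>x. (F k x + H k x - (F k x + h x))\<^sup>2 \<partial>M) \<longlonglongrightarrow> 0"
    using H by (simp add: square_converges_def)
qed

lemma square_converges_mult_bounded:
  assumes F: "square_converges M F f" and h: "h \<in> borel_measurable M" "\<And>x. x \<in> space M \<Longrightarrow> \<bar>h x\<bar> \<le> C"
  shows "square_converges M (\<lambda>k x. h x * F k x) (\<lambda>x. h x * f x)"
  unfolding square_converges_def
proof (intro conjI allI)
  have sf: "square_integrable M f" "\<And>k. square_integrable M (F k)"
    using F by (simp_all add: square_converges_def)
  show "square_integrable M (\<lambda>x. h x * f x)" "\<And>k. square_integrable M (\<lambda>x. h x * F k x)"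
    using sf h by (auto intro: square_integrable_mult_bounded)
  have i: "integrable M (\<lambda>x. (h x * F k x - h x * f x)\<^sup>2)" "integrable M (\<lambda>x. (F k x - f x)\<^sup>2)" for k
    using sf h by (auto intro!: square_integrable_D square_integrable_diff intro: square_integrable_mult_bounded)
  show "(\<lambda>k. \<integral>x. (h x * F k x - h x * f x)\<^sup>2 \<partial>M) \<longlonglongrightarrow> 0"
  proof (rule tendsto_sandwich[of "\<lambda>_. 0"])
    show "(\<lambda>k. C\<^sup>2 * (\<integral>x. (F k x - f x)\<^sup>2 \<partial>M)) \<longlonglongrightarrow> 0"
      using tendsto_mult_left[of _ 0 sequentially "C\<^sup>2"] F by (simp add: square_converges_def)
    have "(\<integral>x. (h x * F k x - h x * f x)\<^sup>2 \<partial>M) \<le> (\<integral>x. C\<^sup>2 * (F k x - f x)\<^sup>2 \<partial>M)" for k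
    proof (rule integral_mono)
      fix x assume "x \<in> space M"
      then have "(h x)\<^sup>2 \<le> C\<^sup>2"
        using h(2) abs_le_square_iff[of "h x" C] by force
      then show "(h x * F k x - h x * f x)\<^sup>2 \<le> C\<^sup>2 * (F k x - f x)\<^sup>2"
        by (simp add: right_diff_distrib[symmetric] power_mult_distrib mult_right_mono)
    qed (use i in auto)
    then show "\<forall>\<^sub>F k in sequentially. (\<integral>x. (h x * F k x - h x * f x)\<^sup>2 \<partial>M) \<le> C\<^sup>2 * (\<integral>x. (F k x - f x)\<^sup>2 \<partial>M)"
      by simp
  qed (auto intro!: always_eventually integral_nonneg_AE)
qed

text \<open>Both factors may vary with \<open>k\<close>. This is how the quadratic complementarity
  term passes to the limit, in which flux and gradient are multiplied.\<close>

lemma square_converges_integral_mult: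
  assumes F: "square_converges M F f" and H: "square_converges M H h"
  shows "(\<lambda>k. \<integral>x. F k x * H k x \<partial>M) \<longlonglongrightarrow> (\<integral>x. f x * h x \<partial>M)"
proof -
  have s: "square_integrable M f" "square_integrable M h" "\<And>k. square_integrable M (H k)"
    "\<And>k. square_integrable M (F k)"
    using assms by (simp_all add: square_converges_def)
  define a where "a k = sqrt (\<integral>x. (F k x - f x)\<^sup>2 \<partial>M)" for k
  define b where "b k = sqrt (\<integral>x. (H k x - h x)\<^sup>2 \<partial>M)" for k
  have lim: "a \<longlonglongrightarrow> 0" "b \<longlonglongrightarrow> 0"
    using assms tendsto_real_sqrt[of _ 0 sequentially]
    unfolding a_def[abs_def] b_def[abs_def] square_converges_def by auto
  define p where "p = sqrt (\<integral>x. (f x)\<^sup>2 \<partial>M)"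
  define q where "q = sqrt (\<integral>x. (h x)\<^sup>2 \<partial>M)"
  have "\<bar>(\<integral>x. F k x * H k x \<partial>M) - (\<integral>x. f x * h x \<partial>M)\<bar> \<le> a k * b k + a k * q + p * b k" for k
  proof -
    have d: "square_integrable M (\<lambda>x. F k x - f x)" "square_integrable M (\<lambda>x. H k x - h x)"
      using s by (auto intro: square_integrable_diff)
    have "(\<integral>x. F k x * H k x \<partial>M) - (\<integral>x. f x * h x \<partial>M) = (\<integral>x. F k x * H k x - f x * h x \<partial>M)"
      using s by (simp add: square_integrable_mult_integrable)
    also have "\<dots> = (\<integral>x. (F k x - f x) * (H k x - h x) + (F k x - f x) * h x + f x * (H k x - h x) \<partial>M)"
      by (intro Bochner_Integration.integral_cong) (auto simp: algebra_simps)
    also have "\<dots> = (\<integral>x. (F k x - f x) * (H k x - h x) \<partial>M) + (\<integral>x. (F k x - f x) * h x \<partial>M)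
        + (\<integral>x. f x * (H k x - h x) \<partial>M)"
      using d s by (subst Bochner_Integration.integral_add
          | intro Bochner_Integration.integrable_add square_integrable_mult_integrable | simp)+
    finally show ?thesis
      using integral_Cauchy_Schwarz[OF d] integral_Cauchy_Schwarz[OF d(1) s(2)]
        integral_Cauchy_Schwarz[OF s(1) d(2)] unfolding a_def b_def p_def q_def by linarith
  qed
  moreover have "(\<lambda>k. a k * b k + a k * q + p * b k) \<longlonglongrightarrow> 0"
    using tendsto_add[OF tendsto_add[OF tendsto_mult[OF lim] tendsto_mult_right[OF lim(1), of q]]
        tendsto_mult_left[OF lim(2), of p]] by simp
  ultimately have "(\<lambda>k. (\<integral>x. F k x * H k x \<partial>M) - (\<integral>x. f x * h x \<partial>M)) \<longlonglongrightarrow> 0"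
    by (auto intro: Lim_null_comparison[OF always_eventually, rotated])
  then show ?thesis
    by (rule Lim_null[THEN iffD2])
qed

lemma square_converges_norm:
  assumes "square_converges M F f"
  shows "(\<lambda>k. \<integral>x. (F k x)\<^sup>2 \<partial>M) \<longlonglongrightarrow> (\<integral>x. (f x)\<^sup>2 \<partial>M)"
  using square_converges_integral_mult[OF assms assms] by (simp add: power2_eq_square)

text \<open>Where \<open>f\<close> is negative, its distance to any nonnegative value is at least
  its absolute value. Hence the L2 norm of the negative part of \<open>f\<close> is bounded by that
  of \<open>F k - f\<close>, with no need for pointwise convergence.\<close>

lemma square_converges_AE_nonneg:
  assumes F: "square_converges M F f" and nn: "\<And>k x. x \<in> space M \<Longrightarrow> 0 \<le> F k x"
  shows "AE x in M. 0 \<le> f x"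
proof -
  have s: "square_integrable M f" "\<And>k. square_integrable M (F k)"
    using assms by (simp_all add: square_converges_def)
  define n where "n x = min 0 (f x)" for x
  have n: "square_integrable M n"
    unfolding square_integrable_def
  proof
    show m: "n \<in> borel_measurable M"
      unfolding n_def[abs_def] using s by measurable
    show "integrable M (\<lambda>x. (n x)\<^sup>2)"
      by (rule Bochner_Integration.integrable_bound[OF square_integrable_D[OF s(1)]])
        (use borel_measurable_power[OF m, of 2] in \<open>auto simp: n_def min_def\<close>)
  qed
  have "(\<integral>x. (n x)\<^sup>2 \<partial>M) \<le> (\<integral>x. (F k x - f x)\<^sup>2 \<partial>M)" for k
  proof (rule integral_mono)
    show "(n x)\<^sup>2 \<le> (F k x - f x)\<^sup>2" if "x \<in> space M" for x
      using nn[OF that, of k] by (auto simp: n_def min_def abs_le_square_iff[symmetric])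
  qed (use s n in \<open>auto intro!: square_integrable_D square_integrable_diff\<close>)
  then have "(\<integral>x. (n x)\<^sup>2 \<partial>M) \<le> 0"
    using F by (intro LIMSEQ_le_const[of "\<lambda>k. \<integral>x. (F k x - f x)\<^sup>2 \<partial>M"]) (auto simp: square_converges_def)
  moreover have "0 \<le> (\<integral>x. (n x)\<^sup>2 \<partial>M)"
    by (intro integral_nonneg_AE) auto
  ultimately have "(\<integral>x. (n x)\<^sup>2 \<partial>M) = 0"
    by simp
  then have "AE x in M. (n x)\<^sup>2 = 0"
    using integral_nonneg_eq_0_iff_AE[OF square_integrable_D[OF n]] by simp
  then show ?thesis
    by eventually_elim (auto simp: n_def min_def split: if_splits)
qed

text \<open>Riesz-Fischer. Along a fast subsequence the increments are summable almost everywhere,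
  which gives a pointwise limit; Fatou's lemma then turns the Cauchy property into L2 convergence to
  it. Finiteness of the measure allows the increments to be summed in L1.\<close>

theorem (in finite_measure) square_integrable_complete:
  fixes f :: "nat \<Rightarrow> 'a \<Rightarrow> real"
  assumes f: "\<And>j. square_integrable M (f j)"
    and Cauchy: "\<And>\<eta>. 0 < \<eta> \<Longrightarrow> \<exists>N. \<forall>i\<ge>N. \<forall>j\<ge>N. (\<integral>x. (f i x - f j x)\<^sup>2 \<partial>M) < \<eta>"
  shows "\<exists>F. square_converges M f F"
proof -
  have sd: "square_integrable M (\<lambda>x. f i x - f j x)" for i j
    using f by (intro square_integrable_diff)
  have "\<exists>N. \<forall>i\<ge>N. \<forall>j\<ge>N. (\<integral>x. (f i x - f j x)\<^sup>2 \<partial>M) < (1/4) ^ k" for k :: nat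
    by (rule Cauchy) simp
  then obtain N where N: "\<And>k i j. N k \<le> i \<Longrightarrow> N k \<le> j \<Longrightarrow> (\<integral>x. (f i x - f j x)\<^sup>2 \<partial>M) < (1/4) ^ k"
    by metis
  \<comment> \<open>The sum places \<open>s k\<close> and \<open>s (Suc k)\<close> beyond
    \<open>N k\<close>, and the summand \<open>k\<close> makes the indices unbounded.\<close>
  define s where "s k = k + (\<Sum>i\<le>k. N i)" for k
  have sN: "N k \<le> s k" "N k \<le> s (Suc k)" "k \<le> s k" for k
    using member_le_sum[of k "{..k}" N] by (auto simp: s_def)
  define d where "d k x = \<bar>f (s (Suc k)) x - f (s k) x\<bar>" for k x
  have dm [measurable]: "d k \<in> borel_measurable M" for k
    unfolding d_def[abs_def] using f by measurable
  define c where "c = measure M (space M)"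
  have dI: "(\<integral>\<^sup>+x. ennreal (d k x) \<partial>M) \<le> ennreal ((1/2) ^ k * (1 + c))" for k
  proof -
    \<comment> \<open>Young's inequality with weight \<open>2 ^ k\<close>: the squared increment
      integrates to less than \<open>(1/4) ^ k\<close>, so both terms contribute on the order of
      \<open>(1/2) ^ k\<close>.\<close>
    have pw: "d k x \<le> 2 ^ k * (f (s (Suc k)) x - f (s k) x)\<^sup>2 + (1/2) ^ k" for x
    proof -
      define t where "t = d k x"
      have "0 \<le> (2 ^ k * t - 1)\<^sup>2" "0 \<le> t"
        by (auto simp: t_def d_def)
      then have "2 * (2 ^ k * t) \<le> (2 ^ k * t)\<^sup>2 + 1" "0 \<le> 2 ^ k * t"
        by (simp_all add: power2_diff)
      then have "2 ^ k * t \<le> (2 ^ k * t)\<^sup>2 + 1"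
        by linarith
      also have "\<dots> = 2 ^ k * (2 ^ k * t\<^sup>2 + (1/2) ^ k)"
        by (simp add: power2_eq_square algebra_simps power_divide)
      finally have "t \<le> 2 ^ k * t\<^sup>2 + (1/2) ^ k"
        by (simp only: mult_le_cancel_left_pos zero_less_power zero_less_numeral)
      then show ?thesis
        by (simp add: t_def d_def)
    qed
    have i: "integrable M (\<lambda>x. 2 ^ k * (f (s (Suc k)) x - f (s k) x)\<^sup>2 + (1/2) ^ k)"
      using square_integrable_D[OF sd] by auto
    have "(\<integral>\<^sup>+x. ennreal (d k x) \<partial>M) \<le> (\<integral>\<^sup>+x. ennreal (2 ^ k * (f (s (Suc k)) x - f (s k) x)\<^sup>2 + (1/2) ^ k) \<partial>M)"
      by (intro nn_integral_mono ennreal_leI pw)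
    also have "\<dots> = ennreal (\<integral>x. 2 ^ k * (f (s (Suc k)) x - f (s k) x)\<^sup>2 + (1/2) ^ k \<partial>M)"
      using i by (intro nn_integral_eq_integral) auto
    also have "\<dots> \<le> ennreal ((1/2) ^ k * (1 + c))"
    proof (rule ennreal_leI)
      have "(\<integral>x. 2 ^ k * (f (s (Suc k)) x - f (s k) x)\<^sup>2 + (1/2) ^ k \<partial>M) =
          2 ^ k * (\<integral>x. (f (s (Suc k)) x - f (s k) x)\<^sup>2 \<partial>M) + (1/2) ^ k * c"
        using square_integrable_D[OF sd] by (simp add: c_def)
      also have "\<dots> \<le> 2 ^ k * (1/4) ^ k + (1/2) ^ k * c"
        using N[OF sN(2) sN(1), of k] by simp
      also have "(2::real) ^ k * (1/4) ^ k = (1/2) ^ k"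
        by (simp add: power_mult_distrib[symmetric])
      finally show "(\<integral>x. 2 ^ k * (f (s (Suc k)) x - f (s k) x)\<^sup>2 + (1/2) ^ k \<partial>M) \<le> (1/2) ^ k * (1 + c)"
        by (simp add: algebra_simps)
    qed
    finally show ?thesis .
  qed
  have "(\<integral>\<^sup>+x. (\<Sum>k. ennreal (d k x)) \<partial>M) = (\<Sum>k. \<integral>\<^sup>+x. ennreal (d k x) \<partial>M)"
    by (rule nn_integral_suminf) simp
  also have "\<dots> \<le> (\<Sum>k. ennreal ((1/2) ^ k * (1 + c)))"
    by (intro suminf_le dI) auto
  also have "\<dots> = ennreal (\<Sum>k. (1/2) ^ k * (1 + c))"
    by (intro suminf_ennreal2) (auto simp: c_def intro!: summable_mult2 summable_geometric)
  also have "\<dots> < \<infinity>"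
    by simp
  finally have "(\<integral>\<^sup>+x. (\<Sum>k. ennreal (d k x)) \<partial>M) \<noteq> \<infinity>"
    by simp
  then have "AE x in M. (\<Sum>k. ennreal (d k x)) \<noteq> \<infinity>"
    by (intro nn_integral_PInf_AE) measurable
  then have conv: "AE x in M. convergent (\<lambda>k. f (s k) x)"
  proof eventually_elim
    case (elim x)
    then have "summable (\<lambda>k. d k x)"
      by (intro summable_suminf_not_top) (auto simp: d_def)
    then have "summable (\<lambda>k. norm (f (s (Suc k)) x - f (s k) x))"
      by (simp add: d_def)
    then have "summable (\<lambda>k. f (s (Suc k)) x - f (s k) x)"
      by (rule summable_norm_cancel)
    then have "convergent (\<lambda>n. \<Sum>k<n. f (s (Suc k)) x - f (s k) x)"
      by (simp add: summable_iff_convergent)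
    then have "convergent (\<lambda>n. f (s n) x - f (s 0) x)"
      using sum_lessThan_telescope[of "\<lambda>k. f (s k) x"] by simp
    then have "convergent (\<lambda>n. f (s 0) x + (f (s n) x - f (s 0) x))"
      by (intro convergent_add convergent_const)
    then show ?case
      by simp
  qed
  define F where "F x = lim (\<lambda>k. f (s k) x)" for x
  have Fm [measurable]: "F \<in> borel_measurable M"
    unfolding F_def[abs_def] using f by (intro borel_measurable_lim_metric) auto
  have fm [measurable]: "f j \<in> borel_measurable M" for j
    using f by (simp add: square_integrable_def)
  have lim: "AE x in M. (\<lambda>k. f (s k) x) \<longlonglongrightarrow> F x"
    using conv by eventually_elim (simp add: F_def convergent_LIMSEQ_iff)
  \<comment> \<open>Stated for the nonnegative integral because square integrability of
    \<open>F\<close> is not yet known; it is deduced from this bound.\<close>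
  have fatou: "(\<integral>\<^sup>+x. ennreal ((f j x - F x)\<^sup>2) \<partial>M) \<le> ennreal \<eta>"
    if Nj: "\<And>i. N' \<le> i \<Longrightarrow> (\<integral>x. (f j x - f i x)\<^sup>2 \<partial>M) < \<eta>" for \<eta> j N'
  proof -
    have "(\<integral>\<^sup>+x. ennreal ((f j x - F x)\<^sup>2) \<partial>M) = (\<integral>\<^sup>+x. liminf (\<lambda>k. ennreal ((f j x - f (s k) x)\<^sup>2)) \<partial>M)"
    proof (rule nn_integral_cong_AE)
      show "AE x in M. ennreal ((f j x - F x)\<^sup>2) = liminf (\<lambda>k. ennreal ((f j x - f (s k) x)\<^sup>2))"
        using lim
      proof eventually_elim
        case (elim x)
        then have "(\<lambda>k. ennreal ((f j x - f (s k) x)\<^sup>2)) \<longlonglongrightarrow> ennreal ((f j x - F x)\<^sup>2)"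
          by (intro tendsto_intros)
        then show ?case
          by (rule lim_imp_Liminf[symmetric, OF trivial_limit_sequentially])
      qed
    qed
    also have "\<dots> \<le> liminf (\<lambda>k. \<integral>\<^sup>+x. ennreal ((f j x - f (s k) x)\<^sup>2) \<partial>M)"
      by (rule nn_integral_liminf) measurable
    also have "\<dots> \<le> liminf (\<lambda>k. ennreal \<eta>)"
    proof (rule Liminf_mono)
      have "(\<integral>\<^sup>+x. ennreal ((f j x - f (s k) x)\<^sup>2) \<partial>M) \<le> ennreal \<eta>" if "N' \<le> k" for k
      proof -
        have "(\<integral>\<^sup>+x. ennreal ((f j x - f (s k) x)\<^sup>2) \<partial>M) = ennreal (\<integral>x. (f j x - f (s k) x)\<^sup>2 \<partial>M)"
          using square_integrable_D[OF sd] by (intro nn_integral_eq_integral) auto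
        then show ?thesis
          using Nj[of "s k"] sN(3)[of k] that by (auto intro!: ennreal_leI)
      qed
      then show "\<forall>\<^sub>F k in sequentially. (\<integral>\<^sup>+x. ennreal ((f j x - f (s k) x)\<^sup>2) \<partial>M) \<le> ennreal \<eta>"
        by (auto simp: eventually_sequentially)
    qed
    also have "\<dots> = ennreal \<eta>"
      by (rule Liminf_const) simp
    finally show ?thesis .
  qed
  have sq: "square_integrable M (\<lambda>x. f j x - F x)" if "\<And>i. N' \<le> i \<Longrightarrow> (\<integral>x. (f j x - f i x)\<^sup>2 \<partial>M) < \<eta>" for \<eta> j N'
    unfolding square_integrable_def using fatou[OF that]
    by (auto simp: integrable_iff_bounded less_top[symmetric] top_unique)
  obtain N1 where N1: "\<And>i j. N1 \<le> i \<Longrightarrow> N1 \<le> j \<Longrightarrow> (\<integral>x. (f i x - f j x)\<^sup>2 \<partial>M) < 1"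
    using Cauchy[of 1] by auto
  have "square_integrable M (\<lambda>x. f N1 x - (f N1 x - F x))"
    using N1 by (intro square_integrable_diff f sq[of N1 _ 1]) auto
  then have F: "square_integrable M F"
    by simp
  have "(\<lambda>k. \<integral>x. (f k x - F x)\<^sup>2 \<partial>M) \<longlonglongrightarrow> 0"
  proof (rule LIMSEQ_I)
    fix \<eta> :: real assume \<eta>: "0 < \<eta>"
    then obtain N2 where N2: "\<And>i j. N2 \<le> i \<Longrightarrow> N2 \<le> j \<Longrightarrow> (\<integral>x. (f i x - f j x)\<^sup>2 \<partial>M) < \<eta> / 2"
      using Cauchy[of "\<eta> / 2"] by auto
    have "norm ((\<integral>x. (f k x - F x)\<^sup>2 \<partial>M) - 0) < \<eta>" if k: "N2 \<le> k" for k
    proof -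
      have "ennreal (\<integral>x. (f k x - F x)\<^sup>2 \<partial>M) = (\<integral>\<^sup>+x. ennreal ((f k x - F x)\<^sup>2) \<partial>M)"
        using square_integrable_D[OF square_integrable_diff[OF f F]]
        by (intro nn_integral_eq_integral[symmetric]) auto
      also have "\<dots> \<le> ennreal (\<eta> / 2)"
        using N2[OF k] by (rule fatou)
      finally have "(\<integral>x. (f k x - F x)\<^sup>2 \<partial>M) \<le> \<eta> / 2"
        using \<eta> by (simp add: ennreal_le_iff)
      moreover have "0 \<le> (\<integral>x. (f k x - F x)\<^sup>2 \<partial>M)"
        by (intro integral_nonneg_AE) auto
      ultimately show ?thesis
        using \<eta> by simp
    qed
    then show "\<exists>no. \<forall>n\<ge>no. norm ((\<integral>x. (f n x - F x)\<^sup>2 \<partial>M) - 0) < \<eta>"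
      by blast
  qed
  then show ?thesis
    using f F by (auto simp: square_converges_def)
qed

subsection \<open>Traces\<close>

lemma prod_Basis_cart:
  fixes x :: "real ^ 'm::finite"
  shows "(\<Prod>b\<in>Basis. x \<bullet> b) = (\<Prod>i\<in>UNIV. x $ i)"
proof -
  have "(Basis :: (real ^ 'm) set) = range (\<lambda>i. axis i 1)"
    by (auto simp: Basis_vec_def)
  moreover have "inj (\<lambda>i::'m. axis i (1::real))"
    by (auto simp: inj_def axis_eq_axis)
  ultimately have "(\<Prod>b\<in>Basis. x \<bullet> b) = prod ((\<bullet>) x \<circ> (\<lambda>i. axis i 1)) UNIV"
    using prod.reindex by metis
  then show ?thesis
    by (simp add: inner_axis o_def)
qed

lemma flat_nth [simp]: "flat x $ None = 0" "flat x $ Some k = x $ k"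
  by (simp_all add: flat_def)

lemma linear_flat: "linear flat"
  by (rule linearI) (auto simp: flat_def vec_eq_iff split: option.splits)

lemma continuous_flat [continuous_intros]: "continuous_on S f \<Longrightarrow> continuous_on S (\<lambda>x. flat (f x))"
  by (rule continuous_on_compose2[OF linear_continuous_on[OF linear_flat[unfolded linear_conv_bounded_linear], of UNIV]]) auto

lemma norm_flat [simp]: "norm (flat x) = norm x"
  by (simp add: norm_vec_def L2_set_def UNIV_option_conv sum.reindex)

lemma flat_upper: "flat x \<in> upper"
  by (simp add: upper_def)

text \<open>Lebesgue measure is determined by its values on boxes, and the preimage of a box under
  this map is a tangential box times a normal interval. This makes Fubini in the normal direction
  available on vectors indexed by \<open>'n option\<close>.\<close>

lemma lborel_flat_product:
  "(lborel :: 'n::finite pt measure) =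
    distr (lborel \<Otimes>\<^sub>M lborel) borel (\<lambda>(x, t). flat x + t *\<^sub>R axis None 1)"
proof (rule lborel_eqI)
  define f :: "(real ^ 'n) \<times> real \<Rightarrow> 'n pt" where "f = (\<lambda>(x, t). flat x + t *\<^sub>R axis None 1)"
  have "continuous_on UNIV f"
    unfolding f_def case_prod_unfold by (intro continuous_intros)
  then have fm: "f \<in> borel_measurable (borel :: ((real ^ 'n) \<times> real) measure)"
    by (rule borel_measurable_continuous_onI)
  then have fm': "f \<in> lborel \<Otimes>\<^sub>M lborel \<rightarrow>\<^sub>M borel"
    by (simp add: lborel_prod)
  have fn: "f (x, t) $ None = t" "f (x, t) $ Some k = x $ k" for x t k
    by (simp_all add: f_def axis_def)
  fix l u :: "'n pt" assume lu: "\<And>b. b \<in> Basis \<Longrightarrow> l \<bullet> b \<le> u \<bullet> b"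
  have le: "l $ i \<le> u $ i" for i
    using lu[of "axis i 1"] by (simp add: inner_axis axis_in_Basis_iff)
  define l' :: "real ^ 'n" where "l' = (\<chi> k. l $ Some k)"
  define u' :: "real ^ 'n" where "u' = (\<chi> k. u $ Some k)"
  have "f -` box l u \<inter> space (lborel \<Otimes>\<^sub>M lborel) = box l' u' \<times> box (l $ None) (u $ None)"
  proof (safe, goal_cases)
    case (1 x t)
    then show ?case by (auto simp: mem_box_cart l'_def u'_def fn dest: spec[of _ "Some _"])
  next
    case (2 x t)
    then show ?case using fn(1)[of x t] by (auto simp: mem_box_cart dest!: spec[of _ None])
  next
    case (3 x t)
    have "l $ i < f (x, t) $ i \<and> f (x, t) $ i < u $ i" for i
      using 3 by (cases i) (auto simp: mem_box_cart l'_def u'_def fn)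
    then show ?case by (simp add: mem_box_cart)
  qed (auto simp: space_pair_measure)
  then have "emeasure (distr (lborel \<Otimes>\<^sub>M lborel) borel f) (box l u) =
      emeasure (lborel \<Otimes>\<^sub>M lborel) (box l' u' \<times> box (l $ None) (u $ None))"
    using fm' by (simp add: emeasure_distr)
  also have "\<dots> = emeasure lborel (box l' u') * emeasure lborel (box (l $ None) (u $ None))"
    by (rule lborel.emeasure_pair_measure_Times) auto
  also have "\<dots> = ennreal (\<Prod>b\<in>Basis. (u' - l') \<bullet> b) * ennreal (u $ None - l $ None)"
  proof -
    have "l' \<bullet> b \<le> u' \<bullet> b" if "b \<in> Basis" for b
      using that le by (auto simp: Basis_vec_def inner_axis l'_def u'_def)
    then have "emeasure lborel (box l' u') = ennreal (\<Prod>b\<in>Basis. (u' - l') \<bullet> b)"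
      by (rule emeasure_lborel_box)
    then show ?thesis
      using le[of None] by simp
  qed
  also have "\<dots> = ennreal ((\<Prod>k\<in>UNIV. u $ Some k - l $ Some k) * (u $ None - l $ None))"
    using le by (simp add: prod_Basis_cart ennreal_mult prod_nonneg u'_def l'_def)
  also have "(\<Prod>k\<in>UNIV. u $ Some k - l $ Some k) * (u $ None - l $ None) = (\<Prod>i\<in>UNIV. (u - l) $ i)"
    by (simp add: UNIV_option_conv prod.reindex mult.commute)
  also have "\<dots> = (\<Prod>b\<in>Basis. (u - l) \<bullet> b)"
    by (simp add: prod_Basis_cart)
  finally show "emeasure (distr (lborel \<Otimes>\<^sub>M lborel) borel (\<lambda>(x, t). flat x + t *\<^sub>R axis None 1)) (box l u) =
      ennreal (\<Prod>b\<in>Basis. (u - l) \<bullet> b)"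
    by (simp add: f_def)
qed simp

lemma nn_integral_flat:
  fixes G :: "'n::finite pt \<Rightarrow> ennreal"
  assumes [measurable]: "G \<in> borel_measurable borel"
  shows "(\<integral>\<^sup>+x. \<integral>\<^sup>+t. G (flat x + t *\<^sub>R axis None 1) \<partial>lborel \<partial>lborel) = (\<integral>\<^sup>+x. G x \<partial>lborel)"
proof -
  let ?f = "\<lambda>(x::real ^ 'n, t). flat x + t *\<^sub>R axis None (1::real)"
  have "continuous_on UNIV ?f"
    unfolding case_prod_unfold by (intro continuous_intros)
  then have "?f \<in> borel_measurable (borel :: ((real ^ 'n) \<times> real) measure)"
    by (rule borel_measurable_continuous_onI)
  then have [measurable]: "?f \<in> lborel \<Otimes>\<^sub>M lborel \<rightarrow>\<^sub>M borel"
    by (simp add: lborel_prod)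
  have "(\<integral>\<^sup>+x. G x \<partial>lborel) = (\<integral>\<^sup>+p. G (?f p) \<partial>(lborel \<Otimes>\<^sub>M lborel))"
    by (subst lborel_flat_product) (rule nn_integral_distr, measurable)
  also have "\<dots> = (\<integral>\<^sup>+x. \<integral>\<^sup>+t. G (?f (x, t)) \<partial>lborel \<partial>lborel)"
    by (rule lborel.nn_integral_fst[symmetric]) measurable
  finally show ?thesis
    by simp
qed

context upper_C1_compact
begin

text \<open>Along the normal ray the function has left its support at height \<open>T\<close>, so
  the boundary value of \<open>v\<^sup>2\<close> is minus the integral of
  \<open>2 * v * (g \<bullet> e)\<close>, which is at most the integral of \<open>v\<^sup>2\<close>
  plus the squared gradient.\<close>

lemma trace_square_pointwise:
  "ennreal ((v (flat x))\<^sup>2) \<le>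
    (\<integral>\<^sup>+t. ennreal (indicator upper (flat x + t *\<^sub>R axis None 1) *
      ((v (flat x + t *\<^sub>R axis None 1))\<^sup>2 + (norm (g (flat x + t *\<^sub>R axis None 1)))\<^sup>2)) \<partial>lborel)"
proof -
  define e :: "'n pt" where "e = axis None 1"
  define T where "T = \<bar>\<rho>\<bar> + 1"
  define c where "c t = flat x + t *\<^sub>R e" for t
  have mem: "c t \<in> upper" if "t \<in> {0..T}" for t
    using that by (simp add: upper_def c_def e_def axis_def)
  have cc: "continuous_on {0..T} c"
    unfolding c_def by (intro continuous_intros)
  have cg: "continuous_on {0..T} (\<lambda>t. g (c t))" and cv: "continuous_on {0..T} (\<lambda>t. v (c t))"
    using mem by (auto intro!: continuous_on_compose2[OF continuous_g cc] continuous_on_compose2[OF continuous_v cc])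
  define f where "f t = 2 * v (c t) * (g (c t) \<bullet> e)" for t
  define h where "h t = (v (c t))\<^sup>2 + (norm (g (c t)))\<^sup>2" for t
  have ch: "continuous_on {0..T} h"
    unfolding h_def using cg cv by (auto intro!: continuous_intros)
  have d: "((\<lambda>t. (v (c t))\<^sup>2) has_vector_derivative f t) (at t within {0..T})" if t: "t \<in> {0..T}" for t
  proof -
    have "(c has_derivative (\<lambda>h. h *\<^sub>R e)) (at t within {0..T})"
      unfolding c_def by (auto intro!: derivative_eq_intros)
    moreover have "(v has_derivative (\<bullet>) (g (c t))) (at (c t) within c ` {0..T})"
      by (rule has_derivative_subset[OF upper_C1D[OF C1 mem[OF t]]]) (use mem in auto)
    ultimately have "((\<lambda>t. v (c t)) has_derivative (\<lambda>h. g (c t) \<bullet> (h *\<^sub>R e))) (at t within {0..T})"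
      by (rule has_derivative_in_compose)
    then have "((\<lambda>t. v (c t)) has_real_derivative (g (c t) \<bullet> e)) (at t within {0..T})"
      by (simp add: has_field_derivative_def mult_commute_abs)
    then have "((\<lambda>t. (v (c t))\<^sup>2) has_real_derivative f t) (at t within {0..T})"
      unfolding f_def by (auto intro!: derivative_eq_intros)
    then show ?thesis
      by (simp add: has_real_derivative_iff_has_vector_derivative)
  qed
  have "(f has_integral ((v (c T))\<^sup>2 - (v (c 0))\<^sup>2)) {0..T}"
    by (rule fundamental_theorem_of_calculus[OF _ d]) (auto simp: T_def)
  moreover have "v (c T) = 0"
  proof (rule supp(1))
    show "c T \<in> upper"
      by (rule mem) (simp add: T_def)
    have "T = \<bar>c T $ None\<bar>"
      by (simp add: c_def e_def axis_def T_def)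
    then show "\<rho> \<le> norm (c T)"
      using component_le_norm_cart[of "c T" None] by (simp add: T_def)
  qed
  ultimately have "((\<lambda>t. - f t) has_integral (v (flat x))\<^sup>2) {0..T}"
    using has_integral_neg[of f "- ((v (c 0))\<^sup>2)"] by (simp add: c_def)
  moreover have "(h has_integral integral {0..T} h) {0..T}"
    using integrable_continuous_interval[OF ch] by (rule integrable_integral)
  ultimately have "(v (flat x))\<^sup>2 \<le> integral {0..T} h"
  proof (rule has_integral_le)
    fix t
    have "\<bar>g (c t) \<bullet> e\<bar> \<le> norm (g (c t))"
      using Cauchy_Schwarz_ineq2[of "g (c t)" e] by (simp add: e_def)
    then have "(g (c t) \<bullet> e)\<^sup>2 \<le> (norm (g (c t)))\<^sup>2"
      by (simp add: abs_le_square_iff[symmetric])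
    then show "- f t \<le> h t"
      using zero_le_power2[of "v (c t) + g (c t) \<bullet> e"]
      unfolding f_def h_def power2_sum by linarith
  qed
  moreover have "integral {0..T} h = (\<integral>t. indicator {0..T} t * h t \<partial>lborel)"
    using set_borel_integral_eq_integral(2)[of "{0..T}" h] borel_integrable_compact[OF _ ch]
    by (simp add: set_lebesgue_integral_def set_integrable_def)
  ultimately have "ennreal ((v (flat x))\<^sup>2) \<le> ennreal (\<integral>t. indicator {0..T} t * h t \<partial>lborel)"
    by (simp add: ennreal_leI)
  also have "\<dots> = (\<integral>\<^sup>+t. ennreal (indicator {0..T} t * h t) \<partial>lborel)"
    using borel_integrable_compact[OF _ ch]
    by (intro nn_integral_eq_integral[symmetric]) (auto simp: h_def)
  also have "\<dots> \<le> (\<integral>\<^sup>+t. ennreal (indicator upper (c t) * h t) \<partial>lborel)"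
    using mem by (intro nn_integral_mono ennreal_leI) (auto simp: indicator_def h_def)
  finally show ?thesis
    by (simp add: c_def h_def e_def)
qed

text \<open>The ray-wise bound integrated over the flat directions. Applied to differences of
  approximants it makes their traces Cauchy.\<close>

lemma trace_square_le:
  "(\<integral>x. (v (flat x))\<^sup>2 \<partial>lebesgue_on (ball 0 r)) \<le>
    (\<integral>x. (v x)\<^sup>2 \<partial>lebesgue_on upper) + (\<integral>x. (norm (g x))\<^sup>2 \<partial>lebesgue_on upper)"
proof -
  define G where "G x = indicator upper x * ((v x)\<^sup>2 + (norm (g x))\<^sup>2)" for x
  have i: "integrable lborel (\<lambda>x. indicator upper x * (v x)\<^sup>2 + indicator upper x * (norm (g x))\<^sup>2)"
    using integrable_v_square integrable_energy by (rule Bochner_Integration.integrable_add)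
  have iG: "integrable lborel G"
    using i by (simp add: G_def[abs_def] distrib_left)
  then have Gm: "G \<in> borel_measurable borel"
    using borel_measurable_integrable by force
  have cflat: "continuous_on UNIV (\<lambda>x. v (flat x))"
    by (rule continuous_on_compose2[OF continuous_v]) (auto intro!: continuous_intros flat_upper)
  have "integrable lborel (\<lambda>x. indicator (ball 0 r) x *\<^sub>R (indicator (cball 0 r) x *\<^sub>R (v (flat x))\<^sup>2))"
    using continuous_on_subset[OF continuous_on_power[OF cflat, of 2]]
    by (intro integrable_mult_indicator borel_integrable_compact) auto
  moreover have "(\<lambda>x. indicator (ball 0 r) x *\<^sub>R (indicator (cball 0 r) x *\<^sub>R (v (flat x))\<^sup>2)) =
      (\<lambda>x. indicator (ball 0 r) x * (v (flat x))\<^sup>2)"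
    by (auto simp: indicator_def fun_eq_iff)
  ultimately have ib: "integrable lborel (\<lambda>x. indicator (ball 0 r) x * (v (flat x))\<^sup>2)"
    by simp
  then have "(\<integral>x. (v (flat x))\<^sup>2 \<partial>lebesgue_on (ball 0 r)) = (\<integral>x. indicator (ball 0 r) x * (v (flat x))\<^sup>2 \<partial>lborel)"
    using borel_measurable_integrable[OF ib] by (simp add: integral_lebesgue_on_indicator integral_completion)
  then have "ennreal (\<integral>x. (v (flat x))\<^sup>2 \<partial>lebesgue_on (ball 0 r)) =
      (\<integral>\<^sup>+x. ennreal (indicator (ball 0 r) x * (v (flat x))\<^sup>2) \<partial>lborel)"
    using ib by (simp add: nn_integral_eq_integral)
  also have "\<dots> \<le> (\<integral>\<^sup>+x. \<integral>\<^sup>+t. ennreal (G (flat x + t *\<^sub>R axis None 1)) \<partial>lborel \<partial>lborel)"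
  proof (rule nn_integral_mono)
    fix x :: "real ^ 'n"
    have "ennreal (indicator (ball 0 r) x * (v (flat x))\<^sup>2) \<le> ennreal ((v (flat x))\<^sup>2)"
      by (auto simp: indicator_def)
    also have "\<dots> \<le> (\<integral>\<^sup>+t. ennreal (G (flat x + t *\<^sub>R axis None 1)) \<partial>lborel)"
      using trace_square_pointwise[of x] by (simp add: G_def)
    finally show "ennreal (indicator (ball 0 r) x * (v (flat x))\<^sup>2) \<le>
        (\<integral>\<^sup>+t. ennreal (G (flat x + t *\<^sub>R axis None 1)) \<partial>lborel)" .
  qed
  also have "\<dots> = (\<integral>\<^sup>+x. ennreal (G x) \<partial>lborel)"
    using Gm by (intro nn_integral_flat) measurable
  also have "\<dots> = ennreal (\<integral>x. G x \<partial>lborel)"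
    by (intro nn_integral_eq_integral iG) (auto simp: G_def)
  finally have "ennreal (\<integral>x. (v (flat x))\<^sup>2 \<partial>lebesgue_on (ball 0 r)) \<le> ennreal (\<integral>x. G x \<partial>lborel)" .
  moreover have "0 \<le> (\<integral>x. G x \<partial>lborel)"
    by (intro integral_nonneg_AE) (auto simp: G_def)
  ultimately have "(\<integral>x. (v (flat x))\<^sup>2 \<partial>lebesgue_on (ball 0 r)) \<le> (\<integral>x. G x \<partial>lborel)"
    by (simp add: ennreal_le_iff)
  also have "(\<integral>x. G x \<partial>lborel) = (\<integral>x. indicator upper x * (v x)\<^sup>2 \<partial>lborel) +
      (\<integral>x. indicator upper x * (norm (g x))\<^sup>2 \<partial>lborel)"
    using integrable_v_square integrable_energy by (simp add: G_def distrib_left)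
  also have "\<dots> = (\<integral>x. (v x)\<^sup>2 \<partial>lebesgue_on upper) + (\<integral>x. (norm (g x))\<^sup>2 \<partial>lebesgue_on upper)"
    using borel_measurable_integrable[OF integrable_v_square] measurable_g
    by (simp add: integral_upper_lborel)
  finally show ?thesis .
qed

end

subsection \<open>Doubling\<close>

text \<open>The annulus contains the ball of radius \<open>r / 8\<close> about the point at height
  \<open>3 * r / 4\<close> on the normal axis: its points have norm between \<open>5 * r / 8\<close>
  and \<open>7 * r / 8\<close> and positive height.\<close>

lemma measure_half_annulus_ge:
  assumes "0 < r"
  shows "measure lebesgue (half_annulus (0::'n::finite pt) (r / 2) r) \<ge>
    unit_ball_vol (real DIM('n pt)) * (1 / 8) ^ DIM('n pt) * r ^ DIM('n pt)"
proof -
  define c :: "'n pt" where "c = (3 * r / 4) *\<^sub>R axis None 1"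
  have nc: "norm c = 3 * r / 4"
    using assms by (simp add: c_def)
  have "ball c (r / 8) \<subseteq> half_annulus 0 (r / 2) r"
  proof
    fix x assume "x \<in> ball c (r / 8)"
    then have d: "norm (c - x) < r / 8"
      by (simp add: dist_norm)
    have "\<bar>(c - x) $ None\<bar> \<le> norm (c - x)"
      by (rule component_le_norm_cart)
    then have "0 \<le> x $ None"
      using d assms by (auto simp: c_def axis_def abs_if split: if_splits)
    moreover have "\<bar>norm c - norm x\<bar> \<le> norm (c - x)"
      by (rule norm_triangle_ineq3)
    then have "norm x < r" "r / 2 \<le> norm x"
      using d nc assms by (auto simp: abs_if split: if_splits)
    ultimately show "x \<in> half_annulus 0 (r / 2) r"
      by (auto simp: half_annulus_def mem_half_ball_0 upper_def)
  qed
  moreover have "half_annulus (0::'n pt) (r / 2) r \<in> lmeasurable"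
    unfolding half_annulus_def using lmeasurable_half_ball[of 0 r] lmeasurable_half_ball[of 0 "r/2"] by (rule fmeasurable.Diff)
  ultimately have "measure lebesgue (ball c (r / 8)) \<le> measure lebesgue (half_annulus (0::'n pt) (r / 2) r)"
    by (intro measure_mono_fmeasurable) auto
  moreover have "measure lebesgue (ball c (r / 8)) = unit_ball_vol (real DIM('n pt)) * (r / 8) ^ DIM('n pt)"
    using assms by (simp add: content_ball)
  ultimately show ?thesis
    by (simp add: power_divide mult.commute)
qed

definition mass :: "('n::finite pt \<Rightarrow> real) \<Rightarrow> real \<Rightarrow> real" where
  "mass w r = (\<integral>x. (w x)\<^sup>2 \<partial>lebesgue_on (half_ball 0 r))"

lemma integral_square_mono:
  fixes w :: "'a::euclidean_space \<Rightarrow> real"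
  assumes "S \<in> sets borel" "T \<in> sets borel" "S \<subseteq> T" "integrable (lebesgue_on T) (\<lambda>x. (w x)\<^sup>2)"
  shows "(\<integral>x. (w x)\<^sup>2 \<partial>lebesgue_on S) \<le> (\<integral>x. (w x)\<^sup>2 \<partial>lebesgue_on T)"
    "integrable (lebesgue_on S) (\<lambda>x. (w x)\<^sup>2)"
proof -
  have T: "integrable lebesgue (\<lambda>x. indicator T x * (w x)\<^sup>2)"
    using assms by (simp add: integral_lebesgue_on_indicator)
  have "integrable lebesgue (\<lambda>x. indicator S x *\<^sub>R (indicator T x * (w x)\<^sup>2))"
    using assms T by (intro integrable_mult_indicator) auto
  moreover have "(\<lambda>x. indicator S x *\<^sub>R (indicator T x * (w x)\<^sup>2)) = (\<lambda>x. indicator S x * (w x)\<^sup>2)"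
    using assms(3) by (auto simp: indicator_def fun_eq_iff)
  ultimately have S: "integrable lebesgue (\<lambda>x. indicator S x * (w x)\<^sup>2)"
    by simp
  then show "integrable (lebesgue_on S) (\<lambda>x. (w x)\<^sup>2)"
    using assms by (simp add: integral_lebesgue_on_indicator)
  have "(\<integral>x. indicator S x * (w x)\<^sup>2 \<partial>lebesgue) \<le> (\<integral>x. indicator T x * (w x)\<^sup>2 \<partial>lebesgue)"
    using S T assms(3) by (intro integral_mono) (auto simp: indicator_def)
  then show "(\<integral>x. (w x)\<^sup>2 \<partial>lebesgue_on S) \<le> (\<integral>x. (w x)\<^sup>2 \<partial>lebesgue_on T)"
    using assms by (simp add: integral_lebesgue_on_indicator)
qed

text \<open>For \<open>r < 1\<close> the logarithm is negative, so an upper bound \<open>n\<close>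
  for the quotient says that the root mean square over the annulus exceeds \<open>r ^ n\<close>.
  Squaring and multiplying by the volume of the annulus gives the exponent
  \<open>d + 2 * n\<close>.\<close>

lemma mass_lower_bound:
  fixes w :: "'n::finite pt \<Rightarrow> real"
  assumes w: "integrable (lebesgue_on (half_ball 0 1)) (\<lambda>x. (w x)\<^sup>2)"
    and fin: "vanishing_order w 0 < \<infinity>"
  obtains c D r0 where "0 < c" "0 < r0" "r0 < 1" "\<And>r. 0 < r \<Longrightarrow> r < r0 \<Longrightarrow> c * r ^ D \<le> mass w r"
proof -
  define d where "d = DIM('n pt)"
  define c where "c = unit_ball_vol (real d) * (1 / 8) ^ d"
  have c: "c > 0"
    by (simp add: c_def)
  obtain n :: nat where n: "vanishing_order w 0 < ereal (real n)"
    using fin less_PInf_Ex_of_nat[of "vanishing_order w 0"] by auto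
  let ?t = "\<lambda>r. sqrt ((\<integral>x. (w x)\<^sup>2 \<partial>lebesgue_on (half_annulus 0 (r / 2) r)) /
                 measure lebesgue (half_annulus (0::'n pt) (r / 2) r))"
  have "\<forall>\<^sub>F r in at_right 0. elog (?t r) / ereal (ln r) < ereal (real n)"
    using Limsup_lessD[OF n[unfolded vanishing_order_def]] .
  then obtain b where b: "b > 0" "\<And>r. 0 < r \<Longrightarrow> r < b \<Longrightarrow> elog (?t r) / ereal (ln r) < ereal (real n)"
    by (auto simp: eventually_at_right_field)
  show thesis
  proof (rule that[of c "min b (1/2)" "d + 2 * n"])
    fix r :: real assume r: "0 < r" "r < min b (1/2)"
    define I where "I = (\<integral>x. (w x)\<^sup>2 \<partial>lebesgue_on (half_annulus 0 (r / 2) r))"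
    define \<mu> where "\<mu> = measure lebesgue (half_annulus (0::'n pt) (r / 2) r)"
    have \<mu>: "\<mu> \<ge> c * r ^ d"
      using measure_half_annulus_ge[OF r(1), where 'n = 'n] by (simp add: \<mu>_def c_def d_def)
    then have \<mu>0: "\<mu> > 0"
      using c r by (intro less_le_trans[of 0 "c * r ^ d" \<mu>]) auto
    have l: "ln r < 0"
      using r by simp
    have e: "elog (sqrt (I / \<mu>)) / ereal (ln r) < ereal (real n)"
      using b(2)[of r] r by (simp add: I_def \<mu>_def)
    \<comment> \<open>For a vanishing mean the quotient would be minus infinity divided by a
      negative number, that is, plus infinity.\<close>
    have t0: "0 < sqrt (I / \<mu>)"
    proof (rule ccontr)
      assume "\<not> ?thesis"
      then have "elog (sqrt (I / \<mu>)) / ereal (ln r) = \<infinity>"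
        using l by (simp add: elog_def divide_ereal_def)
      then show False
        using e by simp
    qed
    then have "ln (sqrt (I / \<mu>)) / ln r < real n"
      using e l by (simp add: elog_def)
    then have "real n * ln r < ln (sqrt (I / \<mu>))"
      using l by (simp add: neg_divide_less_eq)
    then have "ln (r ^ n) < ln (sqrt (I / \<mu>))"
      using r by (simp add: ln_realpow)
    then have "r ^ n < sqrt (I / \<mu>)"
      using r t0 by simp
    then have "(r ^ n)\<^sup>2 < (sqrt (I / \<mu>))\<^sup>2"
      using r by (intro power_strict_mono) auto
    then have "r ^ (2 * n) < I / \<mu>"
      using t0 by (simp add: power_mult[symmetric] mult.commute)
    then have "\<mu> * r ^ (2 * n) \<le> I"
      using \<mu>0 by (simp add: field_simps)
    moreover have "c * r ^ d * r ^ (2 * n) \<le> \<mu> * r ^ (2 * n)"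
      using \<mu> r by (intro mult_right_mono) auto
    moreover have "I \<le> mass w r"
    proof -
      have sub: "half_annulus 0 (r / 2) r \<subseteq> half_ball (0::'n pt) r" "half_ball 0 r \<subseteq> half_ball (0::'n pt) 1"
        using r half_ball_mono[of r 1] by (auto simp: half_annulus_def)
      have "half_annulus (0::'n pt) (r / 2) r \<in> sets borel"
        by (simp add: half_annulus_def sets.Diff)
      then show ?thesis
        unfolding I_def mass_def
        by (intro integral_square_mono(1)[OF _ _ sub(1) integral_square_mono(2)[OF _ _ sub(2) w]]) auto
    qed
    ultimately show "c * r ^ (d + 2 * n) \<le> mass w r"
      by (simp add: power_add mult.assoc)
  qed (use c b in auto)
qed

text \<open>If doubling with constant \<open>2 ^ Suc D\<close> failed at all radii below
  \<open>\<epsilon>\<close>, halving the radius \<open>j\<close> times would divide the mass by at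
  least \<open>2 ^ (Suc D * j)\<close>, while the lower bound permits a loss of order
  \<open>2 ^ (D * j)\<close> only. The surplus \<open>2 ^ j\<close> contradicts finiteness of the
  mass at the starting radius.\<close>

lemma doubling_scales:
  fixes w :: "'n::finite pt \<Rightarrow> real"
  assumes w: "integrable (lebesgue_on (half_ball 0 1)) (\<lambda>x. (w x)\<^sup>2)"
    and fin: "vanishing_order w 0 < \<infinity>"
  obtains C where "\<And>\<epsilon>. 0 < \<epsilon> \<Longrightarrow> \<exists>r. 0 < r \<and> r < \<epsilon> \<and> 0 < mass w r \<and> mass w (2 * r) \<le> C * mass w r"
proof -
  obtain c r0 D where c: "0 < c" "0 < r0" "r0 < 1" and lower: "\<And>r. 0 < r \<Longrightarrow> r < r0 \<Longrightarrow> c * r ^ D \<le> mass w r"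
    by (rule mass_lower_bound[OF assms]) iprover
  have "\<exists>r. 0 < r \<and> r < \<epsilon> \<and> 0 < mass w r \<and> mass w (2 * r) \<le> 2 ^ Suc D * mass w r" if \<epsilon>: "0 < \<epsilon>" for \<epsilon>
  proof (rule ccontr)
    assume neg: "\<not> ?thesis"
    define s where "s = min \<epsilon> r0 / 2"
    have s: "0 < s" "s < \<epsilon>" "s < r0"
      using \<epsilon> c by (auto simp: s_def)
    have sj: "s * (1/2) ^ j \<le> s" "0 < s * (1/2) ^ j" for j :: nat
      using s by (auto simp: mult_le_cancel_left1 power_le_one)
    have decay: "(2 ^ Suc D) ^ j * mass w (s * (1/2) ^ j) \<le> mass w s" for j :: nat
    proof (induction j)
      case (Suc j)
      define r where "r = s * (1/2) ^ Suc j"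
      have "r \<le> s" "0 < r"
        unfolding r_def by (rule sj)+
      then have r: "0 < r" "r < \<epsilon>" "r < r0"
        using s by auto
      then have "0 < mass w r"
        using lower[OF r(1,3)] c by (intro less_le_trans[of 0 "c * r ^ D" "mass w r"]) auto
      then have "2 ^ Suc D * mass w r \<le> mass w (2 * r)"
        using neg r by (force simp: not_le)
      also have "2 * r = s * (1/2) ^ j"
        by (simp add: r_def)
      finally have "(2 ^ Suc D) ^ j * (2 ^ Suc D * mass w r) \<le> (2 ^ Suc D) ^ j * mass w (s * (1/2) ^ j)"
        by (intro mult_left_mono) auto
      also have "\<dots> \<le> mass w s"
        by (rule Suc.IH)
      finally show ?case
        by (simp add: r_def mult_ac)
    qed simp
    have "c * s ^ D * 2 ^ j \<le> mass w s" for j :: nat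
    proof -
      have "(2 ^ Suc D) ^ j * (c * (s * (1/2) ^ j) ^ D) \<le> (2 ^ Suc D) ^ j * mass w (s * (1/2) ^ j)"
        using lower[of "s * (1/2) ^ j"] sj[of j] s by (intro mult_left_mono) auto
      moreover have "(2 ^ Suc D) ^ j * (c * (s * (1/2) ^ j) ^ D) = c * s ^ D * 2 ^ j"
      proof -
        have "((2::real) ^ Suc D) ^ j * ((1/2) ^ j) ^ D = 2 ^ j"
          by (simp add: power_mult_distrib power_mult[symmetric] mult.commute[of j] power_divide)
        then show ?thesis
          by (simp add: power_mult_distrib mult_ac)
      qed
      ultimately show ?thesis
        using decay[of j] by linarith
    qed
    moreover obtain j where "mass w s / (c * s ^ D) < 2 ^ j"
      using real_arch_pow[of 2 "mass w s / (c * s ^ D)"] by auto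
    moreover have "0 < c * s ^ D"
      using c s by simp
    ultimately show False
      by (metis mult.commute not_le pos_divide_less_eq)
  qed
  then show thesis
    by (rule that)
qed

subsection \<open>Energy estimates\<close>

text \<open>
  \<open>F\<close> is the flux \<open>a \<nabla>u\<close>. Its normal component on the flat boundary is \<open>a\<^sup>n\<^sup>+\<^sup>1\<^sup>,\<^sup>n\<^sup>+\<^sup>1 \<partial>\<^sub>n\<^sub>+\<^sub>1u\<close>
  by (A1), so the boundary conditions on the normal derivative are conditions on \<open>F\<close>.
\<close>

definition signorini_flux ::
    "real \<Rightarrow> ('n::finite pt \<Rightarrow> real) \<Rightarrow> ('n pt \<Rightarrow> 'n pt) \<Rightarrow> ('n pt \<Rightarrow> 'n pt) \<Rightarrow> bool" where
  "signorini_flux R u g F \<longleftrightarrow> upper_C1 (half_ball 0 R) u g \<and> continuous_on (half_ball 0 R) F \<and>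
     weakly_div_free (half_ball 0 R) F \<and>
     (\<forall>x\<in>thin_ball 0 R. 0 \<le> u x \<and> F x $ None \<le> 0 \<and> u x * F x $ None = 0)"

lemma signorini_flux_D:
  assumes "signorini_flux R u g F"
  shows "continuous_on (half_ball 0 R) u" "continuous_on (half_ball 0 R) g"
    "continuous_on (half_ball 0 R) F" "upper_C1 (half_ball 0 R) u g" "weakly_div_free (half_ball 0 R) F"
  using assms upper_C1_continuous[OF _ half_ball_upper, of R u g]
  by (auto simp: signorini_flux_def upper_C1_def)

lemma signorini_flux_nonneg:
  assumes "signorini_flux R u g F" "upper_C1 (half_ball 0 R) \<phi> \<psi>" "0 \<le> \<rho>" "\<rho> < R"
    and "\<And>x. x \<in> upper \<Longrightarrow> \<rho> \<le> norm x \<Longrightarrow> \<phi> x = 0" "\<And>x. x \<in> upper \<Longrightarrow> \<rho> \<le> norm x \<Longrightarrow> \<psi> x = 0"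
    and "\<And>x. x \<in> thin_ball 0 R \<Longrightarrow> 0 \<le> \<phi> x"
  shows "0 \<le> (\<integral>x. F x \<bullet> \<psi> x \<partial>lebesgue_on upper)"
  using assms signorini_flux_D[OF assms(1)]
  by (intro flux_integral_nonneg[of R F \<phi> \<psi> \<rho>]) (auto simp: signorini_flux_def mult_nonpos_nonneg)

text \<open>On the flat boundary the normal flux times \<open>u\<close> is 0, so both
  \<open>\<theta> * u\<close> and its negative are admissible, whatever the sign of
  \<open>\<theta>\<close>.\<close>

lemma signorini_flux_complementarity:
  assumes S: "signorini_flux R u g F" and \<theta>: "upper_C1 (half_ball 0 R) \<theta> \<xi>" and "0 \<le> \<rho>" "\<rho> < R"
    and z: "\<And>x. x \<in> upper \<Longrightarrow> \<rho> \<le> norm x \<Longrightarrow> \<theta> x = 0" "\<And>x. x \<in> upper \<Longrightarrow> \<rho> \<le> norm x \<Longrightarrow> \<xi> x = 0"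
  shows "(\<integral>x. F x \<bullet> (\<theta> x *\<^sub>R g x + u x *\<^sub>R \<xi> x) \<partial>lebesgue_on upper) = 0"
proof -
  note D = signorini_flux_D[OF S]
  have C: "upper_C1 (half_ball 0 R) (\<lambda>x. \<theta> x * u x) (\<lambda>x. \<theta> x *\<^sub>R g x + u x *\<^sub>R \<xi> x)"
    by (rule upper_C1_mult[OF \<theta> D(4) half_ball_upper])
  have flat: "F x $ None * (\<theta> x * u x) \<le> 0" "F x $ None * - (\<theta> x * u x) \<le> 0" if "x \<in> thin_ball 0 R" for x
    using S that by (auto simp: signorini_flux_def)
  have "0 \<le> (\<integral>x. F x \<bullet> (\<theta> x *\<^sub>R g x + u x *\<^sub>R \<xi> x) \<partial>lebesgue_on upper)"
    using flat z by (intro flux_integral_nonneg[OF D(3,5) C assms(3,4)]) auto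
  moreover have "0 \<le> (\<integral>x. F x \<bullet> - (\<theta> x *\<^sub>R g x + u x *\<^sub>R \<xi> x) \<partial>lebesgue_on upper)"
    using flat z by (intro flux_integral_nonneg[OF D(3,5) upper_C1_minus[OF C] assms(3,4)]) auto
  ultimately show ?thesis
    unfolding inner_minus_right by simp
qed

text \<open>With \<open>a\<close>, \<open>b\<close>, \<open>c\<close> as in the proof, the
  difference of the two sides is the sum of the squared norms of \<open>a /\<^sub>R 2 + b\<close>,
  \<open>a /\<^sub>R 2 + 2 *\<^sub>R c\<close> and \<open>b + c\<close>. This is the origin of the
  constants 2 and 5.\<close>

lemma energy_pointwise:
  fixes D E \<zeta> :: "'a::real_inner"
  shows "(D + E) \<bullet> (\<eta>\<^sup>2 *\<^sub>R D + (2 * \<eta> * d) *\<^sub>R \<zeta>) \<ge>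
    \<eta>\<^sup>2 * (norm D)\<^sup>2 / 2 - 2 * (\<eta>\<^sup>2 * (norm E)\<^sup>2) - 5 * (d\<^sup>2 * (norm \<zeta>)\<^sup>2)"
proof -
  define a where "a = \<eta> *\<^sub>R D"
  define b where "b = \<eta> *\<^sub>R E"
  define c where "c = d *\<^sub>R \<zeta>"
  have "(D + E) \<bullet> (\<eta>\<^sup>2 *\<^sub>R D + (2 * \<eta> * d) *\<^sub>R \<zeta>) = (a + b) \<bullet> (a + 2 *\<^sub>R c)"
    by (simp add: a_def b_def c_def inner_add_left inner_add_right power2_eq_square algebra_simps)
  moreover have "0 \<le> (a /\<^sub>R 2 + b) \<bullet> (a /\<^sub>R 2 + b)" "0 \<le> (a /\<^sub>R 2 + 2 *\<^sub>R c) \<bullet> (a /\<^sub>R 2 + 2 *\<^sub>R c)"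
    "0 \<le> (b + c) \<bullet> (b + c)"
    by simp_all
  then have "(a + b) \<bullet> (a + 2 *\<^sub>R c) \<ge> (a \<bullet> a) / 2 - 2 * (b \<bullet> b) - 5 * (c \<bullet> c)"
    by (simp add: inner_add_left inner_add_right inner_commute[of b a] inner_commute[of c a]
        inner_commute[of c b] algebra_simps)
  moreover have "a \<bullet> a = \<eta>\<^sup>2 * (norm D)\<^sup>2" "b \<bullet> b = \<eta>\<^sup>2 * (norm E)\<^sup>2" "c \<bullet> c = d\<^sup>2 * (norm \<zeta>)\<^sup>2"
    unfolding a_def b_def c_def dot_square_norm by (simp_all add: power_mult_distrib)
  ultimately show ?thesis
    by simp
qed

locale cutoff =
  fixes \<eta> :: "'n::finite pt \<Rightarrow> real" and \<zeta> :: "'n pt \<Rightarrow> 'n pt" and \<rho> R :: real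
  assumes \<eta>: "upper_C1 upper \<eta> \<zeta>"
    and range: "0 \<le> \<eta> x" "\<eta> x \<le> 1"
    and outside: "\<rho> \<le> norm x \<Longrightarrow> \<eta> x = 0" "\<rho> \<le> norm x \<Longrightarrow> \<zeta> x = 0"
    and radii: "0 \<le> \<rho>" "\<rho> < R"
begin

lemma continuous_cutoff: "continuous_on (half_ball 0 R) \<eta>" "continuous_on (half_ball 0 R) \<zeta>"
  using \<eta> upper_C1_continuous[OF \<eta>] half_ball_upper
  by (auto simp: upper_C1_def intro: continuous_on_subset)

lemma integrable_cutoff:
  assumes "continuous_on (half_ball 0 R) f"
  shows "integrable (lebesgue_on upper) (\<lambda>x. (\<eta> x)\<^sup>2 * f x)"
    "integrable (lebesgue_on upper) (\<lambda>x. f x * (norm (\<zeta> x))\<^sup>2)"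
  using assms outside continuous_cutoff radii
  by (auto intro!: integrable_half_ball_support(2)[of R _ \<rho>] continuous_intros)

text \<open>
  Each solution competes against the other: \<open>u\<^sub>1 + \<eta>\<^sup>2 (u\<^sub>2 - u\<^sub>1)\<close> is admissible for the first
  variational inequality and \<open>u\<^sub>2 + \<eta>\<^sup>2 (u\<^sub>1 - u\<^sub>2)\<close> for the second.
\<close>
lemma energy_difference:
  assumes S1: "signorini_flux R u1 g1 F1" and S2: "signorini_flux R u2 g2 F2"
  shows "(\<integral>x. (\<eta> x)\<^sup>2 * (norm (g1 x - g2 x))\<^sup>2 \<partial>lebesgue_on upper) \<le>
    4 * (\<integral>x. (\<eta> x)\<^sup>2 * (norm ((F1 x - g1 x) - (F2 x - g2 x)))\<^sup>2 \<partial>lebesgue_on upper)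
    + 10 * (\<integral>x. (u1 x - u2 x)\<^sup>2 * (norm (\<zeta> x))\<^sup>2 \<partial>lebesgue_on upper)"
proof -
  note D1 = signorini_flux_D[OF S1] and D2 = signorini_flux_D[OF S2]
  have \<eta>C: "upper_C1 (half_ball 0 R) \<eta> \<zeta>"
    using \<eta> half_ball_upper by (rule upper_C1_subset)
  define d where "d x = u1 x - u2 x" for x
  define D where "D x = g1 x - g2 x" for x
  define E where "E x = (F1 x - g1 x) - (F2 x - g2 x)" for x
  define \<psi> where "\<psi> x = (\<eta> x * \<eta> x) *\<^sub>R D x + d x *\<^sub>R (\<eta> x *\<^sub>R \<zeta> x + \<eta> x *\<^sub>R \<zeta> x)" for x
  have c: "continuous_on (half_ball 0 R) d" "continuous_on (half_ball 0 R) D"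
    "continuous_on (half_ball 0 R) E"
    unfolding d_def D_def E_def using D1 D2 by (intro continuous_intros; simp)+
  have dC: "upper_C1 (half_ball 0 R) (\<lambda>x. \<eta> x * \<eta> x * d x) \<psi>"
    unfolding \<psi>_def d_def D_def
    by (intro upper_C1_mult upper_C1_diff \<eta>C D1 D2 half_ball_upper)
  have z: "\<eta> x * \<eta> x * d x = 0" "\<psi> x = 0" if "\<rho> \<le> norm x" for x
    using outside[OF that] by (simp_all add: \<psi>_def)
  have i1: "0 \<le> (\<integral>x. F1 x \<bullet> - \<psi> x \<partial>lebesgue_on upper)"
  proof (rule flux_integral_nonneg[OF D1(3,5) upper_C1_minus[OF dC] radii])
    show "F1 x $ None * - (\<eta> x * \<eta> x * d x) \<le> 0" if x: "x \<in> thin_ball 0 R" for x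
    proof -
      have f: "u1 x * F1 x $ None = 0" "F1 x $ None \<le> 0" "0 \<le> u2 x"
        using S1 S2 x by (auto simp: signorini_flux_def)
      have "F1 x $ None * - (\<eta> x * \<eta> x * d x) = (\<eta> x * \<eta> x) * (u2 x * F1 x $ None - u1 x * F1 x $ None)"
        by (simp add: d_def algebra_simps)
      also have "\<dots> = (\<eta> x * \<eta> x) * (u2 x * F1 x $ None)"
        using f(1) by simp
      also have "\<dots> \<le> 0"
        using f by (intro mult_nonneg_nonpos) auto
      finally show ?thesis .
    qed
  qed (use z in auto)
  have i2: "0 \<le> (\<integral>x. F2 x \<bullet> \<psi> x \<partial>lebesgue_on upper)"
  proof (rule flux_integral_nonneg[OF D2(3,5) dC radii])
    show "F2 x $ None * (\<eta> x * \<eta> x * d x) \<le> 0" if x: "x \<in> thin_ball 0 R" for x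
    proof -
      have f: "u2 x * F2 x $ None = 0" "F2 x $ None \<le> 0" "0 \<le> u1 x"
        using S1 S2 x by (auto simp: signorini_flux_def)
      have "F2 x $ None * (\<eta> x * \<eta> x * d x) = (\<eta> x * \<eta> x) * (u1 x * F2 x $ None - u2 x * F2 x $ None)"
        by (simp add: d_def algebra_simps)
      also have "\<dots> = (\<eta> x * \<eta> x) * (u1 x * F2 x $ None)"
        using f(1) by simp
      also have "\<dots> \<le> 0"
        using f by (intro mult_nonneg_nonpos) auto
      finally show ?thesis .
    qed
  qed (use z in auto)
  have int: "integrable (lebesgue_on upper) (\<lambda>x. F1 x \<bullet> \<psi> x)" "integrable (lebesgue_on upper) (\<lambda>x. F2 x \<bullet> \<psi> x)"
    "integrable (lebesgue_on upper) (\<lambda>x. (\<eta> x)\<^sup>2 * (norm (D x))\<^sup>2)"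
    "integrable (lebesgue_on upper) (\<lambda>x. (\<eta> x)\<^sup>2 * (norm (E x))\<^sup>2)"
    "integrable (lebesgue_on upper) (\<lambda>x. (d x)\<^sup>2 * (norm (\<zeta> x))\<^sup>2)"
  proof -
    have c\<psi>: "continuous_on (half_ball 0 R) \<psi>"
      using dC by (simp add: upper_C1_def)
    show "integrable (lebesgue_on upper) (\<lambda>x. F1 x \<bullet> \<psi> x)" "integrable (lebesgue_on upper) (\<lambda>x. F2 x \<bullet> \<psi> x)"
      using c\<psi> D1(3) D2(3) z radii
      by (auto intro!: integrable_half_ball_support(2)[of R _ \<rho>] continuous_intros)
    show "integrable (lebesgue_on upper) (\<lambda>x. (\<eta> x)\<^sup>2 * (norm (D x))\<^sup>2)"
      "integrable (lebesgue_on upper) (\<lambda>x. (\<eta> x)\<^sup>2 * (norm (E x))\<^sup>2)"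
      "integrable (lebesgue_on upper) (\<lambda>x. (d x)\<^sup>2 * (norm (\<zeta> x))\<^sup>2)"
      using c by (auto intro!: integrable_cutoff continuous_intros)
  qed
  \<comment> \<open>Adding \<open>i1\<close> and \<open>i2\<close> shows that
    \<open>F1 - F2\<close>, which is \<open>D + E\<close>, has a nonpositive integral against
    \<open>\<psi>\<close>. Clearing the factor 1/2 in front of the energy doubles the constants 2
    and 5 to 4 and 10.\<close>
  have "(\<integral>x. (\<eta> x)\<^sup>2 * (norm (D x))\<^sup>2 / 2 - 2 * ((\<eta> x)\<^sup>2 * (norm (E x))\<^sup>2) - 5 * ((d x)\<^sup>2 * (norm (\<zeta> x))\<^sup>2) \<partial>lebesgue_on upper)
      \<le> (\<integral>x. F1 x \<bullet> \<psi> x - F2 x \<bullet> \<psi> x \<partial>lebesgue_on upper)"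
  proof (rule integral_mono)
    fix x
    have "F1 x \<bullet> \<psi> x - F2 x \<bullet> \<psi> x = (D x + E x) \<bullet> ((\<eta> x)\<^sup>2 *\<^sub>R D x + (2 * \<eta> x * d x) *\<^sub>R \<zeta> x)"
    proof -
      have "\<psi> x = (\<eta> x)\<^sup>2 *\<^sub>R D x + (2 * \<eta> x * d x) *\<^sub>R \<zeta> x"
        by (simp add: \<psi>_def power2_eq_square scaleR_add_right[symmetric] scaleR_2[symmetric] mult_ac)
      moreover have "D x + E x = F1 x - F2 x"
        by (simp add: D_def E_def)
      ultimately show ?thesis
        by (simp add: inner_diff_left)
    qed
    then show "(\<eta> x)\<^sup>2 * (norm (D x))\<^sup>2 / 2 - 2 * ((\<eta> x)\<^sup>2 * (norm (E x))\<^sup>2) - 5 * ((d x)\<^sup>2 * (norm (\<zeta> x))\<^sup>2)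
        \<le> F1 x \<bullet> \<psi> x - F2 x \<bullet> \<psi> x"
      using energy_pointwise[of "\<eta> x" "D x" "E x" "d x" "\<zeta> x"] by simp
  qed (use int in auto)
  also have "\<dots> \<le> 0"
    using i1 i2 int by simp
  finally show ?thesis
    using int by (simp add: d_def[symmetric] D_def[symmetric] E_def[symmetric])
qed

text \<open>The zero function is a competitor with zero flux, so this is
  \<open>energy_difference\<close> against it. The defect contributes at most 4/16 of the left side;
  absorbing it leaves the factor 40/3, rounded up to 14.\<close>

lemma caccioppoli:
  assumes S: "signorini_flux R u g F" and e: "\<And>x. x \<in> half_ball 0 R \<Longrightarrow> norm (F x - g x) \<le> norm (g x) / 4"
  shows "(\<integral>x. (\<eta> x)\<^sup>2 * (norm (g x))\<^sup>2 \<partial>lebesgue_on upper) \<le>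
    14 * (\<integral>x. (u x)\<^sup>2 * (norm (\<zeta> x))\<^sup>2 \<partial>lebesgue_on upper)"
proof -
  note D = signorini_flux_D[OF S]
  have S0: "signorini_flux R (\<lambda>_. 0) (\<lambda>_. 0) (\<lambda>_::'n pt. 0)"
  proof -
    have "((\<lambda>_. 0) has_derivative (\<bullet>) 0) (at x within upper)" for x :: "'n pt"
      by (rule has_derivative_eq_rhs[OF has_derivative_const]) (simp add: fun_eq_iff)
    then show ?thesis
      by (simp add: signorini_flux_def upper_C1_def weakly_div_free_def)
  qed
  have int: "integrable (lebesgue_on upper) (\<lambda>x. (\<eta> x)\<^sup>2 * (norm (g x))\<^sup>2)"
    "integrable (lebesgue_on upper) (\<lambda>x. (\<eta> x)\<^sup>2 * (norm (F x - g x))\<^sup>2)"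
    using D by (auto intro!: integrable_cutoff continuous_intros)
  have "(\<integral>x. (\<eta> x)\<^sup>2 * (norm (F x - g x))\<^sup>2 \<partial>lebesgue_on upper) \<le>
      (\<integral>x. (\<eta> x)\<^sup>2 * (norm (g x))\<^sup>2 / 16 \<partial>lebesgue_on upper)"
  proof (rule integral_mono)
    fix x :: "'n pt" assume "x \<in> space (lebesgue_on upper)"
    then have x: "x \<in> upper"
      by simp
    show "(\<eta> x)\<^sup>2 * (norm (F x - g x))\<^sup>2 \<le> (\<eta> x)\<^sup>2 * (norm (g x))\<^sup>2 / 16"
    proof (cases "norm x < R")
      case True
      then have "(norm (F x - g x))\<^sup>2 \<le> (norm (g x) / 4)\<^sup>2"
        using e[of x] x by (intro power_mono) (auto simp: mem_half_ball_0)
      then show ?thesis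
        by (simp add: power_divide mult_left_mono flip: times_divide_eq_right)
    qed (use outside radii in auto)
  qed (use int in auto)
  moreover have "0 \<le> (\<integral>x. (u x)\<^sup>2 * (norm (\<zeta> x))\<^sup>2 \<partial>lebesgue_on upper)"
    by (intro integral_nonneg_AE) auto
  moreover have "(\<integral>x. (\<eta> x)\<^sup>2 * (norm (g x))\<^sup>2 / 16 \<partial>lebesgue_on upper) =
      (\<integral>x. (\<eta> x)\<^sup>2 * (norm (g x))\<^sup>2 \<partial>lebesgue_on upper) / 16"
    by simp
  ultimately show ?thesis
    using energy_difference[OF S S0] unfolding diff_zero by linarith
qed

end

subsection \<open>Rescaling\<close>

lemma lborel_integral_scale:
  fixes h :: "'a::euclidean_space \<Rightarrow> real"
  assumes [measurable]: "h \<in> borel_measurable borel" and "0 < \<sigma>"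
  shows "(\<integral>x. h x \<partial>lborel) = \<sigma> ^ DIM('a) * (\<integral>x. h (\<sigma> *\<^sub>R x) \<partial>lborel)"
proof -
  have "(\<integral>x. h x \<partial>lborel) = (\<integral>x. h x \<partial>density (distr lborel borel (\<lambda>x. 0 + \<sigma> *\<^sub>R x)) (\<lambda>_. ennreal (\<bar>\<sigma>\<bar> ^ DIM('a))))"
    using lborel_affine[of \<sigma> "0::'a"] assms by simp
  also have "\<dots> = (\<integral>x. \<bar>\<sigma>\<bar> ^ DIM('a) * h x \<partial>distr lborel borel (\<lambda>x. 0 + \<sigma> *\<^sub>R x))"
    by (subst integral_density) auto
  also have "\<dots> = (\<integral>x. \<bar>\<sigma>\<bar> ^ DIM('a) * h (0 + \<sigma> *\<^sub>R x) \<partial>lborel)"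
    by (rule integral_distr) auto
  finally show ?thesis
    using assms by simp
qed

lemma scale_half_ball:
  fixes x :: "'n::finite pt"
  assumes "0 < \<sigma>"
  shows "\<sigma> *\<^sub>R x \<in> half_ball 0 (\<sigma> * R) \<longleftrightarrow> x \<in> half_ball 0 R"
    "\<sigma> *\<^sub>R x \<in> thin_ball 0 (\<sigma> * R) \<longleftrightarrow> x \<in> thin_ball 0 R"
  using assms by (auto simp: thin_ball_def mem_half_ball_0 upper_def zero_le_mult_iff)

lemma integral_half_ball_scale:
  fixes h :: "'n::finite pt \<Rightarrow> real"
  assumes h: "continuous_on (half_ball 0 (\<sigma> * R)) h" and "0 < \<sigma>"
  shows "(\<integral>x. h x \<partial>lebesgue_on (half_ball 0 (\<sigma> * R))) =
    \<sigma> ^ DIM('n pt) * (\<integral>x. h (\<sigma> *\<^sub>R x) \<partial>lebesgue_on (half_ball 0 R))"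
proof -
  define H where "H x = indicator (half_ball 0 (\<sigma> * R)) x * h x" for x
  have Hm [measurable]: "H \<in> borel_measurable borel"
    using borel_measurable_continuous_on_indicator[OF borel_half_ball h] by (simp add: H_def[abs_def])
  have ind: "H (\<sigma> *\<^sub>R x) = indicator (half_ball 0 R) x * h (\<sigma> *\<^sub>R x)" for x
    using scale_half_ball(1)[OF \<open>0 < \<sigma>\<close>, of x R] by (simp add: H_def indicator_def)
  have "(\<integral>x. h x \<partial>lebesgue_on (half_ball 0 (\<sigma> * R))) = (\<integral>x. H x \<partial>lborel)"
    using Hm by (simp add: integral_lebesgue_on_indicator H_def[symmetric] integral_completion)
  also have "\<dots> = \<sigma> ^ DIM('n pt) * (\<integral>x. H (\<sigma> *\<^sub>R x) \<partial>lborel)"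
    by (rule lborel_integral_scale[OF Hm \<open>0 < \<sigma>\<close>])
  also have "(\<integral>x. H (\<sigma> *\<^sub>R x) \<partial>lborel) = (\<integral>x. h (\<sigma> *\<^sub>R x) \<partial>lebesgue_on (half_ball 0 R))"
  proof -
    have "(\<lambda>x. H (\<sigma> *\<^sub>R x)) \<in> borel_measurable borel"
      by measurable
    then show ?thesis
      by (simp add: integral_lebesgue_on_indicator ind[symmetric] integral_completion)
  qed
  finally show ?thesis .
qed

lemma test_function_scale:
  fixes \<phi> :: "'n::finite pt \<Rightarrow> real"
  assumes \<phi>: "\<phi> \<in> test_functions (interior (half_ball 0 R))" and \<sigma>: "0 < \<sigma>" "\<sigma> * R \<le> r"
  shows "(\<lambda>y. \<phi> (y /\<^sub>R \<sigma>)) \<in> test_functions (interior (half_ball 0 r))"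
    "grad UNIV (\<lambda>y. \<phi> (y /\<^sub>R \<sigma>)) x = grad UNIV \<phi> (x /\<^sub>R \<sigma>) /\<^sub>R \<sigma>"
proof -
  have C: "C1_on UNIV \<phi>"
    using \<phi> by (simp add: test_functions_def)
  have d: "((\<lambda>y. \<phi> (y /\<^sub>R \<sigma>)) has_derivative (\<lambda>h. (grad UNIV \<phi> (x /\<^sub>R \<sigma>) /\<^sub>R \<sigma>) \<bullet> h)) (at x)" for x
  proof -
    have "((\<lambda>y. y /\<^sub>R \<sigma>) has_derivative (\<lambda>h. h /\<^sub>R \<sigma>)) (at x)"
      by (auto intro!: derivative_eq_intros)
    from has_derivative_compose[OF this C1_on_UNIV_derivative[OF C]]
    show ?thesis
      by simp
  qed
  then show "grad UNIV (\<lambda>y. \<phi> (y /\<^sub>R \<sigma>)) x = grad UNIV \<phi> (x /\<^sub>R \<sigma>) /\<^sub>R \<sigma>"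
    by (rule grad_UNIV_eq)
  define K where "K = closure {x. \<phi> x \<noteq> 0}"
  have K: "compact K" "K \<subseteq> interior (half_ball 0 R)"
    using \<phi> by (simp_all add: test_functions_def K_def)
  have cK: "compact ((*\<^sub>R) \<sigma> ` K)"
    using K by (intro compact_scaling)
  have "{y. \<phi> (y /\<^sub>R \<sigma>) \<noteq> 0} \<subseteq> (*\<^sub>R) \<sigma> ` K"
  proof
    fix y assume "y \<in> {y. \<phi> (y /\<^sub>R \<sigma>) \<noteq> 0}"
    then have "y /\<^sub>R \<sigma> \<in> K"
      using closure_subset[of "{x. \<phi> x \<noteq> 0}"] by (auto simp: K_def)
    then have "\<sigma> *\<^sub>R (y /\<^sub>R \<sigma>) \<in> (*\<^sub>R) \<sigma> ` K"
      by (rule imageI)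
    then show "y \<in> (*\<^sub>R) \<sigma> ` K"
      using \<sigma> by simp
  qed
  then have cl: "closure {y. \<phi> (y /\<^sub>R \<sigma>) \<noteq> 0} \<subseteq> (*\<^sub>R) \<sigma> ` K"
    using cK by (intro closure_minimal compact_imp_closed)
  have sub: "(*\<^sub>R) \<sigma> ` K \<subseteq> interior (half_ball 0 r)"
  proof
    fix y assume "y \<in> (*\<^sub>R) \<sigma> ` K"
    then obtain x where x: "x \<in> K" "y = \<sigma> *\<^sub>R x"
      by auto
    then have "0 < x $ None" "norm x < R"
      using K(2) by (auto simp: interior_half_ball)
    then have "\<sigma> * norm x < r"
      using \<sigma> by (intro less_le_trans[OF mult_strict_left_mono \<sigma>(2)])
    then show "y \<in> interior (half_ball 0 r)"
      using x \<open>0 < x $ None\<close> \<sigma> by (auto simp: interior_half_ball)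
  qed
  have "C1_on UNIV (\<lambda>y. \<phi> (y /\<^sub>R \<sigma>))"
  proof (rule C1_on_UNIV_I[OF d])
    have cg: "continuous_on UNIV (grad UNIV \<phi>)"
      using C by (simp add: C1_on_def)
    show "continuous_on UNIV (\<lambda>x. grad UNIV \<phi> (x /\<^sub>R \<sigma>) /\<^sub>R \<sigma>)"
      by (intro continuous_on_scaleR continuous_on_const continuous_on_compose2[OF cg])
        (auto intro!: continuous_intros)
  qed
  moreover have "compact (closure {y. \<phi> (y /\<^sub>R \<sigma>) \<noteq> 0})"
    using cl cK by (metis bounded_subset closed_closure compact_eq_bounded_closed)
  ultimately show "(\<lambda>y. \<phi> (y /\<^sub>R \<sigma>)) \<in> test_functions (interior (half_ball 0 r))"
    using cl sub by (auto simp: test_functions_def)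
qed

lemma weakly_div_free_scale:
  fixes F :: "'n::finite pt \<Rightarrow> 'n pt"
  assumes F: "weakly_div_free (half_ball 0 r) F" "continuous_on (half_ball 0 r) F"
    and \<sigma>: "0 < \<sigma>" "\<sigma> * R \<le> r"
  shows "weakly_div_free (half_ball 0 R) (\<lambda>x. c *\<^sub>R F (\<sigma> *\<^sub>R x))"
  unfolding weakly_div_free_def
proof
  fix \<phi> :: "'n pt \<Rightarrow> real" assume \<phi>: "\<phi> \<in> test_functions (interior (half_ball 0 R))"
  define \<phi>' where "\<phi>' y = \<phi> (y /\<^sub>R \<sigma>)" for y
  have test: "\<phi>' \<in> test_functions (interior (half_ball 0 r))"
    and gr: "\<And>x. grad UNIV \<phi>' x = grad UNIV \<phi> (x /\<^sub>R \<sigma>) /\<^sub>R \<sigma>"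
    using test_function_scale[OF \<phi> \<sigma>] by (simp_all add: \<phi>'_def[abs_def])
  have sub: "half_ball (0::'n pt) (\<sigma> * R) \<subseteq> half_ball 0 r"
    using \<sigma> by (intro half_ball_mono)
  have z: "grad UNIV \<phi>' x = 0" if "x \<notin> half_ball 0 (\<sigma> * R)" for x
  proof -
    have "x /\<^sub>R \<sigma> \<notin> interior (half_ball 0 R)"
      using that interior_subset scale_half_ball(1)[OF \<sigma>(1), of "x /\<^sub>R \<sigma>" R] \<sigma> by auto
    then show ?thesis
      using test_function_eq_0(2)[OF \<phi>] by (simp add: gr)
  qed
  have "continuous_on (half_ball 0 (\<sigma> * R)) (\<lambda>x. F x \<bullet> grad UNIV \<phi>' x)"
    using test continuous_on_subset[OF F(2) sub]
    by (intro continuous_intros) (auto simp: test_functions_def C1_on_def intro: continuous_on_subset)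
  from integral_half_ball_scale[OF this \<sigma>(1)]
  have "\<sigma> ^ DIM('n pt) * (\<integral>x. F (\<sigma> *\<^sub>R x) \<bullet> grad UNIV \<phi>' (\<sigma> *\<^sub>R x) \<partial>lebesgue_on (half_ball 0 R)) =
      (\<integral>x. F x \<bullet> grad UNIV \<phi>' x \<partial>lebesgue_on (half_ball 0 (\<sigma> * R)))"
    by simp
  also have "\<dots> = (\<integral>x. F x \<bullet> grad UNIV \<phi>' x \<partial>lebesgue_on (half_ball 0 r))"
    using z sub by (intro integral_extend_support) auto
  also have "\<dots> = 0"
    using F(1) test by (simp add: weakly_div_free_def)
  finally have "(\<integral>x. F (\<sigma> *\<^sub>R x) \<bullet> grad UNIV \<phi>' (\<sigma> *\<^sub>R x) \<partial>lebesgue_on (half_ball 0 R)) = 0"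
    using \<sigma> by simp
  moreover have "(\<lambda>x. F (\<sigma> *\<^sub>R x) \<bullet> grad UNIV \<phi>' (\<sigma> *\<^sub>R x)) = (\<lambda>x. (F (\<sigma> *\<^sub>R x) \<bullet> grad UNIV \<phi> x) / \<sigma>)"
    using \<sigma> by (auto simp: gr divide_inverse mult.commute)
  ultimately have "(\<integral>x. F (\<sigma> *\<^sub>R x) \<bullet> grad UNIV \<phi> x \<partial>lebesgue_on (half_ball 0 R)) = 0"
    using \<sigma> by simp
  then show "(\<integral>x. (c *\<^sub>R F (\<sigma> *\<^sub>R x)) \<bullet> grad UNIV \<phi> x \<partial>lebesgue_on (half_ball 0 R)) = 0"
    by simp
qed

lemma upper_C1_scale:
  fixes u :: "'n::finite pt \<Rightarrow> real"
  assumes u: "upper_C1 (half_ball 0 r) u g" and \<sigma>: "0 < \<sigma>" "\<sigma> * R \<le> r"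
  shows "upper_C1 (half_ball 0 R) (\<lambda>x. u (\<sigma> *\<^sub>R x) / N) (\<lambda>x. (\<sigma> / N) *\<^sub>R g (\<sigma> *\<^sub>R x))"
  unfolding upper_C1_def
proof
  have mem: "\<sigma> *\<^sub>R x \<in> half_ball 0 r" if "x \<in> half_ball 0 R" for x :: "'n pt"
    using that scale_half_ball(1)[OF \<sigma>(1), of x R] half_ball_mono[OF \<sigma>(2), of 0] by auto
  have cg: "continuous_on (half_ball 0 r) g"
    using u by (simp add: upper_C1_def)
  show "continuous_on (half_ball 0 R) (\<lambda>x. (\<sigma> / N) *\<^sub>R g (\<sigma> *\<^sub>R x))"
    using mem
    by (intro continuous_on_scaleR continuous_on_const continuous_on_compose2[OF cg]) (auto intro!: continuous_intros)
  show "\<forall>x\<in>half_ball 0 R. ((\<lambda>x. u (\<sigma> *\<^sub>R x) / N) has_derivative (\<bullet>) ((\<sigma> / N) *\<^sub>R g (\<sigma> *\<^sub>R x))) (at x within upper)"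
  proof
    fix x :: "'n pt" assume x: "x \<in> half_ball 0 R"
    have "((*\<^sub>R) \<sigma> has_derivative (*\<^sub>R) \<sigma>) (at x within upper)"
      by (auto intro!: derivative_eq_intros)
    moreover have "(u has_derivative (\<bullet>) (g (\<sigma> *\<^sub>R x))) (at (\<sigma> *\<^sub>R x) within (*\<^sub>R) \<sigma> ` upper)"
      by (rule has_derivative_subset[OF upper_C1D[OF u mem[OF x]]]) (use \<sigma> in \<open>auto intro: upper_scaleR\<close>)
    ultimately have "((\<lambda>x. u (\<sigma> *\<^sub>R x)) has_derivative (\<lambda>h. g (\<sigma> *\<^sub>R x) \<bullet> (\<sigma> *\<^sub>R h))) (at x within upper)"
      by (rule has_derivative_in_compose)
    then have "((\<lambda>x. u (\<sigma> *\<^sub>R x) * inverse N) has_derivative (\<lambda>h. g (\<sigma> *\<^sub>R x) \<bullet> (\<sigma> *\<^sub>R h) * inverse N)) (at x within upper)"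
      by (rule has_derivative_mult_left)
    then have "((\<lambda>x. u (\<sigma> *\<^sub>R x) / N) has_derivative (\<lambda>h. g (\<sigma> *\<^sub>R x) \<bullet> (\<sigma> *\<^sub>R h) * inverse N)) (at x within upper)"
      by (simp add: divide_inverse)
    then show "((\<lambda>x. u (\<sigma> *\<^sub>R x) / N) has_derivative (\<bullet>) ((\<sigma> / N) *\<^sub>R g (\<sigma> *\<^sub>R x))) (at x within upper)"
      by (rule has_derivative_eq_rhs) (auto simp: fun_eq_iff divide_inverse)
  qed
qed

text \<open>The hypothesis concerns the last column; symmetry moves it to the last row, which is the
  one that enters the normal component of the product.\<close>

lemma flat_conormal:
  fixes A :: "real ^ ('n::finite option) ^ ('n option)"
  assumes "transpose A = A" "\<And>i. A $ Some i $ None = 0"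
  shows "(A *v v) $ None = A $ None $ None * v $ None"
proof -
  have "A $ None $ Some i = 0" for i
  proof -
    have "A $ None $ Some i = transpose A $ None $ Some i"
      by (simp only: assms(1))
    then show ?thesis
      by (simp add: transpose_def assms(2))
  qed
  then show ?thesis
    by (simp add: matrix_vector_mult_def UNIV_option_conv sum.reindex)
qed

lemma signorini_flux_rescale:
  fixes a :: "'n::finite pt \<Rightarrow> real ^ ('n option) ^ ('n option)"
  assumes A1: "\<And>x i. x \<in> thin_ball 0 1 \<Longrightarrow> a x $ Some i $ None = 0"
    and A2: "\<And>x. x \<in> half_ball 0 1 \<Longrightarrow> transpose (a x) = a x"
    and A3: "continuous_on (half_ball 0 1) a"
    and W: "C1_on (half_ball 0 1) w"
    and solution: "thin_obstacle_solution a w"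
    and \<sigma>: "0 < \<sigma>" "\<sigma> * R \<le> 1" and N: "0 < N"
    and pos: "\<And>x. x \<in> half_ball 0 (\<sigma> * R) \<Longrightarrow> 0 \<le> a x $ None $ None"
  defines "g \<equiv> \<lambda>x. (\<sigma> / N) *\<^sub>R grad (half_ball 0 1) w (\<sigma> *\<^sub>R x)"
  shows "signorini_flux R (\<lambda>x. w (\<sigma> *\<^sub>R x) / N) g (\<lambda>x. a (\<sigma> *\<^sub>R x) *v g x)"
proof -
  let ?G = "grad (half_ball 0 1) w"
  have C: "upper_C1 (half_ball 0 1) w ?G"
    by (rule upper_C1_grad[OF W])
  have mem: "\<sigma> *\<^sub>R x \<in> half_ball 0 1" if "x \<in> half_ball 0 R" for x :: "'n pt"
    using that scale_half_ball(1)[OF \<sigma>(1), of x R] half_ball_mono[OF \<sigma>(2), of 0] by auto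
  have cF: "continuous_on (half_ball 0 1) (\<lambda>x. a x *v ?G x)"
    using A3 C unfolding upper_C1_def matrix_vector_mult_def
    by (auto intro!: continuous_intros)
  have eq: "a (\<sigma> *\<^sub>R x) *v g x = (\<sigma> / N) *\<^sub>R (a (\<sigma> *\<^sub>R x) *v ?G (\<sigma> *\<^sub>R x))" for x
    by (simp add: g_def matrix_vector_mult_scaleR)
  have "weakly_div_free (half_ball 0 R) (\<lambda>x. (\<sigma> / N) *\<^sub>R (a (\<sigma> *\<^sub>R x) *v ?G (\<sigma> *\<^sub>R x)))"
    using solution by (intro weakly_div_free_scale[of 1 "\<lambda>x. a x *v ?G x"] cF \<sigma>) (simp add: thin_obstacle_solution_def)
  moreover have "continuous_on (half_ball 0 R) (\<lambda>x. (\<sigma> / N) *\<^sub>R (a (\<sigma> *\<^sub>R x) *v ?G (\<sigma> *\<^sub>R x)))"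
    using mem by (intro continuous_on_scaleR continuous_on_const continuous_on_compose2[OF cF]) (auto intro!: continuous_intros)
  moreover have "0 \<le> w (\<sigma> *\<^sub>R x) / N \<and> (a (\<sigma> *\<^sub>R x) *v g x) $ None \<le> 0 \<and>
      w (\<sigma> *\<^sub>R x) / N * (a (\<sigma> *\<^sub>R x) *v g x) $ None = 0" if x: "x \<in> thin_ball 0 R" for x
  proof -
    have t: "\<sigma> *\<^sub>R x \<in> thin_ball 0 1" "\<sigma> *\<^sub>R x \<in> half_ball 0 1" "\<sigma> *\<^sub>R x \<in> half_ball 0 (\<sigma> * R)"
      using x mem[of x] scale_half_ball[OF \<sigma>(1), of x R] by (auto simp: thin_ball_def)
    have e: "(a (\<sigma> *\<^sub>R x) *v g x) $ None = (\<sigma> / N) * (a (\<sigma> *\<^sub>R x) $ None $ None * ?G (\<sigma> *\<^sub>R x) $ None)"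
      using flat_conormal[OF A2[OF t(2)] A1[OF t(1)]] by (simp add: eq)
    have s: "0 \<le> w (\<sigma> *\<^sub>R x)" "?G (\<sigma> *\<^sub>R x) $ None \<le> 0" "w (\<sigma> *\<^sub>R x) * ?G (\<sigma> *\<^sub>R x) $ None = 0"
      using solution t(1) by (auto simp: thin_obstacle_solution_def)
    have "a (\<sigma> *\<^sub>R x) $ None $ None * ?G (\<sigma> *\<^sub>R x) $ None \<le> 0"
      using pos[OF t(3)] s(2) by (rule mult_nonneg_nonpos)
    then have "(\<sigma> / N) * (a (\<sigma> *\<^sub>R x) $ None $ None * ?G (\<sigma> *\<^sub>R x) $ None) \<le> 0"
      using \<sigma> N by (intro mult_nonneg_nonpos[of "\<sigma> / N"]) auto
    then show ?thesis
      using e s N by auto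
  qed
  moreover have "upper_C1 (half_ball 0 R) (\<lambda>x. w (\<sigma> *\<^sub>R x) / N) g"
    using upper_C1_scale[OF C \<sigma>, of N] by (simp add: g_def)
  ultimately show ?thesis
    unfolding signorini_flux_def eq by blast
qed

text \<open>The normalising power of \<open>\<sigma>\<close>, once squared, cancels the Jacobian of
  the dilation. With \<open>R = 1\<close> this gives unit norm, and with \<open>R = 2\<close> the
  doubling quotient.\<close>

lemma mass_rescaling:
  fixes w :: "'n::finite pt \<Rightarrow> real"
  assumes w: "continuous_on (half_ball 0 1) w" and \<sigma>: "0 < \<sigma>" "\<sigma> * R \<le> 1"
    and pos: "0 < mass w \<sigma>"
  shows "mass (rescaling w \<sigma>) R = mass w (\<sigma> * R) / mass w \<sigma>"
proof -
  let ?D = "DIM('n pt)"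
  let ?N = "\<sigma> powr (- (real CARD('n) + 1) / 2) * L2norm (half_ball 0 \<sigma>) w"
  have D: "?D = CARD('n) + 1"
    by simp
  have p: "(\<sigma> powr (- (real CARD('n) + 1) / 2))\<^sup>2 * \<sigma> ^ ?D = 1"
  proof -
    have "(\<sigma> powr (- (real CARD('n) + 1) / 2))\<^sup>2 * \<sigma> ^ ?D =
        \<sigma> powr (- (real CARD('n) + 1) / 2 + - (real CARD('n) + 1) / 2) * \<sigma> powr (real ?D)"
      unfolding powr_realpow[OF \<sigma>(1)] power2_eq_square powr_add ..
    also have "\<dots> = \<sigma> powr (- (real CARD('n) + 1) / 2 + - (real CARD('n) + 1) / 2 + real ?D)"
      by (rule powr_add[symmetric])
    also have "- (real CARD('n) + 1) / 2 + - (real CARD('n) + 1) / 2 + real ?D = 0"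
      by (simp add: D field_simps)
    finally show ?thesis
      using \<sigma> by simp
  qed
  have N2: "\<sigma> ^ ?D * ?N\<^sup>2 = mass w \<sigma>"
  proof -
    have "(L2norm (half_ball 0 \<sigma>) w)\<^sup>2 = mass w \<sigma>"
      using pos by (simp add: L2norm_def mass_def)
    moreover have "\<sigma> ^ ?D * ?N\<^sup>2 = (\<sigma> powr (- (real CARD('n) + 1) / 2))\<^sup>2 * \<sigma> ^ ?D * (L2norm (half_ball 0 \<sigma>) w)\<^sup>2"
      by (simp only: power_mult_distrib mult_ac)
    ultimately show ?thesis
      unfolding p by simp
  qed
  have "continuous_on (half_ball 0 (\<sigma> * R)) (\<lambda>x. (w x)\<^sup>2)"
    using continuous_on_subset[OF w half_ball_mono[OF \<sigma>(2), of 0]] by (intro continuous_intros)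
  from integral_half_ball_scale[OF this \<sigma>(1)]
  have m: "mass w (\<sigma> * R) = \<sigma> ^ ?D * (\<integral>x. (w (\<sigma> *\<^sub>R x))\<^sup>2 \<partial>lebesgue_on (half_ball 0 R))"
    by (simp add: mass_def)
  have "mass (rescaling w \<sigma>) R = (\<integral>x. (w (\<sigma> *\<^sub>R x))\<^sup>2 \<partial>lebesgue_on (half_ball 0 R)) / ?N\<^sup>2"
    by (simp add: mass_def rescaling_def power_divide)
  also have "\<dots> = mass w (\<sigma> * R) / mass w \<sigma>"
    unfolding m N2[symmetric] using \<sigma> by simp
  finally show ?thesis .
qed

section \<open>Extension by zero and weak derivatives of C1 functions\<close>

lemma upper_C1_extend:
  assumes \<phi>: "upper_C1 (half_ball 0 R) \<phi> \<psi>" and "\<rho> < R"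
    and z: "\<And>x. x \<in> upper \<Longrightarrow> \<rho> \<le> norm x \<Longrightarrow> \<phi> x = 0" "\<And>x. x \<in> upper \<Longrightarrow> \<rho> \<le> norm x \<Longrightarrow> \<psi> x = 0"
  shows "upper_C1 upper \<phi> \<psi>"
proof -
  have far: "\<rho> \<le> norm y" if "\<not> norm x < R" "dist y x < R - \<rho>" for x y :: "'a pt"
    using that norm_triangle_ineq2[of x y] by (simp add: dist_norm norm_minus_commute)
  have "(\<phi> has_derivative (\<bullet>) (\<psi> x)) (at x within upper) \<and> continuous (at x within upper) \<psi>" if x: "x \<in> upper" for x
  proof (cases "norm x < R")
    case True
    then have "x \<in> half_ball 0 R"
      using x by (simp add: mem_half_ball_0)
    then show ?thesis
      using \<phi> at_within_half_ball[of x R] by (auto simp: upper_C1_def continuous_on_eq_continuous_within)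
  next
    case False
    have "\<psi> x = 0"
      using z(2)[OF x] False \<open>\<rho> < R\<close> by simp
    have "((\<lambda>_. 0) has_derivative (\<bullet>) (\<psi> x)) (at x within upper)"
      by (rule has_derivative_eq_rhs[OF has_derivative_const]) (simp add: \<open>\<psi> x = 0\<close> fun_eq_iff)
    then have "(\<phi> has_derivative (\<bullet>) (\<psi> x)) (at x within upper)"
      by (rule has_derivative_transform_within[of _ _ _ _ "R - \<rho>"]) (use False far z x \<open>\<rho> < R\<close> in auto)
    moreover have "continuous (at x within upper) (\<lambda>_. 0 :: 'a pt)"
      by simp
    then have "continuous (at x within upper) \<psi>"
      by (rule continuous_transform_within[of _ _ _ "R - \<rho>"]) (use False far z x \<open>\<rho> < R\<close> in auto)
    ultimately show ?thesis
      by simp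
  qed
  then show ?thesis
    by (auto simp: upper_C1_def continuous_on_eq_continuous_within)
qed

text \<open>Each difference quotient in direction \<open>h\<close> has integral 0 by translation
  invariance. They converge pointwise to \<open>g x \<bullet> h\<close> and are dominated by a
  constant on a fixed ball, since \<open>v\<close> is Lipschitz with bounded support.\<close>

lemma integral_gradient_eq_0:
  fixes v :: "real ^ 'm::finite \<Rightarrow> real"
  assumes d: "\<And>x. (v has_derivative (\<bullet>) (g x)) (at x)" and cg: "continuous_on UNIV g"
    and z: "\<And>x. \<rho> \<le> norm x \<Longrightarrow> v x = 0" "\<And>x. \<rho> \<le> norm x \<Longrightarrow> g x = 0"
  shows "(\<integral>x. g x \<bullet> h \<partial>lborel) = 0"
proof -
  have cv: "continuous_on UNIV v"
    using d has_derivative_continuous by (fastforce simp: continuous_on_eq_continuous_within)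
  have "bounded (g ` cball 0 \<rho>)"
    using continuous_on_subset[OF cg] by (intro compact_imp_bounded compact_continuous_image) auto
  then obtain B where B: "B > 0" "\<And>x. norm x \<le> \<rho> \<Longrightarrow> norm (g x) \<le> B"
    by (auto simp: bounded_pos)
  have gB: "norm (g x) \<le> B" for x
    using B z(2)[of x] by (cases "norm x \<le> \<rho>") auto
  have lip: "\<bar>v y - v x\<bar> \<le> B * norm (y - x)" for x y
  proof -
    have "norm (v y - v x) \<le> B * norm (y - x)"
    proof (rule differentiable_bound[of UNIV v "\<lambda>x. (\<bullet>) (g x)"])
      show "onorm ((\<bullet>) (g x)) \<le> B" for x
      proof (rule onorm_le)
        fix y
        have "norm (g x \<bullet> y) \<le> norm (g x) * norm y"
          using Cauchy_Schwarz_ineq2 by simp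
        also have "\<dots> \<le> B * norm y"
          using gB by (intro mult_right_mono) auto
        finally show "norm (g x \<bullet> y) \<le> B * norm y" .
      qed
    qed (use d in auto)
    then show ?thesis
      by simp
  qed
  define q where "q n x = real (Suc n) * (v (h /\<^sub>R real (Suc n) + x) - v x)" for n x
  \<comment> \<open>The shifts are at most as long as \<open>h\<close>, so this one ball contains
    the supports of all quotients.\<close>
  let ?K = "cball (0 :: real ^ 'm) (\<bar>\<rho>\<bar> + norm h)"
  have iv: "integrable lborel v"
  proof -
    have "integrable lborel (\<lambda>x. indicator (cball 0 \<rho>) x *\<^sub>R v x)"
      using continuous_on_subset[OF cv] by (intro borel_integrable_compact) auto
    moreover have "(\<lambda>x. indicator (cball 0 \<rho>) x *\<^sub>R v x) = v"
      using z(1) by (auto simp: indicator_def fun_eq_iff)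
    ultimately show ?thesis
      by simp
  qed
  have "(\<lambda>n. \<integral>x. q n x \<partial>lborel) \<longlonglongrightarrow> (\<integral>x. g x \<bullet> h \<partial>lborel)"
  proof (rule integral_dominated_convergence[where w = "\<lambda>x. indicator ?K x *\<^sub>R (B * norm h)"])
    show "(\<lambda>x. g x \<bullet> h) \<in> borel_measurable lborel"
      using cg by (auto intro!: borel_measurable_continuous_onI continuous_intros)
    show "q n \<in> borel_measurable lborel" for n
      unfolding q_def
      by (auto intro!: borel_measurable_continuous_onI continuous_intros continuous_on_compose2[OF cv])
    show "integrable lborel (\<lambda>x. indicator ?K x *\<^sub>R (B * norm h))"
      by (intro borel_integrable_compact) auto
    show "AE x in lborel. (\<lambda>n. q n x) \<longlonglongrightarrow> g x \<bullet> h"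
    proof (rule AE_I2)
      fix x
      have "((\<lambda>t. v (t *\<^sub>R h + x)) has_derivative (\<lambda>t. g (0 *\<^sub>R h + x) \<bullet> (t *\<^sub>R h))) (at 0)"
      proof (rule has_derivative_compose[of "\<lambda>t. t *\<^sub>R h + x" "\<lambda>t. t *\<^sub>R h"])
        show "((\<lambda>t. t *\<^sub>R h + x) has_derivative (\<lambda>t. t *\<^sub>R h)) (at 0)"
          by (auto intro!: derivative_eq_intros)
      qed (rule d)
      then have "((\<lambda>t. v (t *\<^sub>R h + x)) has_real_derivative (g x \<bullet> h)) (at 0)"
        by (simp add: has_field_derivative_def mult_commute_abs)
      then have D: "((\<lambda>t. (v (t *\<^sub>R h + x) - v x) / t) \<longlongrightarrow> g x \<bullet> h) (at 0)"
        by (simp add: DERIV_def)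
      have "filterlim (\<lambda>n. inverse (real (Suc n))) (at 0) sequentially"
        using LIMSEQ_inverse_real_of_nat by (auto simp: filterlim_at intro!: always_eventually)
      from filterlim_compose[OF D this] show "(\<lambda>n. q n x) \<longlonglongrightarrow> g x \<bullet> h"
        by (simp add: q_def divide_inverse mult.commute)
    qed
    show "AE x in lborel. norm (q n x) \<le> indicator ?K x *\<^sub>R (B * norm h)" for n
    proof (rule AE_I2)
      fix x
      show "norm (q n x) \<le> indicator ?K x *\<^sub>R (B * norm h)"
      proof (cases "x \<in> ?K")
        case True
        have "norm (q n x) = real (Suc n) * \<bar>v (h /\<^sub>R real (Suc n) + x) - v x\<bar>"
          by (simp add: q_def abs_mult)
        also have "\<dots> \<le> real (Suc n) * (B * norm (h /\<^sub>R real (Suc n)))"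
          using lip[of "h /\<^sub>R real (Suc n) + x" x] by (intro mult_left_mono) auto
        also have "\<dots> = B * norm h"
          by (simp add: field_simps)
        finally show ?thesis
          using True by simp
      next
        case False
        have "norm (h /\<^sub>R real (Suc n)) \<le> norm h"
          by (simp add: field_simps mult_le_cancel_left1 mult_le_cancel_right1)
        moreover have "norm x \<le> norm (h /\<^sub>R real (Suc n) + x) + norm (h /\<^sub>R real (Suc n))"
          using norm_triangle_ineq4[of "h /\<^sub>R real (Suc n) + x" "h /\<^sub>R real (Suc n)"] by simp
        moreover have "\<bar>\<rho>\<bar> + norm h < norm x"
          using False by simp
        ultimately have "\<rho> \<le> norm (h /\<^sub>R real (Suc n) + x)" "\<rho> \<le> norm x"
          using norm_ge_zero[of h] by linarith+
        then have "q n x = 0"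
          using z(1) by (simp add: q_def)
        then show ?thesis
          using False by simp
      qed
    qed
  qed
  moreover have "(\<integral>x. q n x \<partial>lborel) = 0" for n
    unfolding q_def using iv
    by (simp add: lborel_integral_shift)
  ultimately show ?thesis
    by (simp add: LIMSEQ_const_iff)
qed

text \<open>The product of \<open>u\<close> with a test function extends by 0 to a C1 function on
  the whole space, whose partial derivatives have integral 0; the product rule then gives the
  identity.\<close>

lemma C1_weak_partial:
  fixes u :: "'n::finite pt \<Rightarrow> real"
  assumes u: "upper_C1 (half_ball 0 R) u g"
  shows "weak_partial (half_ball 0 R) i u (\<lambda>x. g x $ i)"
  unfolding weak_partial_def
proof
  fix \<phi> :: "'n pt \<Rightarrow> real" assume \<phi>: "\<phi> \<in> test_functions (interior (half_ball 0 R))"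
  define K where "K = closure {x. \<phi> x \<noteq> 0}"
  have K: "compact K" "K \<subseteq> interior (half_ball 0 R)" and C: "C1_on UNIV \<phi>"
    using \<phi> by (simp_all add: test_functions_def K_def)
  have zK: "\<phi> x = 0" "grad UNIV \<phi> x = 0" if "x \<notin> K" for x
    using that grad_eq_0_outside_support[of x \<phi>] closure_subset[of "{x. \<phi> x \<noteq> 0}"] by (auto simp: K_def)
  define \<Phi> where "\<Phi> x = u x * \<phi> x" for x
  define \<Psi> where "\<Psi> x = u x *\<^sub>R grad UNIV \<phi> x + \<phi> x *\<^sub>R g x" for x
  have C\<Phi>: "upper_C1 (half_ball 0 R) \<Phi> \<Psi>"
    unfolding \<Phi>_def \<Psi>_def by (rule upper_C1_mult[OF u test_function_upper_C1[OF \<phi>] half_ball_upper])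
  have z: "\<Phi> x = 0" "\<Psi> x = 0" if "x \<notin> K" for x
    using zK[OF that] by (simp_all add: \<Phi>_def \<Psi>_def)
  have oK: "open (- K)"
    using K(1) by (simp add: compact_imp_closed open_Compl)
  have d: "(\<Phi> has_derivative (\<bullet>) (\<Psi> x)) (at x)" and c: "continuous_on UNIV \<Psi>" for x
    using z K(2) by (auto intro!: upper_C1_extend_UNIV[OF C\<Phi> oK])
  obtain \<rho> where \<rho>: "\<And>x. x \<in> K \<Longrightarrow> norm x < \<rho>"
    using compact_imp_bounded[OF K(1)] by (meson bounded_pos_less)
  have int0: "(\<integral>x. \<Psi> x \<bullet> axis i 1 \<partial>lborel) = 0"
    using z \<rho> by (intro integral_gradient_eq_0[OF d c, of \<rho>]) (metis not_le)+
  have cK: "continuous_on K (\<lambda>x. u x * grad UNIV \<phi> x $ i)" "continuous_on K (\<lambda>x. g x $ i * \<phi> x)"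
  proof -
    have sub: "K \<subseteq> half_ball 0 R"
      using K(2) interior_subset by blast
    have "continuous_on K u" "continuous_on K g" "continuous_on K \<phi>" "continuous_on K (grad UNIV \<phi>)"
      using upper_C1_continuous[OF u half_ball_upper] u upper_C1_continuous[OF test_function_upper_C1[OF \<phi>], of upper] C sub
        half_ball_upper
      by (auto simp: upper_C1_def C1_on_def intro: continuous_on_subset)
    then show "continuous_on K (\<lambda>x. u x * grad UNIV \<phi> x $ i)" "continuous_on K (\<lambda>x. g x $ i * \<phi> x)"
      by (intro continuous_intros; simp)+
  qed
  have KH: "K \<subseteq> half_ball 0 R"
    using K(2) interior_subset by blast
  have ext: "integral\<^sup>L (lebesgue_on (half_ball 0 R)) f = (\<integral>x. indicator K x * f x \<partial>lborel) \<and>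
      integrable lborel (\<lambda>x. indicator K x * f x)"
    if f: "continuous_on K f" "\<And>x. x \<notin> K \<Longrightarrow> f x = 0" for f :: "'n pt \<Rightarrow> real"
  proof -
    have i: "integrable lborel (\<lambda>x. indicator K x * f x)"
      using borel_integrable_compact[OF K(1) f(1)] by simp
    have "(\<lambda>x. indicator (half_ball 0 R) x * f x) = (\<lambda>x. indicator K x * f x)"
      using f(2) KH by (auto simp: indicator_def fun_eq_iff)
    then show ?thesis
      using i borel_measurable_integrable[OF i] by (simp add: integral_lebesgue_on_indicator integral_completion)
  qed
  have "(\<integral>x. u x * grad UNIV \<phi> x $ i \<partial>lebesgue_on (half_ball 0 R)) + (\<integral>x. g x $ i * \<phi> x \<partial>lebesgue_on (half_ball 0 R)) =
      (\<integral>x. indicator K x * (u x * grad UNIV \<phi> x $ i) \<partial>lborel) + (\<integral>x. indicator K x * (g x $ i * \<phi> x) \<partial>lborel)"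
    using ext[OF cK(1)] ext[OF cK(2)] zK by simp
  also have "\<dots> = (\<integral>x. indicator K x * (u x * grad UNIV \<phi> x $ i) + indicator K x * (g x $ i * \<phi> x) \<partial>lborel)"
    using ext[OF cK(1)] ext[OF cK(2)] zK by (intro Bochner_Integration.integral_add[symmetric]) auto
  also have "\<dots> = (\<integral>x. \<Psi> x \<bullet> axis i 1 \<partial>lborel)"
    using zK by (intro Bochner_Integration.integral_cong) (auto simp: \<Psi>_def inner_axis indicator_def)
  finally show "(\<integral>x. u x * grad UNIV \<phi> x $ i \<partial>lebesgue_on (half_ball 0 R)) =
      - (\<integral>x. g x $ i * \<phi> x \<partial>lebesgue_on (half_ball 0 R))"
    using int0 by simp
qed

section \<open>Localisation by cutoffs\<close>

context cutoff
begin

lemma inner_integral_le: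
  assumes "\<And>x. norm x \<le> r \<Longrightarrow> \<eta> x = 1" "r < R" and f: "continuous_on (half_ball 0 R) f"
    and nn: "\<And>x. 0 \<le> f x"
  shows "(\<integral>x. f x \<partial>lebesgue_on (half_ball 0 r)) \<le> (\<integral>x. (\<eta> x)\<^sup>2 * f x \<partial>lebesgue_on upper)"
proof -
  have "integrable lebesgue (\<lambda>x. indicator (half_ball 0 r) x * f x)"
    using integrable_half_ball_inner[OF f \<open>r < R\<close>] by (simp add: integral_lebesgue_on_indicator)
  moreover have "integrable lebesgue (\<lambda>x. indicator upper x * ((\<eta> x)\<^sup>2 * f x))"
    using integrable_cutoff(1)[OF f] by (simp add: integral_lebesgue_on_indicator)
  ultimately have "(\<integral>x. indicator (half_ball 0 r) x * f x \<partial>lebesgue) \<le>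
      (\<integral>x. indicator upper x * ((\<eta> x)\<^sup>2 * f x) \<partial>lebesgue)"
    by (rule integral_mono) (use assms(1) nn in \<open>auto simp: indicator_def mem_half_ball_0\<close>)
  then show ?thesis
    by (simp add: integral_lebesgue_on_indicator)
qed

lemma outer_integral_le:
  assumes "\<rho> \<le> r" and f: "continuous_on (half_ball 0 R) f" "integrable (lebesgue_on (half_ball 0 r)) f"
    and nn: "\<And>x. 0 \<le> f x"
  shows "(\<integral>x. (\<eta> x)\<^sup>2 * f x \<partial>lebesgue_on upper) \<le> (\<integral>x. f x \<partial>lebesgue_on (half_ball 0 r))"
    "(\<And>x. norm (\<zeta> x) \<le> Z) \<Longrightarrow>
      (\<integral>x. f x * (norm (\<zeta> x))\<^sup>2 \<partial>lebesgue_on upper) \<le> Z\<^sup>2 * (\<integral>x. f x \<partial>lebesgue_on (half_ball 0 r))"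
proof -
  have i: "integrable lebesgue (\<lambda>x. indicator (half_ball 0 r) x * f x)"
    using f(2) by (simp add: integral_lebesgue_on_indicator)
  have out: "\<eta> x = 0 \<and> \<zeta> x = 0" if "x \<in> upper" "x \<notin> half_ball 0 r" for x
    using that outside \<open>\<rho> \<le> r\<close> by (auto simp: mem_half_ball_0)
  have i1: "integrable lebesgue (\<lambda>x. indicator upper x * ((\<eta> x)\<^sup>2 * f x))"
    using integrable_cutoff(1)[OF f(1)] by (simp add: integral_lebesgue_on_indicator)
  have "(\<integral>x. indicator upper x * ((\<eta> x)\<^sup>2 * f x) \<partial>lebesgue) \<le> (\<integral>x. indicator (half_ball 0 r) x * f x \<partial>lebesgue)"
  proof (rule integral_mono[OF i1 i])
    fix x
    have "(\<eta> x)\<^sup>2 * f x \<le> f x"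
      using range[of x] nn[of x] by (simp add: mult_left_le_one_le power_le_one)
    then show "indicator upper x * ((\<eta> x)\<^sup>2 * f x) \<le> indicator (half_ball 0 r) x * f x"
      using out[of x] by (auto simp: indicator_def mem_half_ball_0)
  qed
  then show "(\<integral>x. (\<eta> x)\<^sup>2 * f x \<partial>lebesgue_on upper) \<le> (\<integral>x. f x \<partial>lebesgue_on (half_ball 0 r))"
    by (simp add: integral_lebesgue_on_indicator)
  assume Z: "\<And>x. norm (\<zeta> x) \<le> Z"
  have i2: "integrable lebesgue (\<lambda>x. indicator upper x * (f x * (norm (\<zeta> x))\<^sup>2))"
    using integrable_cutoff(2)[OF f(1)] by (simp add: integral_lebesgue_on_indicator)
  have "(\<integral>x. indicator upper x * (f x * (norm (\<zeta> x))\<^sup>2) \<partial>lebesgue) \<le>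
      (\<integral>x. Z\<^sup>2 * (indicator (half_ball 0 r) x * f x) \<partial>lebesgue)"
  proof (rule integral_mono[OF i2 integrable_mult_right[OF i]])
    fix x
    have "(norm (\<zeta> x))\<^sup>2 \<le> Z\<^sup>2"
      using Z by (intro power_mono) auto
    then have "f x * (norm (\<zeta> x))\<^sup>2 \<le> Z\<^sup>2 * f x"
      using mult_left_mono[OF _ nn[of x]] by (metis mult.commute)
    then show "indicator upper x * (f x * (norm (\<zeta> x))\<^sup>2) \<le> Z\<^sup>2 * (indicator (half_ball 0 r) x * f x)"
      using out[of x] by (auto simp: indicator_def mem_half_ball_0)
  qed
  then show "(\<integral>x. f x * (norm (\<zeta> x))\<^sup>2 \<partial>lebesgue_on upper) \<le> Z\<^sup>2 * (\<integral>x. f x \<partial>lebesgue_on (half_ball 0 r))"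
    by (simp add: integral_lebesgue_on_indicator)
qed

lemma upper_C1_compact_cutoff:
  assumes u: "upper_C1 (half_ball 0 R) u g"
  shows "upper_C1_compact (\<lambda>x. \<eta> x * u x) (\<lambda>x. \<eta> x *\<^sub>R g x + u x *\<^sub>R \<zeta> x) \<rho>"
proof
  show "upper_C1 upper (\<lambda>x. \<eta> x * u x) (\<lambda>x. \<eta> x *\<^sub>R g x + u x *\<^sub>R \<zeta> x)"
    using outside
    by (intro upper_C1_extend[OF upper_C1_mult[OF upper_C1_subset[OF \<eta> half_ball_upper] u half_ball_upper] radii(2)]) auto
qed (use outside in auto)

lemma cutoff_energy_le:
  assumes u: "upper_C1 (half_ball 0 R) u g" and Z: "\<And>x. norm (\<zeta> x) \<le> Z"
    and r: "\<rho> \<le> r" and i: "integrable (lebesgue_on (half_ball 0 r)) (\<lambda>x. (u x)\<^sup>2)"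
  shows "(\<integral>x. (\<eta> x * u x)\<^sup>2 \<partial>lebesgue_on upper) \<le> (\<integral>x. (u x)\<^sup>2 \<partial>lebesgue_on (half_ball 0 r))"
    "(\<integral>x. (norm (\<eta> x *\<^sub>R g x + u x *\<^sub>R \<zeta> x))\<^sup>2 \<partial>lebesgue_on upper) \<le>
      2 * (\<integral>x. (\<eta> x)\<^sup>2 * (norm (g x))\<^sup>2 \<partial>lebesgue_on upper) + 2 * Z\<^sup>2 * (\<integral>x. (u x)\<^sup>2 \<partial>lebesgue_on (half_ball 0 r))"
proof -
  have cu: "continuous_on (half_ball 0 R) (\<lambda>x. (u x)\<^sup>2)" and cg: "continuous_on (half_ball 0 R) (\<lambda>x. (norm (g x))\<^sup>2)"
    using upper_C1_continuous[OF u half_ball_upper] u by (auto simp: upper_C1_def intro!: continuous_intros)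
  show "(\<integral>x. (\<eta> x * u x)\<^sup>2 \<partial>lebesgue_on upper) \<le> (\<integral>x. (u x)\<^sup>2 \<partial>lebesgue_on (half_ball 0 r))"
    using outer_integral_le(1)[OF r cu i] by (simp add: power_mult_distrib)
  interpret c: upper_C1_compact "\<lambda>x. \<eta> x * u x" "\<lambda>x. \<eta> x *\<^sub>R g x + u x *\<^sub>R \<zeta> x" \<rho>
    by (rule upper_C1_compact_cutoff[OF u])
  have ic: "integrable (lebesgue_on upper) (\<lambda>x. (norm (\<eta> x *\<^sub>R g x + u x *\<^sub>R \<zeta> x))\<^sup>2)"
    using c.integrable_energy c.measurable_g by (simp add: integral_lebesgue_on_indicator integrable_completion)
  have "(\<integral>x. (norm (\<eta> x *\<^sub>R g x + u x *\<^sub>R \<zeta> x))\<^sup>2 \<partial>lebesgue_on upper) \<le>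
      (\<integral>x. 2 * ((\<eta> x)\<^sup>2 * (norm (g x))\<^sup>2) + 2 * ((u x)\<^sup>2 * (norm (\<zeta> x))\<^sup>2) \<partial>lebesgue_on upper)"
  proof (rule integral_mono[OF ic])
    show "integrable (lebesgue_on upper) (\<lambda>x. 2 * ((\<eta> x)\<^sup>2 * (norm (g x))\<^sup>2) + 2 * ((u x)\<^sup>2 * (norm (\<zeta> x))\<^sup>2))"
      using integrable_cutoff cu cg by auto
    have "(norm (a + b))\<^sup>2 \<le> 2 * (norm a)\<^sup>2 + 2 * (norm b)\<^sup>2" for a b :: "'n pt"
      using zero_le_power2[of "norm (a - b)"]
      by (simp add: power2_norm_eq_inner inner_add_left inner_add_right inner_diff_left inner_diff_right inner_commute)
    from this[of "\<eta> _ *\<^sub>R g _" "u _ *\<^sub>R \<zeta> _"]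
    show "(norm (\<eta> x *\<^sub>R g x + u x *\<^sub>R \<zeta> x))\<^sup>2 \<le> 2 * ((\<eta> x)\<^sup>2 * (norm (g x))\<^sup>2) + 2 * ((u x)\<^sup>2 * (norm (\<zeta> x))\<^sup>2)" for x
      by (simp add: power_mult_distrib)
  qed
  also have "\<dots> = 2 * (\<integral>x. (\<eta> x)\<^sup>2 * (norm (g x))\<^sup>2 \<partial>lebesgue_on upper) + 2 * (\<integral>x. (u x)\<^sup>2 * (norm (\<zeta> x))\<^sup>2 \<partial>lebesgue_on upper)"
    using integrable_cutoff cu cg by simp
  finally show "(\<integral>x. (norm (\<eta> x *\<^sub>R g x + u x *\<^sub>R \<zeta> x))\<^sup>2 \<partial>lebesgue_on upper) \<le>
      2 * (\<integral>x. (\<eta> x)\<^sup>2 * (norm (g x))\<^sup>2 \<partial>lebesgue_on upper) + 2 * Z\<^sup>2 * (\<integral>x. (u x)\<^sup>2 \<partial>lebesgue_on (half_ball 0 r))"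
    using outer_integral_le(2)[OF r cu i _ Z] by simp
qed

end

lemma ex_cutoff:
  assumes "0 \<le> r" "r < \<rho>" "\<rho> < R"
  obtains \<eta> :: "'n::finite pt \<Rightarrow> real" and \<zeta> Z where
    "cutoff \<eta> \<zeta> \<rho> R" "\<And>x. norm x \<le> r \<Longrightarrow> \<eta> x = 1" "\<And>x. norm (\<zeta> x) \<le> Z" "0 \<le> Z"
proof -
  obtain \<eta> :: "'n pt \<Rightarrow> real" and \<zeta> Z where *:
    "\<And>S. upper_C1 S \<eta> \<zeta>" "\<And>x. 0 \<le> \<eta> x \<and> \<eta> x \<le> 1" "\<And>x. norm x \<le> r \<Longrightarrow> \<eta> x = 1"
    "\<And>x. \<rho> \<le> norm x \<Longrightarrow> \<eta> x = 0" "\<And>x. \<rho> \<le> norm x \<Longrightarrow> \<zeta> x = 0"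
    "\<And>x. norm (\<zeta> x) \<le> Z" "0 \<le> Z"
    by (rule radial_cutoff[OF assms(1,2)]) blast
  show thesis
    by (rule that[of \<eta> \<zeta> Z]) (use * assms in \<open>auto simp: cutoff_def\<close>)
qed

section \<open>L2 convergence of vector fields and on smaller sets\<close>

lemma square_converges_inner:
  fixes P Q :: "nat \<Rightarrow> 'a \<Rightarrow> real ^ 'm::finite"
  assumes P: "\<And>i. square_converges M (\<lambda>k x. P k x $ i) (\<lambda>x. p x $ i)"
    and Q: "\<And>i. square_converges M (\<lambda>k x. Q k x $ i) (\<lambda>x. q x $ i)"
  shows "(\<lambda>k. \<integral>x. P k x \<bullet> Q k x \<partial>M) \<longlonglongrightarrow> (\<integral>x. p x \<bullet> q x \<partial>M)"
proof -
  have s: "square_integrable M (\<lambda>x. P k x $ i)" "square_integrable M (\<lambda>x. Q k x $ i)"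
    "square_integrable M (\<lambda>x. p x $ i)" "square_integrable M (\<lambda>x. q x $ i)" for i k
    using P[of i] Q[of i] by (simp_all add: square_converges_def)
  have "(\<lambda>k. \<Sum>i\<in>UNIV. \<integral>x. P k x $ i * Q k x $ i \<partial>M) \<longlonglongrightarrow> (\<Sum>i\<in>UNIV. \<integral>x. p x $ i * q x $ i \<partial>M)"
    by (intro tendsto_sum square_converges_integral_mult P Q)
  moreover have "(\<integral>x. P k x \<bullet> Q k x \<partial>M) = (\<Sum>i\<in>UNIV. \<integral>x. P k x $ i * Q k x $ i \<partial>M)" for k
    unfolding inner_vec_def inner_real_def
    by (intro Bochner_Integration.integral_sum square_integrable_mult_integrable s)
  moreover have "(\<integral>x. p x \<bullet> q x \<partial>M) = (\<Sum>i\<in>UNIV. \<integral>x. p x $ i * q x $ i \<partial>M)"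
    unfolding inner_vec_def inner_real_def
    by (intro Bochner_Integration.integral_sum square_integrable_mult_integrable s)
  ultimately show ?thesis
    by simp
qed

text \<open>The sequence may be replaced by one that agrees with it on \<open>S\<close> only. This
  is needed for gradients taken within a smaller half ball, which are determined only inside
  it.\<close>

lemma square_converges_subset:
  fixes f :: "'a::euclidean_space \<Rightarrow> real"
  assumes F: "square_converges (lebesgue_on T) F f" and S: "S \<in> sets borel" "T \<in> sets borel" "S \<subseteq> T"
    and eq: "\<And>k x. x \<in> S \<Longrightarrow> H k x = F k x"
  shows "square_converges (lebesgue_on S) H f"
proof -
  have sub: "square_integrable (lebesgue_on S) h" if "square_integrable (lebesgue_on T) h" for h :: "'a \<Rightarrow> real"
    unfolding square_integrable_def
  proof
    show "h \<in> borel_measurable (lebesgue_on S)"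
      using that S(3) unfolding square_integrable_def by (blast intro: measurable_restrict_mono)
    show "integrable (lebesgue_on S) (\<lambda>x. (h x)\<^sup>2)"
      using that by (intro integral_square_mono(2)[OF S]) (simp add: square_integrable_def)
  qed
  have cong: "square_integrable (lebesgue_on S) h \<longleftrightarrow> square_integrable (lebesgue_on S) h'"
    if "\<And>x. x \<in> S \<Longrightarrow> h x = h' x" for h h' :: "'a \<Rightarrow> real"
    unfolding square_integrable_def using that
    by (intro conj_cong measurable_cong Bochner_Integration.integrable_cong) auto
  have s: "square_integrable (lebesgue_on T) f" "\<And>k. square_integrable (lebesgue_on T) (F k)"
    using F by (simp_all add: square_converges_def)
  show ?thesis
    unfolding square_converges_def
  proof (intro conjI allI)
    show "square_integrable (lebesgue_on S) f"
      by (rule sub[OF s(1)])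
    show "square_integrable (lebesgue_on S) (H k)" for k
      using sub[OF s(2)] cong[of "H k" "F k"] eq by simp
    show "(\<lambda>k. \<integral>x. (H k x - f x)\<^sup>2 \<partial>lebesgue_on S) \<longlonglongrightarrow> 0"
    proof (rule tendsto_sandwich[of "\<lambda>_. 0"])
      have "(\<integral>x. (H k x - f x)\<^sup>2 \<partial>lebesgue_on S) = (\<integral>x. (F k x - f x)\<^sup>2 \<partial>lebesgue_on S)" for k
        using eq by (intro Bochner_Integration.integral_cong) auto
      moreover have "(\<integral>x. (F k x - f x)\<^sup>2 \<partial>lebesgue_on S) \<le> (\<integral>x. (F k x - f x)\<^sup>2 \<partial>lebesgue_on T)" for k
        using s by (intro integral_square_mono(1)[OF S] square_integrable_D square_integrable_diff)
      ultimately show "\<forall>\<^sub>F k in sequentially. (\<integral>x. (H k x - f x)\<^sup>2 \<partial>lebesgue_on S) \<le> (\<integral>x. (F k x - f x)\<^sup>2 \<partial>lebesgue_on T)"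
        by simp
    qed (use F in \<open>auto simp: square_converges_def intro!: always_eventually integral_nonneg_AE\<close>)
  qed
qed

subsection \<open>Blow-up limits\<close>

lemma finite_measure_half_ball: "finite_measure (lebesgue_on (half_ball (0::'n::finite pt) r))"
  using lmeasurable_half_ball by (rule finite_measure_lebesgue_on)

text \<open>Here \<open>F j\<close> is the rescaled coefficient matrix applied to
  \<open>g j\<close>, and \<open>e j\<close> measures how far that matrix is from the identity. The
  threshold 1/4 is the one that \<open>caccioppoli\<close> can absorb.\<close>

locale blowup_sequence =
  fixes u :: "nat \<Rightarrow> 'n::finite pt \<Rightarrow> real" and g F :: "nat \<Rightarrow> 'n pt \<Rightarrow> 'n pt"
    and e :: "nat \<Rightarrow> real" and C :: real
  assumes sol: "\<And>j. signorini_flux 2 (u j) (g j) (F j)"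
    and integrable_u: "\<And>j. integrable (lebesgue_on (half_ball 0 2)) (\<lambda>x. (u j x)\<^sup>2)"
    and mass_u: "\<And>j. mass (u j) 2 \<le> C"
    and e: "\<And>j. 0 \<le> e j" "\<And>j. e j \<le> 1 / 4" "e \<longlonglongrightarrow> 0"
    and near: "\<And>j x. x \<in> half_ball 0 2 \<Longrightarrow> norm (F j x - g j x) \<le> e j * norm (g j x)"
begin

lemma continuous_u: "continuous_on (half_ball 0 2) (u j)"
  and continuous_g: "continuous_on (half_ball 0 2) (g j)"
  and continuous_F: "continuous_on (half_ball 0 2) (F j)"
  and C1_u: "upper_C1 (half_ball 0 2) (u j) (g j)"
  using signorini_flux_D[OF sol] by auto

lemma near_square: "x \<in> half_ball 0 2 \<Longrightarrow> (norm (F j x - g j x))\<^sup>2 \<le> (e j)\<^sup>2 * (norm (g j x))\<^sup>2"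
  using power_mono[OF near norm_ge_zero, of x j 2] by (simp add: power_mult_distrib)

lemma integrable_inner:
  fixes h :: "'n pt \<Rightarrow> real"
  assumes "r < 2" "continuous_on (half_ball 0 2) h"
  shows "integrable (lebesgue_on (half_ball 0 r)) h"
  using integrable_half_ball_inner[OF assms(2,1)] .

text \<open>A cutoff equal to 1 on radius 3/2 and vanishing from 7/4 on turns the mass bound on
  radius 2 into a gradient bound through \<open>caccioppoli\<close>. Rellich is applied to the
  cut-off functions, which agree with the \<open>u j\<close> on the inner half ball.\<close>

lemma compactness:
  obtains s :: "nat \<Rightarrow> nat" and B where "strict_mono s"
    "\<And>j. (\<integral>x. (norm (g j x))\<^sup>2 \<partial>lebesgue_on (half_ball 0 (3/2))) \<le> B"
    "\<And>\<epsilon>. 0 < \<epsilon> \<Longrightarrow> \<exists>N. \<forall>i\<ge>N. \<forall>j\<ge>N. (\<integral>x. (u (s i) x - u (s j) x)\<^sup>2 \<partial>lebesgue_on (half_ball 0 (3/2))) < \<epsilon>"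
proof -
  obtain \<eta> :: "'n pt \<Rightarrow> real" and \<zeta> Z where cut: "cutoff \<eta> \<zeta> (7/4) 2"
    and \<eta>1: "\<And>x. norm x \<le> 3/2 \<Longrightarrow> \<eta> x = 1" and Z: "\<And>x. norm (\<zeta> x) \<le> Z" "0 \<le> Z"
    by (rule ex_cutoff[of "3/2" "7/4" 2, where 'n = 'n]) (simp_all, blast)
  interpret cutoff \<eta> \<zeta> "7/4" 2 by fact
  have cu: "continuous_on (half_ball 0 2) (\<lambda>x. (u j x)\<^sup>2)" for j
    by (intro continuous_intros continuous_u)
  have E: "(\<integral>x. (\<eta> x)\<^sup>2 * (norm (g j x))\<^sup>2 \<partial>lebesgue_on upper) \<le> 14 * (Z\<^sup>2 * C)" for j
  proof -
    have "norm (F j x - g j x) \<le> norm (g j x) / 4" if "x \<in> half_ball 0 2" for x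
      using near[OF that, of j] mult_right_mono[OF e(2)[of j] norm_ge_zero[of "g j x"]] by simp
    then have "(\<integral>x. (\<eta> x)\<^sup>2 * (norm (g j x))\<^sup>2 \<partial>lebesgue_on upper) \<le>
        14 * (\<integral>x. (u j x)\<^sup>2 * (norm (\<zeta> x))\<^sup>2 \<partial>lebesgue_on upper)"
      by (rule caccioppoli[OF sol])
    also have "(\<integral>x. (u j x)\<^sup>2 * (norm (\<zeta> x))\<^sup>2 \<partial>lebesgue_on upper) \<le> Z\<^sup>2 * mass (u j) 2"
      unfolding mass_def by (rule outer_integral_le(2)[OF _ cu integrable_u _ Z(1)]) auto
    also have "\<dots> \<le> Z\<^sup>2 * C"
      using mass_u by (intro mult_left_mono) auto
    finally show ?thesis
      by simp
  qed
  have B: "(\<integral>x. (norm (g j x))\<^sup>2 \<partial>lebesgue_on (half_ball 0 (3/2))) \<le> 14 * (Z\<^sup>2 * C)" for j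
  proof -
    have "(\<integral>x. (norm (g j x))\<^sup>2 \<partial>lebesgue_on (half_ball 0 (3/2))) \<le>
        (\<integral>x. (\<eta> x)\<^sup>2 * (norm (g j x))\<^sup>2 \<partial>lebesgue_on upper)"
      using \<eta>1 by (intro inner_integral_le) (auto intro!: continuous_intros continuous_g)
    then show ?thesis
      using E[of j] by simp
  qed
  have "\<exists>s::nat \<Rightarrow> nat. strict_mono s \<and>
      (\<forall>\<epsilon>>0. \<exists>N. \<forall>i\<ge>N. \<forall>j\<ge>N. (\<integral>x. (\<eta> x * u (s i) x - \<eta> x * u (s j) x)\<^sup>2 \<partial>lebesgue_on upper) < \<epsilon>)"
  proof (rule rellich)
    show "upper_C1_compact (\<lambda>x. \<eta> x * u j x) (\<lambda>x. \<eta> x *\<^sub>R g j x + u j x *\<^sub>R \<zeta> x) (7/4)" for j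
      by (rule upper_C1_compact_cutoff[OF C1_u])
    show "(\<integral>x. (\<eta> x * u j x)\<^sup>2 \<partial>lebesgue_on upper) \<le> C" for j
      using cutoff_energy_le(1)[OF C1_u Z(1) _ integrable_u, of j] mass_u[of j] by (simp add: mass_def)
    show "(\<integral>x. (norm (\<eta> x *\<^sub>R g j x + u j x *\<^sub>R \<zeta> x))\<^sup>2 \<partial>lebesgue_on upper) \<le>
        2 * (14 * (Z\<^sup>2 * C)) + 2 * Z\<^sup>2 * C" for j
    proof -
      have "2 * Z\<^sup>2 * mass (u j) 2 \<le> 2 * Z\<^sup>2 * C"
        using mass_u by (intro mult_left_mono) auto
      then show ?thesis
        using cutoff_energy_le(2)[OF C1_u Z(1) _ integrable_u, of j] E[of j] unfolding mass_def by linarith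
    qed
  qed
  then obtain s :: "nat \<Rightarrow> nat" where s: "strict_mono s"
    "\<And>\<epsilon>. 0 < \<epsilon> \<Longrightarrow> \<exists>N. \<forall>i\<ge>N. \<forall>j\<ge>N. (\<integral>x. (\<eta> x * u (s i) x - \<eta> x * u (s j) x)\<^sup>2 \<partial>lebesgue_on upper) < \<epsilon>"
    by blast
  have le: "(\<integral>x. (u i x - u j x)\<^sup>2 \<partial>lebesgue_on (half_ball 0 (3/2))) \<le>
      (\<integral>x. (\<eta> x * u i x - \<eta> x * u j x)\<^sup>2 \<partial>lebesgue_on upper)" for i j
  proof -
    have "(\<integral>x. (u i x - u j x)\<^sup>2 \<partial>lebesgue_on (half_ball 0 (3/2))) \<le>
        (\<integral>x. (\<eta> x)\<^sup>2 * (u i x - u j x)\<^sup>2 \<partial>lebesgue_on upper)"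
      using \<eta>1 by (intro inner_integral_le) (auto intro!: continuous_intros continuous_u)
    then show ?thesis
      by (simp add: right_diff_distrib[symmetric] power_mult_distrib)
  qed
  show thesis
  proof (rule that[OF s(1) B])
    fix \<epsilon> :: real assume "0 < \<epsilon>"
    then obtain N where "\<forall>i\<ge>N. \<forall>j\<ge>N. (\<integral>x. (\<eta> x * u (s i) x - \<eta> x * u (s j) x)\<^sup>2 \<partial>lebesgue_on upper) < \<epsilon>"
      using s(2) by blast
    then show "\<exists>N. \<forall>i\<ge>N. \<forall>j\<ge>N. (\<integral>x. (u (s i) x - u (s j) x)\<^sup>2 \<partial>lebesgue_on (half_ball 0 (3/2))) < \<epsilon>"
      using le by (meson le_less_trans)
  qed
qed

lemma subsequence:
  assumes "strict_mono s"
  shows "blowup_sequence (\<lambda>j. u (s j)) (\<lambda>j. g (s j)) (\<lambda>j. F (s j)) (\<lambda>j. e (s j)) C"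
proof
  show "(\<lambda>j. e (s j)) \<longlonglongrightarrow> 0"
    using LIMSEQ_subseq_LIMSEQ[OF e(3) assms] by (simp add: o_def)
qed (use sol integrable_u mass_u e near in auto)

end

locale convergent_blowup = blowup_sequence u g F e C
  for u :: "nat \<Rightarrow> 'n::finite pt \<Rightarrow> real" and g F e C +
  fixes B :: real
  assumes energy_g: "\<And>j. (\<integral>x. (norm (g j x))\<^sup>2 \<partial>lebesgue_on (half_ball 0 (3/2))) \<le> B"
    and Cauchy_u: "\<And>\<epsilon>. 0 < \<epsilon> \<Longrightarrow>
      \<exists>N. \<forall>i\<ge>N. \<forall>j\<ge>N. (\<integral>x. (u i x - u j x)\<^sup>2 \<partial>lebesgue_on (half_ball 0 (3/2))) < \<epsilon>"
begin

lemma B_nonneg: "0 \<le> B"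
proof -
  have "0 \<le> (\<integral>x. (norm (g 0 x))\<^sup>2 \<partial>lebesgue_on (half_ball 0 (3/2)))"
    by (intro integral_nonneg_AE) auto
  then show ?thesis
    using energy_g[of 0] by (rule order_trans)
qed

lemma flux_defect_le:
  "(\<integral>x. (norm (F j x - g j x))\<^sup>2 \<partial>lebesgue_on (half_ball 0 (3/2))) \<le> (e j)\<^sup>2 * B"
proof -
  have "(\<integral>x. (norm (F j x - g j x))\<^sup>2 \<partial>lebesgue_on (half_ball 0 (3/2))) \<le>
      (\<integral>x. (e j)\<^sup>2 * (norm (g j x))\<^sup>2 \<partial>lebesgue_on (half_ball 0 (3/2)))"
  proof (rule integral_mono)
    show "(norm (F j x - g j x))\<^sup>2 \<le> (e j)\<^sup>2 * (norm (g j x))\<^sup>2" if "x \<in> space (lebesgue_on (half_ball 0 (3/2)))" for x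
      using that near_square[of x j] by (auto simp: mem_half_ball_0)
  qed (auto intro!: integrable_inner continuous_intros continuous_g continuous_F)
  also have "\<dots> = (e j)\<^sup>2 * (\<integral>x. (norm (g j x))\<^sup>2 \<partial>lebesgue_on (half_ball 0 (3/2)))"
    by simp
  also have "\<dots> \<le> (e j)\<^sup>2 * B"
    by (intro mult_left_mono energy_g) auto
  finally show ?thesis .
qed

text \<open>The cutoff lives inside radius 3/2, where the gradients are bounded by \<open>B\<close>
  and the functions are Cauchy. In the bound for a pair \<open>i\<close>, \<open>j\<close>, the flux
  defects are therefore controlled by \<open>e i\<close> and \<open>e j\<close>, and the remaining
  term by the L2 distance of the functions.\<close>

lemma Cauchy_g:
  assumes "0 < \<epsilon>"
  shows "\<exists>N. \<forall>i\<ge>N. \<forall>j\<ge>N. (\<integral>x. (norm (g i x - g j x))\<^sup>2 \<partial>lebesgue_on (half_ball 0 (5/4))) < \<epsilon>"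
proof -
  obtain \<eta> :: "'n pt \<Rightarrow> real" and \<zeta> Z where cut: "cutoff \<eta> \<zeta> (3/2) 2"
    and \<eta>1: "\<And>x. norm x \<le> 5/4 \<Longrightarrow> \<eta> x = 1" and Z: "\<And>x. norm (\<zeta> x) \<le> Z" "0 \<le> Z"
    by (rule ex_cutoff[of "5/4" "3/2" 2, where 'n = 'n]) (simp_all, blast)
  interpret cutoff \<eta> \<zeta> "3/2" 2 by fact
  let ?I = "\<lambda>i j. \<integral>x. (u i x - u j x)\<^sup>2 \<partial>lebesgue_on (half_ball 0 (3/2))"
  have est: "(\<integral>x. (norm (g i x - g j x))\<^sup>2 \<partial>lebesgue_on (half_ball 0 (5/4))) \<le>
      8 * B * ((e i)\<^sup>2 + (e j)\<^sup>2) + 10 * Z\<^sup>2 * ?I i j" for i j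
  proof -
    have "(\<integral>x. (norm (g i x - g j x))\<^sup>2 \<partial>lebesgue_on (half_ball 0 (5/4))) \<le>
        (\<integral>x. (\<eta> x)\<^sup>2 * (norm (g i x - g j x))\<^sup>2 \<partial>lebesgue_on upper)"
      using \<eta>1 by (intro inner_integral_le) (auto intro!: continuous_intros continuous_g)
    also have "\<dots> \<le> 4 * (\<integral>x. (\<eta> x)\<^sup>2 * (norm ((F i x - g i x) - (F j x - g j x)))\<^sup>2 \<partial>lebesgue_on upper)
        + 10 * (\<integral>x. (u i x - u j x)\<^sup>2 * (norm (\<zeta> x))\<^sup>2 \<partial>lebesgue_on upper)"
      by (rule energy_difference[OF sol sol])
    also have "(\<integral>x. (u i x - u j x)\<^sup>2 * (norm (\<zeta> x))\<^sup>2 \<partial>lebesgue_on upper) \<le> Z\<^sup>2 * ?I i j"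
      by (rule outer_integral_le(2)[OF _ _ _ _ Z(1)])
        (auto intro!: integrable_inner continuous_intros continuous_u)
    also have "(\<integral>x. (\<eta> x)\<^sup>2 * (norm ((F i x - g i x) - (F j x - g j x)))\<^sup>2 \<partial>lebesgue_on upper) \<le>
        (\<integral>x. (norm ((F i x - g i x) - (F j x - g j x)))\<^sup>2 \<partial>lebesgue_on (half_ball 0 (3/2)))"
      by (rule outer_integral_le(1)) (auto intro!: integrable_inner continuous_intros continuous_g continuous_F)
    also have "\<dots> \<le> (\<integral>x. 2 * (norm (F i x - g i x))\<^sup>2 + 2 * (norm (F j x - g j x))\<^sup>2 \<partial>lebesgue_on (half_ball 0 (3/2)))"
    proof (rule integral_mono)
      have "(norm (a - b))\<^sup>2 \<le> 2 * (norm a)\<^sup>2 + 2 * (norm b)\<^sup>2" for a b :: "'n pt"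
        using zero_le_power2[of "norm (a + b)"]
        by (simp add: power2_norm_eq_inner inner_add_left inner_add_right inner_diff_left inner_diff_right inner_commute)
      then show "(norm ((F i x - g i x) - (F j x - g j x)))\<^sup>2 \<le> 2 * (norm (F i x - g i x))\<^sup>2 + 2 * (norm (F j x - g j x))\<^sup>2" for x .
    qed (auto intro!: integrable_inner continuous_intros continuous_g continuous_F)
    also have "\<dots> = 2 * (\<integral>x. (norm (F i x - g i x))\<^sup>2 \<partial>lebesgue_on (half_ball 0 (3/2))) +
        2 * (\<integral>x. (norm (F j x - g j x))\<^sup>2 \<partial>lebesgue_on (half_ball 0 (3/2)))"
    proof -
      have "integrable (lebesgue_on (half_ball 0 (3/2))) (\<lambda>x. (norm (F i x - g i x))\<^sup>2)" for i
        by (auto intro!: integrable_inner continuous_intros continuous_g continuous_F)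
      then show ?thesis
        by simp
    qed
    also have "\<dots> \<le> 2 * ((e i)\<^sup>2 * B) + 2 * ((e j)\<^sup>2 * B)"
      by (intro add_mono mult_left_mono flux_defect_le) auto
    finally show ?thesis
      by (simp add: algebra_simps)
  qed
  \<comment> \<open>The total constant of \<open>est\<close> when both squared defects and the L2
    distance are below \<open>\<delta>\<close>, plus 1 to make the final inequality strict.\<close>
  define k where "k = 16 * B + 10 * Z\<^sup>2 + 1"
  have k: "k > 0"
    using B_nonneg by (simp add: k_def add_nonneg_pos)
  define \<delta> where "\<delta> = \<epsilon> / k"
  have \<delta>: "\<delta> > 0"
    using assms k by (simp add: \<delta>_def)
  obtain N1 where N1: "\<And>i j. N1 \<le> i \<Longrightarrow> N1 \<le> j \<Longrightarrow> ?I i j < \<delta>"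
    using Cauchy_u[OF \<delta>] by blast
  have "(\<lambda>j. (e j)\<^sup>2) \<longlonglongrightarrow> 0"
    using tendsto_power[OF e(3), of 2] by simp
  then obtain N2 where N2: "\<And>j. N2 \<le> j \<Longrightarrow> (e j)\<^sup>2 < \<delta>"
    using \<delta> LIMSEQ_D[of _ 0 \<delta>] by fastforce
  show ?thesis
  proof (intro exI[of _ "max N1 N2"] allI impI)
    fix i j assume ij: "max N1 N2 \<le> i" "max N1 N2 \<le> j"
    have "8 * B * ((e i)\<^sup>2 + (e j)\<^sup>2) \<le> 8 * B * (\<delta> + \<delta>)"
      using N2[of i] N2[of j] ij B_nonneg by (intro mult_left_mono add_mono) auto
    moreover have "10 * Z\<^sup>2 * ?I i j \<le> 10 * Z\<^sup>2 * \<delta>"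
      using N1[of i j] ij by (intro mult_left_mono) auto
    moreover have "8 * B * (\<delta> + \<delta>) + 10 * Z\<^sup>2 * \<delta> = (k - 1) * \<delta>"
      by (simp add: k_def algebra_simps)
    moreover have "(k - 1) * \<delta> < \<epsilon>"
      using k \<delta> by (simp add: \<delta>_def field_simps)
    ultimately show "(\<integral>x. (norm (g i x - g j x))\<^sup>2 \<partial>lebesgue_on (half_ball 0 (5/4))) < \<epsilon>"
      using est[of i j] by linarith
  qed
qed

lemma integral_shrink:
  fixes h :: "'n pt \<Rightarrow> real"
  assumes "r \<le> R" "R < 2" "continuous_on (half_ball 0 2) h"
  shows "(\<integral>x. (h x)\<^sup>2 \<partial>lebesgue_on (half_ball 0 r)) \<le> (\<integral>x. (h x)\<^sup>2 \<partial>lebesgue_on (half_ball 0 R))"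
  using assms by (intro integral_square_mono(1) half_ball_mono integrable_inner continuous_intros) auto

text \<open>The trace inequality applied to cut-off differences. It needs the gradients themselves
  to be Cauchy on radius 5/4, and the cutoff restricts the conclusion to radius 1.\<close>

lemma Cauchy_trace:
  assumes "0 < \<epsilon>"
  shows "\<exists>N. \<forall>i\<ge>N. \<forall>j\<ge>N. (\<integral>x. (u i (flat x) - u j (flat x))\<^sup>2 \<partial>lebesgue_on (ball 0 1)) < \<epsilon>"
proof -
  obtain \<eta> :: "'n pt \<Rightarrow> real" and \<zeta> Z where cut: "cutoff \<eta> \<zeta> (5/4) 2"
    and \<eta>1: "\<And>x. norm x \<le> 1 \<Longrightarrow> \<eta> x = 1" and Z: "\<And>x. norm (\<zeta> x) \<le> Z" "0 \<le> Z"
    by (rule ex_cutoff[of 1 "5/4" 2, where 'n = 'n]) (simp_all, blast)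
  interpret cutoff \<eta> \<zeta> "5/4" 2 by fact
  let ?I = "\<lambda>i j. \<integral>x. (u i x - u j x)\<^sup>2 \<partial>lebesgue_on (half_ball 0 (3/2))"
  let ?J = "\<lambda>i j. \<integral>x. (norm (g i x - g j x))\<^sup>2 \<partial>lebesgue_on (half_ball 0 (5/4))"
  have est: "(\<integral>x. (u i (flat x) - u j (flat x))\<^sup>2 \<partial>lebesgue_on (ball 0 1)) \<le>
      (1 + 2 * Z\<^sup>2) * ?I i j + 2 * ?J i j" for i j
  proof -
    let ?d = "\<lambda>x. u i x - u j x" and ?D = "\<lambda>x. g i x - g j x"
    have C1: "upper_C1 (half_ball 0 2) ?d ?D"
      by (intro upper_C1_diff C1_u)
    interpret c: upper_C1_compact "\<lambda>x. \<eta> x * ?d x" "\<lambda>x. \<eta> x *\<^sub>R ?D x + ?d x *\<^sub>R \<zeta> x" "5/4"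
      by (rule upper_C1_compact_cutoff[OF C1])
    have i: "integrable (lebesgue_on (half_ball 0 (5/4))) (\<lambda>x. (?d x)\<^sup>2)"
      by (auto intro!: integrable_inner continuous_intros continuous_u)
    have sh: "(\<integral>x. (?d x)\<^sup>2 \<partial>lebesgue_on (half_ball 0 (5/4))) \<le> ?I i j"
      by (rule integral_shrink) (auto intro!: continuous_intros continuous_u)
    have "(\<integral>x. (u i (flat x) - u j (flat x))\<^sup>2 \<partial>lebesgue_on (ball 0 1)) =
        (\<integral>x. (\<eta> (flat x) * ?d (flat x))\<^sup>2 \<partial>lebesgue_on (ball 0 1))"
      using \<eta>1 by (intro Bochner_Integration.integral_cong) auto
    also have "\<dots> \<le> (\<integral>x. (\<eta> x * ?d x)\<^sup>2 \<partial>lebesgue_on upper) +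
        (\<integral>x. (norm (\<eta> x *\<^sub>R ?D x + ?d x *\<^sub>R \<zeta> x))\<^sup>2 \<partial>lebesgue_on upper)"
      by (rule c.trace_square_le)
    also have "(\<integral>x. (\<eta> x * ?d x)\<^sup>2 \<partial>lebesgue_on upper) \<le> ?I i j"
      using cutoff_energy_le(1)[OF C1 Z(1) _ i] sh by simp
    also have "(\<integral>x. (norm (\<eta> x *\<^sub>R ?D x + ?d x *\<^sub>R \<zeta> x))\<^sup>2 \<partial>lebesgue_on upper) \<le>
        2 * (\<integral>x. (\<eta> x)\<^sup>2 * (norm (?D x))\<^sup>2 \<partial>lebesgue_on upper) + 2 * Z\<^sup>2 * (\<integral>x. (?d x)\<^sup>2 \<partial>lebesgue_on (half_ball 0 (5/4)))"
      using cutoff_energy_le(2)[OF C1 Z(1) _ i] by simp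
    also have "(\<integral>x. (\<eta> x)\<^sup>2 * (norm (?D x))\<^sup>2 \<partial>lebesgue_on upper) \<le> ?J i j"
      by (rule outer_integral_le(1)) (auto intro!: integrable_inner continuous_intros continuous_g)
    also have "2 * Z\<^sup>2 * (\<integral>x. (?d x)\<^sup>2 \<partial>lebesgue_on (half_ball 0 (5/4))) \<le> 2 * Z\<^sup>2 * ?I i j"
      using sh by (intro mult_left_mono) auto
    finally show ?thesis
      by (simp add: algebra_simps)
  qed
  define k where "k = 2 + 2 * Z\<^sup>2 + 2"
  have k: "k > 0"
    by (simp add: k_def add_pos_nonneg)
  define \<delta> where "\<delta> = \<epsilon> / k"
  have \<delta>: "\<delta> > 0"
    using assms k by (simp add: \<delta>_def)
  obtain N1 where N1: "\<And>i j. N1 \<le> i \<Longrightarrow> N1 \<le> j \<Longrightarrow> ?I i j < \<delta>"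
    using Cauchy_u[OF \<delta>] by blast
  obtain N2 where N2: "\<And>i j. N2 \<le> i \<Longrightarrow> N2 \<le> j \<Longrightarrow> ?J i j < \<delta>"
    using Cauchy_g[OF \<delta>] by blast
  show ?thesis
  proof (intro exI[of _ "max N1 N2"] allI impI)
    fix i j assume ij: "max N1 N2 \<le> i" "max N1 N2 \<le> j"
    have "(1 + 2 * Z\<^sup>2) * ?I i j \<le> (1 + 2 * Z\<^sup>2) * \<delta>"
      using N1[of i j] ij by (intro mult_left_mono) auto
    moreover have "2 * ?J i j \<le> 2 * \<delta>"
      using N2[of i j] ij by auto
    moreover have "(1 + 2 * Z\<^sup>2) * \<delta> + 2 * \<delta> = (k - 1) * \<delta>"
      by (simp add: k_def algebra_simps)
    moreover have "(k - 1) * \<delta> < \<epsilon>"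
      using k \<delta> by (simp add: \<delta>_def field_simps)
    ultimately show "(\<integral>x. (u i (flat x) - u j (flat x))\<^sup>2 \<partial>lebesgue_on (ball 0 1)) < \<epsilon>"
      using est[of i j] by linarith
  qed
qed

lemma square_integrable_inner:
  fixes h :: "'n pt \<Rightarrow> real"
  assumes "continuous_on (half_ball 0 2) h" "r < 2"
  shows "square_integrable (lebesgue_on (half_ball 0 r)) h"
  unfolding square_integrable_def
proof
  show "h \<in> borel_measurable (lebesgue_on (half_ball 0 r))"
    by (rule borel_measurable_integrable[OF integrable_inner[OF assms(2,1)]])
  show "integrable (lebesgue_on (half_ball 0 r)) (\<lambda>x. (h x)\<^sup>2)"
    by (rule integrable_inner[OF assms(2) continuous_on_power[OF assms(1)]])
qed

lemma square_integrable_trace: "square_integrable (lebesgue_on (ball 0 1)) (\<lambda>x. u j (flat x))"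
proof -
  have c: "continuous_on (cball 0 1) (\<lambda>x. u j (flat x))"
    by (rule continuous_on_compose2[OF continuous_u]) (auto simp: mem_half_ball_0 flat_upper intro!: continuous_intros)
  then have "bounded ((\<lambda>x. u j (flat x)) ` cball 0 1)"
    by (intro compact_imp_bounded compact_continuous_image) auto
  then obtain K where K: "\<forall>x\<in>cball 0 1. \<bar>u j (flat x)\<bar> \<le> K"
    unfolding bounded_iff by (auto simp del: mem_cball_0)
  interpret finite_measure "lebesgue_on (ball (0::real ^ 'n) 1)"
    by (rule finite_measure_lebesgue_on) simp
  show ?thesis
  proof (rule square_integrable_bounded[where C = K])
    show "(\<lambda>x. u j (flat x)) \<in> borel_measurable (lebesgue_on (ball 0 1))"
      using continuous_on_subset[OF c] by (intro continuous_imp_measurable_on_sets_lebesgue) auto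
  qed (use K in auto)
qed

lemma ex_limits:
  obtains w G T where
    "square_converges (lebesgue_on (half_ball 0 1)) u w"
    "\<And>i. square_converges (lebesgue_on (half_ball 0 1)) (\<lambda>j x. g j x $ i) (\<lambda>x. G x $ i)"
    "square_converges (lebesgue_on (ball 0 1)) (\<lambda>j x. u j (flat x)) T"
proof -
  interpret H: finite_measure "lebesgue_on (half_ball (0::'n pt) 1)"
    by (rule finite_measure_half_ball)
  interpret T: finite_measure "lebesgue_on (ball (0::real ^ 'n) 1)"
    by (rule finite_measure_lebesgue_on) simp
  have cg: "continuous_on (half_ball 0 2) (\<lambda>x. g j x $ i)" for i j
    by (intro continuous_intros continuous_g)
  have "\<exists>w. square_converges (lebesgue_on (half_ball 0 1)) u w"
  proof (rule H.square_integrable_complete)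
    show "square_integrable (lebesgue_on (half_ball 0 1)) (u j)" for j
      by (intro square_integrable_inner continuous_u) simp
    fix \<epsilon> :: real assume "0 < \<epsilon>"
    then obtain N where N: "\<forall>i\<ge>N. \<forall>j\<ge>N. (\<integral>x. (u i x - u j x)\<^sup>2 \<partial>lebesgue_on (half_ball 0 (3/2))) < \<epsilon>"
      using Cauchy_u by blast
    have "(\<integral>x. (u i x - u j x)\<^sup>2 \<partial>lebesgue_on (half_ball 0 1)) \<le> (\<integral>x. (u i x - u j x)\<^sup>2 \<partial>lebesgue_on (half_ball 0 (3/2)))" for i j
      by (rule integral_shrink) (auto intro!: continuous_intros continuous_u)
    then show "\<exists>N. \<forall>i\<ge>N. \<forall>j\<ge>N. (\<integral>x. (u i x - u j x)\<^sup>2 \<partial>lebesgue_on (half_ball 0 1)) < \<epsilon>"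
      using N by (meson le_less_trans)
  qed
  then obtain w where w: "square_converges (lebesgue_on (half_ball 0 1)) u w"
    by blast
  have "\<exists>G. square_converges (lebesgue_on (half_ball 0 1)) (\<lambda>j x. g j x $ i) G" for i
  proof (rule H.square_integrable_complete)
    show "square_integrable (lebesgue_on (half_ball 0 1)) (\<lambda>x. g j x $ i)" for j
      by (intro square_integrable_inner cg) simp
    fix \<epsilon> :: real assume "0 < \<epsilon>"
    then obtain N where N: "\<forall>i\<ge>N. \<forall>j\<ge>N. (\<integral>x. (norm (g i x - g j x))\<^sup>2 \<partial>lebesgue_on (half_ball 0 (5/4))) < \<epsilon>"
      using Cauchy_g by blast
    have "(\<integral>x. (g k x $ i - g j x $ i)\<^sup>2 \<partial>lebesgue_on (half_ball 0 1)) \<le>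
        (\<integral>x. (norm (g k x - g j x))\<^sup>2 \<partial>lebesgue_on (half_ball 0 (5/4)))" for k j
    proof -
      have "(\<integral>x. (g k x $ i - g j x $ i)\<^sup>2 \<partial>lebesgue_on (half_ball 0 1)) \<le>
          (\<integral>x. (norm (g k x - g j x))\<^sup>2 \<partial>lebesgue_on (half_ball 0 1))"
      proof (rule integral_mono)
        fix x
        have "\<bar>(g k x - g j x) $ i\<bar> \<le> norm (g k x - g j x)"
          by (rule component_le_norm_cart)
        then show "(g k x $ i - g j x $ i)\<^sup>2 \<le> (norm (g k x - g j x))\<^sup>2"
          by (simp add: abs_le_square_iff[symmetric])
      qed (auto intro!: integrable_inner continuous_intros continuous_g)
      also have "\<dots> \<le> (\<integral>x. (norm (g k x - g j x))\<^sup>2 \<partial>lebesgue_on (half_ball 0 (5/4)))"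
        by (rule integral_shrink) (auto intro!: continuous_intros continuous_g)
      finally show ?thesis .
    qed
    then show "\<exists>N. \<forall>k\<ge>N. \<forall>j\<ge>N. (\<integral>x. (g k x $ i - g j x $ i)\<^sup>2 \<partial>lebesgue_on (half_ball 0 1)) < \<epsilon>"
      using N by (meson le_less_trans)
  qed
  then obtain G where G: "\<And>i. square_converges (lebesgue_on (half_ball 0 1)) (\<lambda>j x. g j x $ i) (G i)"
    by metis
  obtain T where T: "square_converges (lebesgue_on (ball 0 1)) (\<lambda>j x. u j (flat x)) T"
    using T.square_integrable_complete[OF square_integrable_trace Cauchy_trace] by blast
  show thesis
    by (rule that[of w "\<lambda>x. \<chi> i. G i x" T]) (use w G T in auto)
qed

theorem ex_blowup_limit:
  "\<exists>w. square_converges (lebesgue_on (half_ball 0 1)) u w \<and> laplace_thin_obstacle_weak_solution w"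
proof -
  let ?M = "lebesgue_on (half_ball (0::'n pt) 1)"
  interpret H: finite_measure ?M
    by (rule finite_measure_half_ball)
  obtain w G T where w: "square_converges ?M u w"
    and G: "\<And>i. square_converges ?M (\<lambda>j x. g j x $ i) (\<lambda>x. G x $ i)"
    and T: "square_converges (lebesgue_on (ball 0 1)) (\<lambda>j x. u j (flat x)) T"
    by (rule ex_limits) blast
  \<comment> \<open>Fluxes and gradients share the limit \<open>G\<close>, because their difference
    is at most \<open>e j\<close> times a bounded quantity. This is why the limit equation is
    Laplace's.\<close>
  have FG: "square_converges ?M (\<lambda>j x. F j x $ i) (\<lambda>x. G x $ i)" for i
  proof (rule square_converges_perturb[OF G])
    show "square_integrable ?M (\<lambda>x. F j x $ i)" for j
      by (intro square_integrable_inner continuous_intros continuous_F) simp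
    show "(\<lambda>j. \<integral>x. (F j x $ i - g j x $ i)\<^sup>2 \<partial>?M) \<longlonglongrightarrow> 0"
    proof (rule tendsto_sandwich[of "\<lambda>_. 0"])
      show "(\<lambda>j. (e j)\<^sup>2 * B) \<longlonglongrightarrow> 0"
        using tendsto_mult_right[OF tendsto_power[OF e(3), of 2], of B] by simp
      have "(\<integral>x. (F j x $ i - g j x $ i)\<^sup>2 \<partial>?M) \<le> (e j)\<^sup>2 * B" for j
      proof -
        have "(\<integral>x. (F j x $ i - g j x $ i)\<^sup>2 \<partial>?M) \<le> (\<integral>x. (norm (F j x - g j x))\<^sup>2 \<partial>?M)"
        proof (rule integral_mono)
          fix x
          have "\<bar>(F j x - g j x) $ i\<bar> \<le> norm (F j x - g j x)"
            by (rule component_le_norm_cart)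
          then show "(F j x $ i - g j x $ i)\<^sup>2 \<le> (norm (F j x - g j x))\<^sup>2"
            by (simp add: abs_le_square_iff[symmetric])
        qed (auto intro!: integrable_inner continuous_intros continuous_g continuous_F)
        also have "\<dots> \<le> (\<integral>x. (norm (F j x - g j x))\<^sup>2 \<partial>lebesgue_on (half_ball 0 (3/2)))"
          by (rule integral_shrink) (auto intro!: continuous_intros continuous_g continuous_F)
        also have "\<dots> \<le> (e j)\<^sup>2 * B"
          by (rule flux_defect_le)
        finally show ?thesis .
      qed
      then show "\<forall>\<^sub>F j in sequentially. (\<integral>x. (F j x $ i - g j x $ i)\<^sup>2 \<partial>?M) \<le> (e j)\<^sup>2 * B"
        by simp
    qed (auto intro!: always_eventually integral_nonneg_AE)
  qed
  have bounded_test: "\<exists>K. \<forall>x. \<bar>\<phi> x\<bar> \<le> K \<and> norm (grad UNIV \<phi> x) \<le> K"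
    and measurable_test: "\<phi> \<in> borel_measurable ?M" "(\<lambda>x. grad UNIV \<phi> x $ i) \<in> borel_measurable ?M"
    if "\<phi> \<in> test_functions U" for \<phi> :: "'n pt \<Rightarrow> real" and U i
  proof -
    define K where "K = closure {x. \<phi> x \<noteq> 0}"
    have C: "C1_on UNIV \<phi>" and K: "compact K"
      using that by (simp_all add: test_functions_def K_def)
    have c: "continuous_on UNIV \<phi>" "continuous_on UNIV (grad UNIV \<phi>)"
      using C by (auto simp: C1_on_def differentiable_imp_continuous_on)
    have "bounded (\<phi> ` K)" "bounded (grad UNIV \<phi> ` K)"
      using c K by (auto intro!: compact_imp_bounded compact_continuous_image intro: continuous_on_subset)
    then obtain a b where ab: "a > 0" "b > 0" "\<And>x. x \<in> K \<Longrightarrow> \<bar>\<phi> x\<bar> \<le> a" "\<And>x. x \<in> K \<Longrightarrow> norm (grad UNIV \<phi> x) \<le> b"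
      by (auto simp: bounded_pos)
    have "\<bar>\<phi> x\<bar> \<le> max a b \<and> norm (grad UNIV \<phi> x) \<le> max a b" for x
    proof (cases "x \<in> K")
      case True
      then show ?thesis
        using ab by (force simp: le_max_iff_disj)
    next
      case False
      then have "\<phi> x = 0" "grad UNIV \<phi> x = 0"
        using grad_eq_0_outside_support[of x \<phi>] closure_subset[of "{x. \<phi> x \<noteq> 0}"] by (auto simp: K_def)
      then show ?thesis
        using ab by simp
    qed
    then show "\<exists>K. \<forall>x. \<bar>\<phi> x\<bar> \<le> K \<and> norm (grad UNIV \<phi> x) \<le> K"
      by blast
    show "\<phi> \<in> borel_measurable ?M" "(\<lambda>x. grad UNIV \<phi> x $ i) \<in> borel_measurable ?M"
      using c by (auto intro!: continuous_imp_measurable_on_sets_lebesgue continuous_intros intro: continuous_on_subset)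
  qed
  have test_const: "square_converges ?M (\<lambda>_. \<phi>) \<phi>"
    and grad_const: "square_converges ?M (\<lambda>_ x. grad UNIV \<phi> x $ i) (\<lambda>x. grad UNIV \<phi> x $ i)"
    and product: "square_converges ?M (\<lambda>j x. (\<phi> x *\<^sub>R g j x + u j x *\<^sub>R grad UNIV \<phi> x) $ i)
      (\<lambda>x. (\<phi> x *\<^sub>R G x + w x *\<^sub>R grad UNIV \<phi> x) $ i)"
    if \<phi>: "\<phi> \<in> test_functions U" for \<phi> U i
  proof -
    obtain K where K: "\<And>x. \<bar>\<phi> x\<bar> \<le> K" "\<And>x. norm (grad UNIV \<phi> x) \<le> K"
      using bounded_test[OF \<phi>] by blast
    have K': "\<bar>grad UNIV \<phi> x $ i\<bar> \<le> K" for x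
      using component_le_norm_cart[of "grad UNIV \<phi> x" i] K(2)[of x] by simp
    note m = measurable_test[OF \<phi>]
    show "square_converges ?M (\<lambda>_. \<phi>) \<phi>"
      using H.square_integrable_bounded[OF m(1) K(1)] by (rule square_converges_const)
    show "square_converges ?M (\<lambda>_ x. grad UNIV \<phi> x $ i) (\<lambda>x. grad UNIV \<phi> x $ i)"
      using H.square_integrable_bounded[OF m(2) K'] by (rule square_converges_const)
    have "square_converges ?M (\<lambda>j x. \<phi> x * g j x $ i + grad UNIV \<phi> x $ i * u j x)
        (\<lambda>x. \<phi> x * G x $ i + grad UNIV \<phi> x $ i * w x)"
      by (intro square_converges_add square_converges_mult_bounded[OF G m(1) K(1)]
          square_converges_mult_bounded[OF w m(2) K'])
    then show "square_converges ?M (\<lambda>j x. (\<phi> x *\<^sub>R g j x + u j x *\<^sub>R grad UNIV \<phi> x) $ i)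
      (\<lambda>x. (\<phi> x *\<^sub>R G x + w x *\<^sub>R grad UNIV \<phi> x) $ i)"
      by (simp add: mult.commute)
  qed
  \<comment> \<open>The flux lemmas integrate over the half space, the conditions on the limit over
    the unit half ball; test functions in the unit ball do not see the difference.\<close>
  have restrict: "integral\<^sup>L (lebesgue_on upper) f = integral\<^sup>L ?M f"
    if "\<And>x. x \<in> upper \<Longrightarrow> 1 \<le> norm x \<Longrightarrow> f x = 0" for f :: "'n pt \<Rightarrow> real"
    using that half_ball_upper by (intro integral_extend_support(1)[symmetric]) (auto simp: mem_half_ball_0)
  have ball_test: "\<phi> x = 0" "grad UNIV \<phi> x = 0" if "\<phi> \<in> test_functions (ball 0 1)" "1 \<le> norm x"
    for \<phi> :: "'n pt \<Rightarrow> real" and x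
    using test_function_eq_0[OF that(1), of x] that(2) by auto
  have weak: "weak_partial (half_ball 0 1) i w (\<lambda>x. G x $ i)" for i
    unfolding weak_partial_def
  proof
    fix \<phi> :: "'n pt \<Rightarrow> real" assume \<phi>: "\<phi> \<in> test_functions (interior (half_ball 0 1))"
    have "weak_partial (half_ball 0 1) i (u j) (\<lambda>x. g j x $ i)" for j
      by (intro C1_weak_partial upper_C1_subset[OF C1_u] half_ball_mono) simp
    then have "(\<integral>x. u j x * grad UNIV \<phi> x $ i \<partial>?M) = - (\<integral>x. g j x $ i * \<phi> x \<partial>?M)" for j
      using \<phi> by (simp add: weak_partial_def)
    moreover have "(\<lambda>j. \<integral>x. u j x * grad UNIV \<phi> x $ i \<partial>?M) \<longlonglongrightarrow> (\<integral>x. w x * grad UNIV \<phi> x $ i \<partial>?M)"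
      by (rule square_converges_integral_mult[OF w grad_const[OF \<phi>]])
    moreover have "(\<lambda>j. - (\<integral>x. g j x $ i * \<phi> x \<partial>?M)) \<longlonglongrightarrow> - (\<integral>x. G x $ i * \<phi> x \<partial>?M)"
      by (intro tendsto_minus square_converges_integral_mult[OF G test_const[OF \<phi>]])
    ultimately show "(\<integral>x. w x * grad UNIV \<phi> x $ i \<partial>?M) = - (\<integral>x. G x $ i * \<phi> x \<partial>?M)"
      by (auto intro: LIMSEQ_unique)
  qed
  have div: "weakly_div_free (half_ball 0 1) G"
    unfolding weakly_div_free_def
  proof
    fix \<phi> :: "'n pt \<Rightarrow> real" assume \<phi>: "\<phi> \<in> test_functions (interior (half_ball 0 1))"
    have "interior (half_ball 0 1) \<subseteq> interior (half_ball (0::'n pt) 2)"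
      by (intro interior_mono half_ball_mono) simp
    then have \<phi>2: "\<phi> \<in> test_functions (interior (half_ball 0 2))"
      using \<phi> by (auto simp: test_functions_def)
    have "(\<integral>x. F j x \<bullet> grad UNIV \<phi> x \<partial>?M) = 0" for j
    proof -
      have "(\<integral>x. F j x \<bullet> grad UNIV \<phi> x \<partial>?M) = (\<integral>x. F j x \<bullet> grad UNIV \<phi> x \<partial>lebesgue_on (half_ball 0 2))"
      proof (rule integral_extend_support(1))
        show "half_ball (0::'n pt) 1 \<subseteq> half_ball 0 2"
          by (rule half_ball_mono) simp
        fix x :: "'n pt" assume "x \<in> half_ball 0 2 - half_ball 0 1"
        then have "x \<notin> interior (half_ball 0 1)"
          using interior_subset by blast
        then show "F j x \<bullet> grad UNIV \<phi> x = 0"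
          using test_function_eq_0(2)[OF \<phi>] by simp
      qed auto
      also have "\<dots> = 0"
        using signorini_flux_D(5)[OF sol] \<phi>2 by (simp add: weakly_div_free_def)
      finally show ?thesis .
    qed
    moreover have "(\<lambda>j. \<integral>x. F j x \<bullet> grad UNIV \<phi> x \<partial>?M) \<longlonglongrightarrow> (\<integral>x. G x \<bullet> grad UNIV \<phi> x \<partial>?M)"
      by (rule square_converges_inner[OF FG grad_const[OF \<phi>]])
    ultimately show "(\<integral>x. G x \<bullet> grad UNIV \<phi> x \<partial>?M) = 0"
      by (simp add: LIMSEQ_const_iff)
  qed
  have trace: "flat_trace w G T"
    unfolding flat_trace_def
  proof (intro allI impI)
    fix r :: real assume r: "0 < r \<and> r < 1"
    have sub: "half_ball (0::'n pt) r \<subseteq> half_ball 0 1" "ball (0::real ^ 'n) r \<subseteq> ball 0 1"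
      using r half_ball_mono[of r 1] by auto
    show "\<exists>v. (\<forall>k. C1_on (half_ball 0 r) (v k)) \<and> L2_converges (half_ball 0 r) v w \<and>
        (\<forall>i. L2_converges (half_ball 0 r) (\<lambda>k x. grad (half_ball 0 r) (v k) x $ i) (\<lambda>x. G x $ i)) \<and>
        L2_converges (ball 0 r) (\<lambda>k x'. v k (flat x')) T"
      unfolding L2_converges_iff
    \<comment> \<open>The rescalings are themselves the approximating C1 functions of the trace, the
      same ones for every radius.\<close>
    proof (intro exI[of _ u] conjI allI)
      show "C1_on (half_ball 0 r) (u k)" for k
        using r by (intro C1_on_half_ball[OF C1_u]) simp
      show "square_converges (lebesgue_on (half_ball 0 r)) u w"
        by (rule square_converges_subset[OF w _ _ sub(1)]) auto
      show "square_converges (lebesgue_on (half_ball 0 r)) (\<lambda>k x. grad (half_ball 0 r) (u k) x $ i) (\<lambda>x. G x $ i)" for i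
        using r by (intro square_converges_subset[OF G _ _ sub(1)]) (auto simp: grad_half_ball_eq[OF C1_u])
      show "square_converges (lebesgue_on (ball 0 r)) (\<lambda>k x'. u k (flat x')) T"
        by (rule square_converges_subset[OF T _ _ sub(2)]) auto
    qed
  qed
  have trace_nonneg: "AE x in lebesgue_on (ball 0 1). 0 \<le> T x"
  proof (rule square_converges_AE_nonneg[OF T])
    show "0 \<le> u k (flat x)" if "x \<in> space (lebesgue_on (ball 0 1))" for k x
    proof -
      have "flat x \<in> thin_ball 0 2"
        using that by (auto simp: thin_ball_def mem_half_ball_0 flat_upper)
      then show ?thesis
        using sol[of k] by (auto simp: signorini_flux_def)
    qed
  qed
  have flux: "0 \<le> (\<integral>x. G x \<bullet> grad UNIV \<phi> x \<partial>?M)"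
    if \<phi>: "\<phi> \<in> test_functions (ball 0 1)" and nn: "\<And>x. 0 \<le> \<phi> x" for \<phi>
  proof (rule LIMSEQ_le_const)
    show "(\<lambda>j. \<integral>x. F j x \<bullet> grad UNIV \<phi> x \<partial>?M) \<longlonglongrightarrow> (\<integral>x. G x \<bullet> grad UNIV \<phi> x \<partial>?M)"
      by (rule square_converges_inner[OF FG grad_const[OF \<phi>]])
    \<comment> \<open>Supports of test functions in the unit ball are within the strict inner radius
      1 of the domain of radius 2, as the flux lemmas require.\<close>
    have "0 \<le> (\<integral>x. F j x \<bullet> grad UNIV \<phi> x \<partial>lebesgue_on upper)" for j
      using ball_test[OF \<phi>] nn by (intro signorini_flux_nonneg[OF sol test_function_upper_C1[OF \<phi>], of 1]) auto
    then show "\<exists>N. \<forall>j\<ge>N. 0 \<le> (\<integral>x. F j x \<bullet> grad UNIV \<phi> x \<partial>?M)"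
      using ball_test[OF \<phi>] by (subst restrict[symmetric]) auto
  qed
  have compl: "(\<integral>x. G x \<bullet> (\<phi> x *\<^sub>R G x + w x *\<^sub>R grad UNIV \<phi> x) \<partial>?M) = 0"
    if \<phi>: "\<phi> \<in> test_functions (ball 0 1)" for \<phi>
  proof -
    have "(\<integral>x. F j x \<bullet> (\<phi> x *\<^sub>R g j x + u j x *\<^sub>R grad UNIV \<phi> x) \<partial>?M) = 0" for j
    proof -
      have "(\<integral>x. F j x \<bullet> (\<phi> x *\<^sub>R g j x + u j x *\<^sub>R grad UNIV \<phi> x) \<partial>lebesgue_on upper) = 0"
        using ball_test[OF \<phi>] by (intro signorini_flux_complementarity[OF sol test_function_upper_C1[OF \<phi>], of 1]) auto
      then show ?thesis
        using ball_test[OF \<phi>] by (subst restrict[symmetric]) auto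
    qed
    moreover have "(\<lambda>j. \<integral>x. F j x \<bullet> (\<phi> x *\<^sub>R g j x + u j x *\<^sub>R grad UNIV \<phi> x) \<partial>?M) \<longlonglongrightarrow>
        (\<integral>x. G x \<bullet> (\<phi> x *\<^sub>R G x + w x *\<^sub>R grad UNIV \<phi> x) \<partial>?M)"
      \<comment> \<open>The one limit that is quadratic in the gradient: flux and test field both
        vary with \<open>j\<close> and both converge strongly.\<close>
      by (rule square_converges_inner[OF FG product[OF \<phi>]])
    ultimately show ?thesis
      by (simp add: LIMSEQ_const_iff)
  qed
  have "w \<in> Lspace 2 (half_ball 0 1)" "\<And>i. (\<lambda>x. G x $ i) \<in> Lspace 2 (half_ball 0 1)"
    using w G unfolding Lspace_2_iff by (simp_all add: square_converges_def)
  then have "laplace_thin_obstacle_weak_solution w"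
    unfolding laplace_thin_obstacle_weak_solution_def
    using weak div trace trace_nonneg flux compl by blast
  then show ?thesis
    using w by blast
qed

end

section \<open>Coefficients near the origin and the choice of scales\<close>

lemma norm_matrix_vector_le:
  fixes M :: "real ^ 'm::finite ^ 'k::finite"
  shows "norm (M *v v) \<le> norm M * norm v"
proof -
  have "norm (M *v v) = L2_set (\<lambda>i. \<bar>M $ i \<bullet> v\<bar>) UNIV"
    by (simp add: norm_vec_def matrix_vector_mult_def inner_vec_def)
  \<comment> \<open>The norm of a matrix is its Frobenius norm here, the L2 norm of the norms of its
    rows, so Cauchy-Schwarz is used row by row.\<close>
  also have "\<dots> \<le> L2_set (\<lambda>i. norm (M $ i) * norm v) UNIV"
    by (intro L2_set_mono Cauchy_Schwarz_ineq2) auto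
  also have "\<dots> = norm M * norm v"
    by (simp add: norm_vec_def L2_set_left_distrib)
  finally show ?thesis .
qed

lemma near_identity:
  fixes a :: "'n::finite pt \<Rightarrow> real ^ ('n option) ^ ('n option)"
  assumes "continuous_on (half_ball 0 1) a" "a 0 = mat 1" "0 < \<epsilon>"
  obtains \<delta> where "0 < \<delta>" "\<delta> \<le> 1"
    "\<And>x v. x \<in> half_ball 0 \<delta> \<Longrightarrow> norm (a x *v v - v) \<le> \<epsilon> * norm v"
proof -
  have "0 \<in> half_ball (0::'n pt) 1"
    by (simp add: mem_half_ball_0 upper_def)
  then obtain d where d: "d > 0" "\<And>x. x \<in> half_ball 0 1 \<Longrightarrow> dist x 0 < d \<Longrightarrow> dist (a x) (a 0) < \<epsilon>"
    using assms(1,3) unfolding continuous_on_iff by metis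
  show thesis
  proof (rule that[of "min d 1"])
    fix x v :: "'n pt" assume x: "x \<in> half_ball 0 (min d 1)"
    then have "norm (a x - mat 1) \<le> \<epsilon>"
      using d(2)[of x] assms(2) by (auto simp: mem_half_ball_0 dist_norm)
    moreover have "a x *v v - v = (a x - mat 1) *v v"
      by (simp add: matrix_vector_mult_diff_rdistrib)
    ultimately show "norm (a x *v v - v) \<le> \<epsilon> * norm v"
      using norm_matrix_vector_le[of "a x - mat 1" v] mult_right_mono[of _ \<epsilon> "norm v"]
      by (metis norm_ge_zero order_trans)
  qed (use d in auto)
qed

theorem proposition4p4:
  fixes a :: "'n::finite pt \<Rightarrow> real ^ ('n option) ^ ('n option)"
    and w :: "'n pt \<Rightarrow> real" and p :: ereal and \<alpha> :: real
  assumes A0: "w \<in> Lspace 2 (half_ball 0 1)" "L2norm (half_ball 0 1) w = 1"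
    and A1: "\<And>x i. x \<in> thin_ball 0 1 \<Longrightarrow> a x $ Some i $ None = 0"
    and A2: "\<And>x. x \<in> half_ball 0 1 \<Longrightarrow> transpose (a x) = a x"
      "\<And>x l v. x \<in> half_ball 0 1 \<Longrightarrow> v \<noteq> 0 \<Longrightarrow> a x *v v = l *\<^sub>R v \<Longrightarrow> 1 / 2 \<le> l \<and> l \<le> 2"
    and A3: "ereal (real CARD('n) + 1) < p"
      "\<And>i j. (\<lambda>x. a x $ i $ j) \<in> W1_space p (half_ball 0 1)"
      "continuous_on (half_ball 0 1) a"
    and A4: "a 0 = mat 1"
    and W: "0 < \<alpha>" "\<alpha> \<le> 1 / 2" "C1_alpha_loc \<alpha> (half_ball 0 1) w"
    and solution: "thin_obstacle_solution a w"
    and free_bdry: "0 \<in> free_boundary w"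
    and finite_order: "vanishing_order w 0 < \<infinity>"
  shows "\<exists>(\<sigma> :: nat \<Rightarrow> real) w0.
    (\<forall>j. 0 < \<sigma> j \<and> \<sigma> j < 1) \<and> \<sigma> \<longlonglongrightarrow> 0 \<and>
    L2_converges (half_ball 0 1) (\<lambda>j. rescaling w (\<sigma> j)) w0 \<and>
    laplace_thin_obstacle_weak_solution w0 \<and>
    L2norm (half_ball 0 1) w0 = 1 \<and>
    \<not> (AE x in lebesgue_on (half_ball 0 1). w0 x = 0)"
proof -
  have C1: "C1_on (half_ball 0 1) w"
    using W(3) by (simp add: C1_alpha_loc_def)
  have cw: "continuous_on (half_ball 0 1) w"
    by (rule upper_C1_continuous[OF upper_C1_grad[OF C1] half_ball_upper])
  have iw: "integrable (lebesgue_on (half_ball 0 1)) (\<lambda>x. (w x)\<^sup>2)"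
    using A0(1) unfolding Lspace_2_iff by (rule square_integrable_D)
  obtain C where C: "\<And>\<epsilon>. 0 < \<epsilon> \<Longrightarrow> \<exists>r. 0 < r \<and> r < \<epsilon> \<and> 0 < mass w r \<and> mass w (2 * r) \<le> C * mass w r"
    by (rule doubling_scales[OF iw finite_order]) blast
  \<comment> \<open>Any null sequence starting within the threshold 1/4 of
    \<open>blowup_sequence\<close> would do.\<close>
  define e where "e j = 1 / (4 * real (Suc j))" for j
  \<comment> \<open>Good radii occur below every threshold, so the radius can be taken small enough
    for the coefficients to be \<open>e j\<close>-close to the identity on twice that radius. The
    bound \<open>1 / real (j + 3)\<close> forces convergence to 0 and keeps three times the radius
    within the unit half ball.\<close>
  have "\<exists>r. 0 < r \<and> r < 1 / real (j + 3) \<and> 0 < mass w r \<and> mass w (2 * r) \<le> C * mass w r \<and>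
      (\<forall>x\<in>half_ball 0 (2 * r). \<forall>v. norm (a x *v v - v) \<le> e j * norm v)" for j
  proof -
    have "0 < e j"
      by (simp add: e_def)
    then obtain \<delta> where \<delta>: "0 < \<delta>"
      "\<And>x v. x \<in> half_ball 0 \<delta> \<Longrightarrow> norm (a x *v v - v) \<le> e j * norm v"
      by (rule near_identity[OF A3(3) A4]) blast
    obtain r where r: "0 < r" "r < min (\<delta> / 2) (1 / real (j + 3))" "0 < mass w r" "mass w (2 * r) \<le> C * mass w r"
      using C[of "min (\<delta> / 2) (1 / real (j + 3))"] \<delta>(1) by auto
    then show ?thesis
      using \<delta>(2) half_ball_mono[of "2 * r" \<delta> 0] by (intro exI[of _ r]) auto
  qed
  then obtain \<sigma> where \<sigma>: "\<And>j. 0 < \<sigma> j" "\<And>j. \<sigma> j < 1 / real (j + 3)" "\<And>j. 0 < mass w (\<sigma> j)"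
    "\<And>j. mass w (2 * \<sigma> j) \<le> C * mass w (\<sigma> j)"
    and near: "\<And>j x v. x \<in> half_ball 0 (2 * \<sigma> j) \<Longrightarrow> norm (a x *v v - v) \<le> e j * norm v"
    by metis
  have \<sigma>3: "\<sigma> j * 3 \<le> 1" for j
  proof -
    have "1 / real (j + 3) \<le> 1 / 3"
      by (simp add: field_simps)
    then show ?thesis
      using \<sigma>(2)[of j] by linarith
  qed
  have \<sigma>0: "\<sigma> \<longlonglongrightarrow> 0"
  proof (rule tendsto_sandwich[of "\<lambda>_. 0"])
    show "(\<lambda>j. 1 / real (j + 3)) \<longlonglongrightarrow> 0"
      using LIMSEQ_ignore_initial_segment[OF lim_1_over_n, of 3] by simp
  qed (use \<sigma> in \<open>auto intro!: always_eventually less_imp_le\<close>)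
  have e14: "e j \<le> 1 / 4" "0 \<le> e j" for j
    by (simp_all add: e_def field_simps)
  define N where "N j = \<sigma> j powr (- (real CARD('n) + 1) / 2) * L2norm (half_ball 0 (\<sigma> j)) w" for j
  have N: "0 < N j" for j
    using \<sigma>(1,3)[of j] by (simp add: N_def L2norm_def mass_def)
  define u where "u j = rescaling w (\<sigma> j)" for j
  have u: "u j = (\<lambda>x. w (\<sigma> j *\<^sub>R x) / N j)" for j
    by (simp add: u_def rescaling_def N_def fun_eq_iff)
  define g where "g j x = (\<sigma> j / N j) *\<^sub>R grad (half_ball 0 1) w (\<sigma> j *\<^sub>R x)" for j x
  define F where "F j x = a (\<sigma> j *\<^sub>R x) *v g j x" for j x
  have mass_quot: "mass (u j) R = mass w (\<sigma> j * R) / mass w (\<sigma> j)" if "\<sigma> j * R \<le> 1" for j R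
    unfolding u_def by (rule mass_rescaling[OF cw \<sigma>(1) that \<sigma>(3)])
  interpret blowup_sequence u g F e C
  proof
    fix j
    show "signorini_flux 2 (u j) (g j) (F j)"
    proof -
      \<comment> \<open>Closeness to the identity on the normal unit vector puts this entry within
        1/4 of 1.\<close>
      have pos: "0 \<le> a x $ None $ None" if "x \<in> half_ball 0 (\<sigma> j * 2)" for x
      proof -
        let ?v = "axis None 1 :: 'n pt"
        have "\<bar>(a x *v ?v - ?v) $ None\<bar> \<le> e j * norm ?v"
          using component_le_norm_cart[of "a x *v ?v - ?v" None] near[of x j ?v] that
          by (simp add: mult.commute)
        moreover have "(a x *v ?v) $ None = a x $ None $ None"
          by (simp add: matrix_vector_mult_basis column_def)
        ultimately show ?thesis
          using e14(1)[of j] by simp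
      qed
      show ?thesis
        using signorini_flux_rescale[OF A1 A2(1) A3(3) C1 solution \<sigma>(1) _ N pos] \<sigma>3[of j] \<sigma>(1)[of j]
        unfolding u g_def[abs_def] F_def[abs_def] by simp
    qed
    \<comment> \<open>Radius 3 leaves a margin beyond 2: continuity on the half ball of radius 2
      alone would not give integrability up to its spherical boundary.\<close>
    have "continuous_on (half_ball 0 3) (u j)"
      using upper_C1_continuous[OF upper_C1_scale[OF upper_C1_grad[OF C1] \<sigma>(1) \<sigma>3] half_ball_upper]
      unfolding u .
    then show "integrable (lebesgue_on (half_ball 0 2)) (\<lambda>x. (u j x)\<^sup>2)"
      by (intro integrable_half_ball_inner[of 3] continuous_on_power) auto
    show "mass (u j) 2 \<le> C"
      using mass_quot[of j 2] \<sigma>3[of j] \<sigma>(1)[of j] \<sigma>(3)[of j] \<sigma>(4)[of j]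
      by (simp add: mult.commute pos_divide_le_eq)
    show "0 \<le> e j" "e j \<le> 1 / 4"
      by (rule e14)+
    show "norm (F j x - g j x) \<le> e j * norm (g j x)" if "x \<in> half_ball 0 2" for x
      using near[of "\<sigma> j *\<^sub>R x" j "g j x"] that scale_half_ball(1)[OF \<sigma>(1), of j x 2]
      by (simp add: F_def mult.commute)
  next
    have "(\<lambda>j. inverse (real (Suc j)) / 4) \<longlonglongrightarrow> 0 / 4"
      by (intro tendsto_intros LIMSEQ_inverse_real_of_nat) simp
    then show "e \<longlonglongrightarrow> 0"
      by (simp add: e_def[abs_def] field_simps)
  qed
  obtain s :: "nat \<Rightarrow> nat" and B where s: "strict_mono s"
    and B: "\<And>j. (\<integral>x. (norm (g j x))\<^sup>2 \<partial>lebesgue_on (half_ball 0 (3/2))) \<le> B"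
    and Cauchy: "\<And>\<epsilon>. 0 < \<epsilon> \<Longrightarrow>
      \<exists>N. \<forall>i\<ge>N. \<forall>j\<ge>N. (\<integral>x. (u (s i) x - u (s j) x)\<^sup>2 \<partial>lebesgue_on (half_ball 0 (3/2))) < \<epsilon>"
    by (rule compactness) blast
  interpret sub: convergent_blowup "\<lambda>j. u (s j)" "\<lambda>j. g (s j)" "\<lambda>j. F (s j)" "\<lambda>j. e (s j)" C B
    by (intro convergent_blowup.intro convergent_blowup_axioms.intro subsequence s B Cauchy)
  obtain w0 where conv: "square_converges (lebesgue_on (half_ball 0 1)) (\<lambda>j. u (s j)) w0"
    and w0: "laplace_thin_obstacle_weak_solution w0"
    using sub.ex_blowup_limit by blast
  \<comment> \<open>The constant mass survives because the convergence in L2 is strong.\<close>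
  have "mass (u j) 1 = 1" for j
    using mass_quot[of j 1] \<sigma>3[of j] \<sigma>(1)[of j] \<sigma>(3)[of j] by simp
  then have "(\<lambda>j. 1) \<longlonglongrightarrow> (\<integral>x. (w0 x)\<^sup>2 \<partial>lebesgue_on (half_ball 0 1))"
    using square_converges_norm[OF conv] by (simp add: mass_def)
  then have norm: "(\<integral>x. (w0 x)\<^sup>2 \<partial>lebesgue_on (half_ball 0 1)) = 1"
    by (simp add: LIMSEQ_const_iff)
  have "\<not> (AE x in lebesgue_on (half_ball 0 1). w0 x = 0)"
  proof
    assume "AE x in lebesgue_on (half_ball 0 1). w0 x = 0"
    then have "AE x in lebesgue_on (half_ball 0 1). (w0 x)\<^sup>2 = 0"
      by eventually_elim simp
    then have "(\<integral>x. (w0 x)\<^sup>2 \<partial>lebesgue_on (half_ball 0 1)) = 0"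
      by (rule integral_eq_zero_AE)
    then show False
      using norm by simp
  qed
  moreover have "L2_converges (half_ball 0 1) (\<lambda>j. rescaling w (\<sigma> (s j))) w0"
    using conv by (simp add: L2_converges_iff u_def)
  moreover have "(\<lambda>j. \<sigma> (s j)) \<longlonglongrightarrow> 0"
    using LIMSEQ_subseq_LIMSEQ[OF \<sigma>0 s] by (simp add: o_def)
  moreover have "0 < \<sigma> (s j) \<and> \<sigma> (s j) < 1" for j
    using \<sigma>(1)[of "s j"] \<sigma>3[of "s j"] by simp
  ultimately show ?thesis
    using w0 norm by (intro exI[of _ "\<lambda>j. \<sigma> (s j)"] exI[of _ w0]) (simp add: L2norm_def)
qed

end
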